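(* For $x_1>0$ let $A^{x_1}$ be Clarke's $G_2$-instanton on the Bryant--Salamon $G_2$-manifold $\mathbb{R}^4\times S^3$ and let $A^{\lim}$ be the $G_2$-instanton below: $$A^{x_1}=\frac{2x_1A_1^2}{1+x_1\left(B_1^2-\frac13\right)}\sum_{i=1}^3T_i\otimes\eta_i^+,\qquad A^{\lim}=\frac{A_1^2}{\frac12\left(B_1^2-\frac13\right)}\sum_{i=1}^3T_i\otimes\eta_i^+ .$$ Let $\{A^{x_1}\}$ be a sequence of such instantons with $x_1\to+\infty$. Then: (a) Given any $\lambda>0$ there is a sequence of positive real numbers $\delta=\delta(x_1,\lambda)\to0$ as $x_1\to+\infty$ such that for all $p\in S^3$ the connections $(s^p_\delta)^*A^{x_1}$ converge uniformly with all derivatives on the unit ball $B_1(0)\subset\mathbb{R}^4$ to the basic anti-self-dual instanton $$A_\lambda^{\mathrm{ASD}}=\frac{\lambda t^2}{1+\lambda t^2}\sum_{i=1}^3T_i\otimes\eta_i^+,$$ where $s_\delta^p:B_1(0)\to\mathbb{R}^4\times S^3$, $s^p_\delta(x)=(\delta x,p)$. (b) The connections $A^{x_1}$ converge uniformly with all derivatives to $A^{\lim}$ on every compact subset of $(\mathbb{R}^4\setminus\{0\})\times S^3$ as $x_1\to+\infty$. (c) The function $|F_{A^{x_1}}|^2-|F_{A^{\lim}}|^2$ is integrable on $\mathbb{R}^4\times S^3$ for all $x_1>0$, and as $x_1\to+\infty$ it converges to $8\pi^2\delta_{\{0\}\times S^3}$ as a current: for all compactly supported smooth functions $f$, $$\lim_{x_1\to+\infty}\int_{\mathbb{R}^4\times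 S^3}f\left(|F_{A^{x_1}}|^2-|F_{A^{\lim}}|^2\right)\mathrm{dvol}_g=8\pi^2\int_{\{0\}\times S^3}f\,\mathrm{dvol}_{g|_{\{0\}\times S^3}} .$$
   Context: Conventions: $SU(2)$ is identified with the unit quaternions; $\{T_i\}_{i=1}^3$ is a basis of $\mathfrak{su}(2)$ with $[T_i,T_j]=2\epsilon_{ijk}T_k$; $T_i^{\pm}=(T_i,\pm T_i)\in\mathfrak{su}(2)\oplus\mathfrak{su}(2)$; $\{\eta_i^{\pm}\}$ are the left-invariant 1-forms on $SU(2)^2$ dual to the basis $\{T_i^{\pm}\}$. Manifold: $\mathbb{R}^4\times S^3\subset\mathbb{H}\times\mathbb{H}$ with $SU(2)^2$ acting by $(a_1,a_2)\cdot(p,q)=(a_1p,a_1q\bar a_2)$. The complement of the singular orbit $\{0\}\times S^3$ is identified with $\mathbb{R}^+_t\times SU(2)^2$ via $(t,a_1,a_2)\mapsto(ta_1,a_1\bar a_2)$; thus $t=|p|$. On each fibre $(\mathbb{R}^4\setminus\{0\})\times\{q\}\cong\mathbb{R}^+_t\times S^3$ the forms $\eta_i^+$ restrict to the left-invariant coframe of $S^3=SU(2)$ dual to $\{T_i\}$; this is the meaning of $\eta_i^+$ in the formula for $A^{\mathrm{ASD}}_\lambda$ on $\mathbb{R}^4\setminus\{0\}=\mathbb{R}^+_t\times S^3$ (which extends smoothly over the origin). Bryant--Salamon structure: define $r\in[1,\infty)$ by $t(r)=\int_1^r(1-s^{-3})^{-1/2}ds$ and put $A_1=\frac r3\sqrt{1-r^{-3}}$,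 $B_1=\frac{r}{\sqrt3}$. The metric is $g=dt^2+\sum_i(2A_1)^2\eta_i^+\otimes\eta_i^++(2B_1)^2\eta_i^-\otimes\eta_i^-$, which extends smoothly over $\{0\}\times S^3$ and is the metric of a torsion-free $G_2$-structure. Both $A^{x_1}$ and $A^{\lim}$ are $SU(2)$-connections satisfying the $G_2$-instanton equation, written over $\mathbb{R}^+_t\times SU(2)^2$ as $\mathfrak{su}(2)$-valued 1-forms on the trivial bundle. The pointwise norm $|F|$ uses $g$ on forms and the invariant inner product $\langle X,Y\rangle=-\mathrm{tr}(XY)$ on $\mathfrak{su}(2)$ (so $|T_i|^2=2$). *)

theory Defs
  imports "HOL-Analysis.Analysis"
begin

section \<open>Quaternions, \<open>SU(2)\<close> and \<open>su(2)\<close>\<close>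

text \<open>A quaternion is a pair (real part, imaginary part).  With this product the norm of
  \<open>real \<times> (real^3)\<close> is the quaternion norm, \<open>SU(2) = S^3\<close> is \<open>sphere 0 1\<close>, and \<open>su(2)\<close> is the space
  of quaternions with vanishing real part.\<close>

type_synonym quat = "real \<times> (real^3)"

definition qmult :: "quat \<Rightarrow> quat \<Rightarrow> quat" (infixl \<open>\<odot>\<close> 70) where
  "x \<odot> y = (fst x * fst y - snd x \<bullet> snd y,
            fst x *\<^sub>R snd y + fst y *\<^sub>R snd x + cross3 (snd x) (snd y))"

definition qconj :: "quat \<Rightarrow> quat" where
  "qconj x = (fst x, - snd x)"

definition qcomm :: "quat \<Rightarrow> quat \<Rightarrow> quat" where
  "qcomm x y = x \<odot> y - y \<odot> x"

definition T :: "3 \<Rightarrow> quat" where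
  "T i = (0, axis i 1)"

text \<open>The standard isomorphism of the unit quaternions with \<open>SU(2)\<close>, extended linearly; the trace
  in the invariant inner product \<open>-tr(XY)\<close> is the trace of \<open>2 \<times> 2\<close> complex matrices.\<close>

definition su2_mat :: "quat \<Rightarrow> complex^2^2" where
  "su2_mat x = vector [vector [Complex (fst x) (snd x $ 1), Complex (snd x $ 2) (snd x $ 3)],
                       vector [Complex (- (snd x $ 2)) (snd x $ 3), Complex (fst x) (- (snd x $ 1))]]"

definition su2_inner :: "quat \<Rightarrow> quat \<Rightarrow> real" where
  "su2_inner X Y = - Re (trace (su2_mat X ** su2_mat Y))"

lemma su2_mat_qmult: "su2_mat (x \<odot> y) = su2_mat x ** su2_mat y"
  by (simp add: vec_eq_iff forall_2 su2_mat_def qmult_def matrix_matrix_mult_def sum_2 complex_eq_iff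
      cross3_def inner_vec_def sum_3 vector_3 vector_2 algebra_simps)

lemma su2_inner_eq: "su2_inner X Y = - 2 * fst (X \<odot> Y)"
  unfolding su2_inner_def su2_mat_qmult[symmetric]
  by (simp add: trace_def sum_2 su2_mat_def)

lemma su2_inner_T: "su2_inner (T i) (T j) = (if i = j then 2 else 0)"
  by (simp add: su2_inner_eq qmult_def T_def inner_axis_axis)

lemma norm_qmult: "norm (x \<odot> y) = norm x * norm y"
proof -
  have "(norm (x \<odot> y))\<^sup>2 = (norm x * norm y)\<^sup>2"
    by (simp add: power2_norm_eq_inner power_mult_distrib qmult_def inner_prod_def inner_vec_def
        sum_3 cross3_def vector_3) algebra
  then show ?thesis
    by (simp add: power2_eq_iff_nonneg)
qed

lemma qcomm_T: "qcomm (T 1) (T 2) = 2 *\<^sub>R T 3" "qcomm (T 2) (T 3) = 2 *\<^sub>R T 1"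
    "qcomm (T 3) (T 1) = 2 *\<^sub>R T 2"
  by (simp_all add: qcomm_def qmult_def T_def prod_eq_iff vec_eq_iff forall_3 cross3_def
      axis_def vector_3 inner_vec_def sum_3)


section \<open>Smooth maps and differential forms on open sets\<close>

text \<open>The iterated directional derivative \<open>D\<^sub>v\<^sub>1 (\<dots> (D\<^sub>v\<^sub>k f))\<close> for \<open>vs = [v1, \<dots>, vk]\<close>.\<close>

fun iter_deriv :: "'a::real_normed_vector list \<Rightarrow> ('a \<Rightarrow> 'b::real_normed_vector) \<Rightarrow> 'a \<Rightarrow> 'b" where
  "iter_deriv [] f = f"
| "iter_deriv (v # vs) f = (\<lambda>x. frechet_derivative (iter_deriv vs f) (at x) v)"

text \<open>For open \<open>U\<close> in a Euclidean space this is \<open>C\<^sup>\<infinity>\<close>: all iterated directional derivatives exist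
  and are differentiable, hence continuous.\<close>

definition smooth_on :: "'a::real_normed_vector set \<Rightarrow> ('a \<Rightarrow> 'b::real_normed_vector) \<Rightarrow> bool" where
  "smooth_on U f \<longleftrightarrow> (\<forall>vs. \<forall>x\<in>U. iter_deriv vs f differentiable (at x))"

text \<open>A \<open>'b\<close>-valued 1-form is a function of a point and a tangent vector.\<close>

type_synonym ('a, 'b) form1 = "'a \<Rightarrow> 'a \<Rightarrow> 'b"

definition pullback :: "('a \<Rightarrow> 'c) \<Rightarrow> ('c::real_normed_vector, 'b) form1 \<Rightarrow>
    ('a::real_normed_vector, 'b) form1" where
  "pullback \<phi> \<omega> = (\<lambda>x w. \<omega> (\<phi> x) (frechet_derivative \<phi> (at x) w))"

definition smooth_form :: "'a::real_normed_vector set \<Rightarrow> ('a, 'b::real_normed_vector) form1 \<Rightarrow> bool"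
  where "smooth_form U \<omega> \<longleftrightarrow> (\<forall>w. smooth_on U (\<lambda>x. \<omega> x w))"

text \<open>Smooth forms on the open set \<open>U\<close> that converge on \<open>S \<subseteq> U\<close>, uniformly with all derivatives.\<close>

definition converges_with_derivs ::
    "'a::real_normed_vector set \<Rightarrow> 'a set \<Rightarrow> ('n \<Rightarrow> ('a, 'b::real_normed_vector) form1) \<Rightarrow>
     ('a, 'b) form1 \<Rightarrow> 'n filter \<Rightarrow> bool" where
  "converges_with_derivs U S \<omega> \<omega>' F \<longleftrightarrow>
     (\<forall>\<^sub>F n in F. smooth_form U (\<omega> n)) \<and> smooth_form U \<omega>' \<and>
     (\<forall>w vs. uniform_limit S (\<lambda>n. iter_deriv vs (\<lambda>x. \<omega> n x w)) (iter_deriv vs (\<lambda>x. \<omega>' x w)) F)"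


section \<open>The manifold \<open>\<real>\<^sup>4 \<times> S\<^sup>3\<close>\<close>

definition M :: "(quat \<times> quat) set" where
  "M = UNIV \<times> sphere 0 1"

definition M_reg :: "(quat \<times> quat) set" where
  "M_reg = (UNIV - {0}) \<times> sphere 0 1"

definition sing_orbit :: "(quat \<times> quat) set" where
  "sing_orbit = {0} \<times> sphere 0 1"

definition tangent_M :: "quat \<times> quat \<Rightarrow> (quat \<times> quat) set" where
  "tangent_M x = {v. snd x \<bullet> snd v = 0}"

text \<open>For \<open>N\<close> a submanifold of dimension \<open>CARD('n)\<close>, these are the inverses of its charts (up to
  shrinking \<open>U\<close> to make \<open>\<phi>\<close> injective): immersions between manifolds of equal dimension are
  local diffeomorphisms.\<close>

definition local_param ::
    "'a::real_normed_vector set \<Rightarrow> (real^'n) set \<Rightarrow> (real^'n \<Rightarrow> 'a) \<Rightarrow> bool" where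
  "local_param N U \<phi> \<longleftrightarrow> open U \<and> smooth_on U \<phi> \<and> \<phi> ` U \<subseteq> N \<and>
     (\<forall>u\<in>U. inj (frechet_derivative \<phi> (at u)))"

text \<open>Forms on an open subset \<open>N\<close> of the 7-manifold \<open>M\<close> that converge on \<open>K \<subseteq> N\<close>, uniformly with all
  derivatives in local coordinates.\<close>

definition converges_with_derivs_on_compact ::
    "(quat \<times> quat) set \<Rightarrow> (quat \<times> quat) set \<Rightarrow> ('n \<Rightarrow> (quat \<times> quat, quat) form1) \<Rightarrow>
     (quat \<times> quat, quat) form1 \<Rightarrow> 'n filter \<Rightarrow> bool" where
  "converges_with_derivs_on_compact N K \<omega> \<omega>' F \<longleftrightarrow>
     (\<forall>(U :: (real^7) set) \<phi> C. local_param N U \<phi> \<and> compact C \<and> C \<subseteq> U \<and> \<phi> ` C \<subseteq> K \<longrightarrow>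
        converges_with_derivs U C (\<lambda>n. pullback \<phi> (\<omega> n)) (pullback \<phi> \<omega>') F)"

text \<open>Smooth functions of compact support on \<open>M\<close>; values outside \<open>M\<close> are irrelevant.\<close>

definition test_function :: "(quat \<times> quat \<Rightarrow> real) \<Rightarrow> bool" where
  "test_function f \<longleftrightarrow>
     (\<forall>(U :: (real^7) set) \<phi>. local_param M U \<phi> \<longrightarrow> smooth_on U (f \<circ> \<phi>)) \<and>
     (\<exists>K. compact K \<and> K \<subseteq> M \<and> (\<forall>x\<in>M - K. f x = 0))"


section \<open>Left-invariant forms\<close>

text \<open>The left-invariant coframe of \<open>SU(2)\<close> dual to \<open>T\<close>.\<close>

definition \<eta>\<^sub>L :: "3 \<Rightarrow> (quat, real) form1" where
  "\<eta>\<^sub>L i a v = snd (qconj a \<odot> v) $ i"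

text \<open>The left-invariant coframe of \<open>SU(2) \<times> SU(2)\<close> dual to \<open>T\<^sub>i\<^sup>\<plusminus> = (T\<^sub>i, \<plusminus>T\<^sub>i)\<close>; see \<open>eta_dual\<close>.\<close>

definition \<eta>G_plus :: "3 \<Rightarrow> (quat \<times> quat, real) form1" where
  "\<eta>G_plus i a v = (\<eta>\<^sub>L i (fst a) (fst v) + \<eta>\<^sub>L i (snd a) (snd v)) / 2"

definition \<eta>G_minus :: "3 \<Rightarrow> (quat \<times> quat, real) form1" where
  "\<eta>G_minus i a v = (\<eta>\<^sub>L i (fst a) (fst v) - \<eta>\<^sub>L i (snd a) (snd v)) / 2"

lemma qconj_qmult_cancel:
  assumes "norm a = 1" shows "qconj a \<odot> (a \<odot> x) = x"
proof -
  have "(fst a)\<^sup>2 + (snd a $ 1)\<^sup>2 + (snd a $ 2)\<^sup>2 + (snd a $ 3)\<^sup>2 = 1"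
    using assms by (simp add: norm_eq_1 inner_prod_def inner_vec_def sum_3 power2_eq_square)
  then show ?thesis
    by (simp add: qconj_def qmult_def prod_eq_iff vec_eq_iff forall_3 inner_vec_def sum_3
        cross3_def vector_3; algebra)
qed

lemma eta_dual:
  assumes "norm a1 = 1" "norm a2 = 1"
  shows "\<eta>G_plus i (a1, a2) (a1 \<odot> T j, a2 \<odot> T j) = (if i = j then 1 else 0)"
    and "\<eta>G_plus i (a1, a2) (a1 \<odot> T j, a2 \<odot> (- T j)) = 0"
    and "\<eta>G_minus i (a1, a2) (a1 \<odot> T j, a2 \<odot> T j) = 0"
    and "\<eta>G_minus i (a1, a2) (a1 \<odot> T j, a2 \<odot> (- T j)) = (if i = j then 1 else 0)"
  using assms
  by (simp_all add: \<eta>G_plus_def \<eta>G_minus_def \<eta>\<^sub>L_def qconj_qmult_cancel T_def axis_def)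

text \<open>The inverse of \<open>(t, a1, a2) \<mapsto> (t a1, a1 (qconj a2))\<close> is \<open>x \<mapsto> (norm (fst x), group_part x)\<close>.\<close>

definition group_part :: "quat \<times> quat \<Rightarrow> quat \<times> quat" where
  "group_part x = (sgn (fst x), qconj (snd x) \<odot> sgn (fst x))"

lemma group_part_orbit:
  assumes "t > 0" "norm a1 = 1" "norm a2 = 1"
  shows "norm (t *\<^sub>R a1) = t" and "group_part (t *\<^sub>R a1, a1 \<odot> qconj a2) = (a1, a2)"
proof -
  show "norm (t *\<^sub>R a1) = t" using assms by simp
  have 1: "(fst a1)\<^sup>2 + (snd a1 $ 1)\<^sup>2 + (snd a1 $ 2)\<^sup>2 + (snd a1 $ 3)\<^sup>2 = 1"
    using assms by (simp add: norm_eq_1 inner_prod_def inner_vec_def sum_3 power2_eq_square)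
  have "qconj (a1 \<odot> qconj a2) \<odot> a1 = a2"
    using 1 by (simp add: qconj_def qmult_def prod_eq_iff vec_eq_iff forall_3 inner_vec_def sum_3
        cross3_def vector_3; algebra)
  moreover have "sgn (t *\<^sub>R a1) = a1"
    using assms by (simp add: sgn_div_norm)
  ultimately show "group_part (t *\<^sub>R a1, a1 \<odot> qconj a2) = (a1, a2)"
    by (simp add: group_part_def)
qed

text \<open>The forms \<open>\<eta>\<^sub>i\<^sup>\<plusminus>\<close> and \<open>dt\<close> on \<open>M_reg\<close>.  The formulas make sense on the open set
  \<open>{x. fst x \<noteq> 0}\<close>; only the restriction to vectors tangent to \<open>M_reg\<close> is geometric.\<close>

definition \<eta>_plus :: "3 \<Rightarrow> (quat \<times> quat, real) form1" where
  "\<eta>_plus i = pullback group_part (\<eta>G_plus i)"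

definition \<eta>_minus :: "3 \<Rightarrow> (quat \<times> quat, real) form1" where
  "\<eta>_minus i = pullback group_part (\<eta>G_minus i)"

definition dt :: "(quat \<times> quat, real) form1" where
  "dt x v = frechet_derivative (\<lambda>y. norm (fst y)) (at x) v"


section \<open>The Bryant--Salamon metric\<close>

text \<open>The integrand is unbounded at \<open>s = 1\<close>, but the Henstock-Kurzweil integral converges.\<close>

definition t_of_r :: "real \<Rightarrow> real" where
  "t_of_r r = integral {1..r} (\<lambda>s. 1 / sqrt (1 - 1 / s ^ 3))"

definition r_of_t :: "real \<Rightarrow> real" where
  "r_of_t = the_inv_into {1..} t_of_r"

definition A1 :: "real \<Rightarrow> real" where
  "A1 t = r_of_t t / 3 * sqrt (1 - 1 / r_of_t t ^ 3)"

definition B1 :: "real \<Rightarrow> real" where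
  "B1 t = r_of_t t / sqrt 3"

definition bs_metric_reg :: "quat \<times> quat \<Rightarrow> quat \<times> quat \<Rightarrow> quat \<times> quat \<Rightarrow> real" where
  "bs_metric_reg x v w =
     dt x v * dt x w
     + (\<Sum>i\<in>UNIV. (2 * A1 (norm (fst x)))\<^sup>2 * (\<eta>_plus i x v * \<eta>_plus i x w))
     + (\<Sum>i\<in>UNIV. (2 * B1 (norm (fst x)))\<^sup>2 * (\<eta>_minus i x v * \<eta>_minus i x w))"

text \<open>On the singular orbit the metric is the extension by continuity from \<open>M_reg\<close>.\<close>

definition bs_metric :: "quat \<times> quat \<Rightarrow> quat \<times> quat \<Rightarrow> quat \<times> quat \<Rightarrow> real" where
  "bs_metric x v w =
     (if fst x = 0 then Lim (at x within M_reg) (\<lambda>y. bs_metric_reg y v w)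
      else bs_metric_reg x v w)"


section \<open>Riemannian volume\<close>

definition volume_density ::
    "('a::real_normed_vector \<Rightarrow> 'a \<Rightarrow> 'a \<Rightarrow> real) \<Rightarrow> (real^'n \<Rightarrow> 'a) \<Rightarrow> real^'n \<Rightarrow> real" where
  "volume_density g \<phi> u =
     sqrt (det (\<chi> i j. g (\<phi> u) (frechet_derivative \<phi> (at u) (axis i 1))
                               (frechet_derivative \<phi> (at u) (axis j 1))))"

text \<open>If \<open>\<phi>\<close> is an injective parametrization, defined on all of \<open>\<real>\<^sup>n\<close>, of the complement in \<open>N\<close> of a
  null set (a closed submanifold of lower dimension), then this is the completed Riemannian
  volume measure of \<open>(N, g)\<close>.  Thanks to the completion, integrands only matter almost everywhere;
  the curvature of \<open>A_lim\<close> below has no meaning on the singular orbit, a null set.\<close>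

definition param_volume ::
    "'a::real_normed_vector set \<Rightarrow> ('a \<Rightarrow> 'a \<Rightarrow> 'a \<Rightarrow> real) \<Rightarrow> (real^'n \<Rightarrow> 'a) \<Rightarrow> 'a measure" where
  "param_volume N g \<phi> =
     completion (distr (density lborel (\<lambda>u. ennreal (volume_density g \<phi> u)))
                       (restrict_space borel N) \<phi>)"

text \<open>Stereographic projection from the quaternion \<open>1\<close>, whose image is \<open>S\<^sup>3 - {1}\<close>.\<close>

definition stereo :: "real^3 \<Rightarrow> quat" where
  "stereo y = (((norm y)\<^sup>2 - 1) / ((norm y)\<^sup>2 + 1), (2 / ((norm y)\<^sup>2 + 1)) *\<^sub>R y)"

lemma norm_stereo: "norm (stereo y) = 1"
proof -
  define n where "n = (norm y)\<^sup>2"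
  have n: "n + 1 > 0" unfolding n_def by (simp add: add_nonneg_pos)
  have y: "y \<bullet> y = n" by (simp add: n_def power2_norm_eq_inner)
  have "stereo y \<bullet> stereo y = ((n - 1) / (n + 1))\<^sup>2 + (2 / (n + 1))\<^sup>2 * n"
    by (simp add: stereo_def inner_prod_def power2_eq_square[of "_ / _"] y flip: n_def)
  also have "\<dots> = ((n - 1)\<^sup>2 + 4 * n) / (n + 1)\<^sup>2"
    by (simp add: power_divide add_divide_distrib)
  also have "(n - 1)\<^sup>2 + 4 * n = (n + 1)\<^sup>2"
    by algebra
  finally show ?thesis
    using n by (simp add: norm_eq_1)
qed

definition param_M :: "real^7 \<Rightarrow> quat \<times> quat" where
  "param_M u = ((u $ 1, vector [u $ 2, u $ 3, u $ 4]), stereo (vector [u $ 5, u $ 6, u $ 7]))"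

definition param_sing :: "real^3 \<Rightarrow> quat \<times> quat" where
  "param_sing y = (0, stereo y)"

definition vol_M :: "(quat \<times> quat) measure" where
  "vol_M = param_volume M bs_metric param_M"

definition vol_sing :: "(quat \<times> quat) measure" where
  "vol_sing = param_volume sing_orbit bs_metric param_sing"


section \<open>Connections and curvature\<close>

definition A_clarke :: "real \<Rightarrow> (quat \<times> quat, quat) form1" where
  "A_clarke x1 x v =
     (let t = norm (fst x) in
      (2 * x1 * (A1 t)\<^sup>2 / (1 + x1 * ((B1 t)\<^sup>2 - 1 / 3))) *\<^sub>R (\<Sum>i\<in>UNIV. \<eta>_plus i x v *\<^sub>R T i))"

text \<open>Since \<open>A1 0 = 0\<close>, \<open>A_clarke x1\<close> vanishes over the singular orbit, and likewise
  \<open>A_ASD l\<close> at the origin; these are the values of the smooth extensions.\<close>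

definition A_lim :: "(quat \<times> quat, quat) form1" where
  "A_lim x v =
     (let t = norm (fst x) in
      ((A1 t)\<^sup>2 / (1 / 2 * ((B1 t)\<^sup>2 - 1 / 3))) *\<^sub>R (\<Sum>i\<in>UNIV. \<eta>_plus i x v *\<^sub>R T i))"

definition A_ASD :: "real \<Rightarrow> (quat, quat) form1" where
  "A_ASD l x v =
     (let t = norm x in
      (l * t\<^sup>2 / (1 + l * t\<^sup>2)) *\<^sub>R (\<Sum>i\<in>UNIV. pullback sgn (\<eta>\<^sub>L i) x v *\<^sub>R T i))"

definition slice :: "real \<Rightarrow> quat \<Rightarrow> quat \<Rightarrow> quat \<times> quat" where
  "slice \<delta> p x = (\<delta> *\<^sub>R x, p)"

text \<open>\<open>F = dA + [A \<and> A] / 2\<close>, computed in the ambient space; as exterior differentiation commutes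
  with restriction, its values on vectors tangent to \<open>M\<close> depend only on the restriction of \<open>A\<close>.\<close>

definition curvature :: "(quat \<times> quat, quat) form1 \<Rightarrow> quat \<times> quat \<Rightarrow> quat \<times> quat \<Rightarrow> quat \<times> quat \<Rightarrow> quat"
  where
  "curvature A x v w =
     frechet_derivative (\<lambda>y. A y w) (at x) v - frechet_derivative (\<lambda>y. A y v) (at x) w
     + qcomm (A x v) (A x w)"

definition bs_orthonormal_frame :: "quat \<times> quat \<Rightarrow> (7 \<Rightarrow> quat \<times> quat) \<Rightarrow> bool" where
  "bs_orthonormal_frame x e \<longleftrightarrow>
     (\<forall>i. e i \<in> tangent_M x) \<and> (\<forall>i j. bs_metric x (e i) (e j) = (if i = j then 1 else 0))"

text \<open>The squared norm of an \<open>su(2)\<close>-valued 2-form, the sum over \<open>i < j\<close> of \<open>\<bar>F(e\<^sub>i,e\<^sub>j)\<bar>\<^sup>2\<close>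
  (half the sum over all \<open>i, j\<close>) for any orthonormal frame \<open>e\<close>; it does not depend on the frame.\<close>

definition curv_norm2 :: "(quat \<times> quat, quat) form1 \<Rightarrow> quat \<times> quat \<Rightarrow> real" where
  "curv_norm2 A x =
     (let e = (SOME e. bs_orthonormal_frame x e);
          F = (\<lambda>i j. curvature A x (e i) (e j))
      in (\<Sum>i\<in>UNIV. \<Sum>j\<in>UNIV. su2_inner (F i j) (F i j)) / 2)"

end

theory Submission
  imports Defs "HOL-Real_Asymp.Real_Asymp"
begin

text \<open>Write \<open>r = r_of_t t\<close>.  As \<open>t\<^sup>2\<close> is a smooth function of \<open>r - 1\<close> with smooth inverse, both
  connections have the form \<open>profile e (\<bar>p\<bar>\<^sup>2) \<cdot> pform\<close>, where \<open>pform\<close> is polynomial in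
  \<open>(p, q, dp, dq)\<close> and \<open>e\<close> is \<open>1 / x1\<close>, or \<open>0\<close> for the limit.  This expression is jointly smooth in
  the point and a parameter that tends to \<open>0\<close> (\<open>1 / x1\<close>, or \<open>\<delta>\<close> after rescaling), so the convergence
  with all derivatives in (a) and (b) is mere continuity.

  For (c), the curvature in an orthonormal frame has three coefficients, rational functions
  of \<open>r\<close> and \<open>e\<close>.  The difference of the squared norms decays like \<open>r\<^sup>-\<^sup>8\<close> against a volume
  growth \<open>r\<^sup>6 dr\<close>.  After the rescaling \<open>p = \<surd>(3 / x1) p'\<close> of the fibre it is dominated
  by a multiple of \<open>(1 + \<bar>p'\<bar>\<^sup>2)\<^sup>-\<^sup>5\<^sup>/\<^sup>2\<close> and converges pointwise to the energy density of the
  anti-self-dual instanton on \<open>\<real>\<^sup>4\<close>, whose integral is \<open>8 \<pi>\<^sup>2\<close>.\<close>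

text \<open>The limit in (c) needs two separate estimates. At fixed \<open>x1\<close> integrability
  rests on decay at infinity, with a constant depending on \<open>x1\<close>. Concentration only
  needs a bound uniform in \<open>x1\<close> on the support of the test function, where r is
  bounded, so no decay uniform in \<open>x1\<close> is proved. Put x = e / (r^2 - 1 + e)^2. Each
  curvature coefficient is that of \<open>A_lim\<close> plus x times a function bounded for bounded
  r. In the difference of squares the x^2 term carries the mass: on the bubble x is of order 1/e,
  which compensates the factor e^2 of the rescaled volume. The cross term is smaller by a factor e.
  Since B1^2 - 1/3 = (r^2 - 1)/3, the curvature formulas use e = 3/x1 where \<open>profile\<close>
  uses 1/x1. Rescaling by sqrt (2 l / x1) produces the instanton of parameter l, so rescaling by
  sqrt e produces l = 3/2. Curvature and metric are computed from ambient derivatives, so the forms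
  are written for all q near the sphere, not only for unit q. In one global chart the volume density
  is a product of a radial function of p and the round density in q, which reduces all integrals to
  Lebesgue integrals on R^4 and R^3.\<close>

section \<open>Calculus of smooth maps\<close>

text \<open>A recursive form of \<open>smooth_on\<close> in which closure properties are proved by induction on the order.\<close>

primrec Ck_on :: "nat \<Rightarrow> 'a::real_normed_vector set \<Rightarrow> ('a \<Rightarrow> 'b::real_normed_vector) \<Rightarrow> bool" where
  "Ck_on 0 U f \<longleftrightarrow> True"
| "Ck_on (Suc k) U f \<longleftrightarrow>
     (\<exists>f'. (\<forall>x\<in>U. (f has_derivative f' x) (at x)) \<and> (\<forall>v. Ck_on k U (\<lambda>x. f' x v)))"

lemma Ck_onI:
  assumes "\<And>x. x \<in> U \<Longrightarrow> (f has_derivative f' x) (at x)" "\<And>v. Ck_on k U (\<lambda>x. f' x v)"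
  shows "Ck_on (Suc k) U f"
  using assms by auto

lemma has_derivative_cong_open:
  assumes "open U" "x \<in> U" "\<And>y. y \<in> U \<Longrightarrow> f y = g y"
  shows "(f has_derivative D) (at x) \<longleftrightarrow> (g has_derivative D) (at x)"
  using assms by (metis has_derivative_transform_within_open)

lemma frechet_derivative_cong_open:
  assumes "open U" "x \<in> U" "\<And>y. y \<in> U \<Longrightarrow> f y = g y"
  shows "frechet_derivative f (at x) = frechet_derivative g (at x)"
proof -
  have "(f has_derivative D) (at x) = (g has_derivative D) (at x)" for D
    by (rule has_derivative_cong_open[OF assms])
  then show ?thesis by (simp only: frechet_derivative_def)
qed

lemma Ck_on_cong:
  assumes "open U" "Ck_on k U f" "\<And>x. x \<in> U \<Longrightarrow> f x = g x"
  shows "Ck_on k U g"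
proof (cases k)
  case (Suc j)
  with assms(2) obtain f' where "\<And>x. x \<in> U \<Longrightarrow> (f has_derivative f' x) (at x)"
      "\<And>v. Ck_on j U (\<lambda>x. f' x v)"
    by auto
  then show ?thesis
    unfolding Suc using has_derivative_cong_open[OF assms(1) _ assms(3)] by (intro Ck_onI) auto
qed simp

text \<open>Derivatives at a point are unique, so any witness \<open>f'\<close> equals
  \<open>frechet_derivative f\<close> on \<open>U\<close>. This ties the existential in
  \<open>Ck_on\<close> to the derivative that \<open>iter_deriv\<close> uses.\<close>

lemma Ck_on_Suc_iff:
  assumes "open U"
  shows "Ck_on (Suc k) U f \<longleftrightarrow>
    (\<forall>x\<in>U. f differentiable (at x)) \<and> (\<forall>v. Ck_on k U (\<lambda>x. frechet_derivative f (at x) v))"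
    (is "?L \<longleftrightarrow> ?R")
proof
  assume ?L
  then obtain f' where f': "\<And>x. x \<in> U \<Longrightarrow> (f has_derivative f' x) (at x)"
      "\<And>v. Ck_on k U (\<lambda>x. f' x v)"
    by auto
  then have "\<And>x. x \<in> U \<Longrightarrow> f' x = frechet_derivative f (at x)"
    by (intro frechet_derivative_at)
  then show ?R
    using f' Ck_on_cong[OF assms f'(2)] by (auto simp: differentiable_def)
next
  assume ?R
  then show ?L
    by (intro Ck_onI[where f' = "\<lambda>x. frechet_derivative f (at x)"])
      (auto simp: frechet_derivative_works[symmetric])
qed

lemma Ck_on_Suc_imp: "Ck_on (Suc k) U f \<Longrightarrow> Ck_on k U f"
proof (induction k arbitrary: f)
  case (Suc k)
  then show ?case by (subst (asm) Ck_on.simps, subst Ck_on.simps) blast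
qed simp

lemma iter_deriv_append: "iter_deriv (vs @ ws) f = iter_deriv vs (iter_deriv ws f)"
  by (induction vs) auto

lemma iter_deriv_cong_open:
  assumes "open U" "x \<in> U" "\<And>y. y \<in> U \<Longrightarrow> f y = g y"
  shows "iter_deriv vs f x = iter_deriv vs g x"
  using assms(2)
proof (induction vs arbitrary: x)
  case (Cons v vs)
  then show ?case
    by (simp add: frechet_derivative_cong_open[OF assms(1), of x "iter_deriv vs f" "iter_deriv vs g"])
qed (use assms in auto)

lemma smooth_on_imp_differentiable: "smooth_on U f \<Longrightarrow> x \<in> U \<Longrightarrow> f differentiable (at x)"
  unfolding smooth_on_def by (metis iter_deriv.simps(1))

lemma smooth_on_frechet_derivative:
  assumes "smooth_on U f" shows "smooth_on U (\<lambda>x. frechet_derivative f (at x) v)"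
proof -
  have "iter_deriv vs (\<lambda>x. frechet_derivative f (at x) v) = iter_deriv (vs @ [v]) f" for vs
    by (simp add: iter_deriv_append)
  with assms show ?thesis unfolding smooth_on_def by presburger
qed

lemma smooth_on_iter_deriv: "smooth_on U f \<Longrightarrow> smooth_on U (iter_deriv vs f)"
proof -
  assume "smooth_on U f"
  then have "\<forall>ws. \<forall>x\<in>U. iter_deriv (ws @ vs) f differentiable (at x)"
    unfolding smooth_on_def by blast
  then show ?thesis unfolding smooth_on_def iter_deriv_append by blast
qed

text \<open>\<open>iter_deriv\<close> adds the head of the list as the outermost derivative, while
  \<open>Ck_on\<close> strips the innermost one. One direction therefore appends a vector at the end
  of the list, the other puts one in front.\<close>

lemma smooth_on_iff_Ck_on:
  assumes "open U"
  shows "smooth_on U f \<longleftrightarrow> (\<forall>k. Ck_on k U f)"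
proof
  show "smooth_on U f \<Longrightarrow> \<forall>k. Ck_on k U f"
  proof
    fix k assume "smooth_on U f"
    then show "Ck_on k U f"
    proof (induction k arbitrary: f)
      case (Suc k)
      then show ?case
        using smooth_on_frechet_derivative smooth_on_imp_differentiable
        unfolding Ck_on_Suc_iff[OF assms] by blast
    qed simp
  qed
next
  assume "\<forall>k. Ck_on k U f"
  then have "\<forall>k. Ck_on k U (iter_deriv vs f)" for vs
  proof (induction vs)
    case (Cons v vs)
    then have "\<forall>k. Ck_on (Suc k) U (iter_deriv vs f)" by blast
    then show ?case by (simp only: Ck_on_Suc_iff[OF assms] iter_deriv.simps) blast
  qed simp
  then show "smooth_on U f"
    unfolding smooth_on_def using Ck_on_Suc_iff[OF assms] by blast
qed

lemma smooth_on_cong: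
  assumes "open U" "smooth_on U f" "\<And>x. x \<in> U \<Longrightarrow> f x = g x"
  shows "smooth_on U g"
  using assms Ck_on_cong unfolding smooth_on_iff_Ck_on[OF assms(1)] by metis

lemma smooth_on_subset: "smooth_on U f \<Longrightarrow> V \<subseteq> U \<Longrightarrow> smooth_on V f"
  unfolding smooth_on_def by blast

lemma smooth_on_imp_continuous_on: "smooth_on U f \<Longrightarrow> continuous_on U f"
  by (meson continuous_at_imp_continuous_on differentiable_imp_continuous_within smooth_on_imp_differentiable)

lemma Ck_on_const: "Ck_on k U (\<lambda>_. c)"
proof (induction k arbitrary: c)
  case (Suc k)
  then show ?case by (intro Ck_onI[where f' = "\<lambda>_ _. 0"]) auto
qed simp

lemma Ck_on_linear: "bounded_linear f \<Longrightarrow> Ck_on k U f"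
proof (cases k)
  case (Suc j)
  assume "bounded_linear f"
  then show ?thesis unfolding Suc
    by (intro Ck_onI[where f' = "\<lambda>_. f"] Ck_on_const) (auto intro: bounded_linear_imp_has_derivative)
qed simp

lemma Ck_on_add: "Ck_on k U f \<Longrightarrow> Ck_on k U g \<Longrightarrow> Ck_on k U (\<lambda>x. f x + g x)"
proof (induction k arbitrary: f g)
  case (Suc k)
  from Suc.prems(1) obtain f' where
    "\<And>x. x \<in> U \<Longrightarrow> (f has_derivative f' x) (at x)" "\<And>v. Ck_on k U (\<lambda>x. f' x v)"
    by auto
  moreover from Suc.prems(2) obtain g' where
    "\<And>x. x \<in> U \<Longrightarrow> (g has_derivative g' x) (at x)" "\<And>v. Ck_on k U (\<lambda>x. g' x v)"
    by auto
  ultimately show ?case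
    using Suc.IH by (intro Ck_onI[where f' = "\<lambda>x v. f' x v + g' x v"] has_derivative_add) auto
qed simp

lemma Ck_on_sum: "(\<And>i. i \<in> I \<Longrightarrow> Ck_on k U (f i)) \<Longrightarrow> Ck_on k U (\<lambda>x. \<Sum>i\<in>I. f i x)"
  by (induction I rule: infinite_finite_induct) (auto intro: Ck_on_add Ck_on_const)

lemma Ck_on_bilinear:
  assumes "bounded_bilinear B"
  shows "Ck_on k U f \<Longrightarrow> Ck_on k U g \<Longrightarrow> Ck_on k U (\<lambda>x. B (f x) (g x))"
proof (induction k arbitrary: f g)
  case (Suc k)
  from Suc.prems(1) obtain f' where
    "\<And>x. x \<in> U \<Longrightarrow> (f has_derivative f' x) (at x)" "\<And>v. Ck_on k U (\<lambda>x. f' x v)"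
    by auto
  moreover from Suc.prems(2) obtain g' where
    "\<And>x. x \<in> U \<Longrightarrow> (g has_derivative g' x) (at x)" "\<And>v. Ck_on k U (\<lambda>x. g' x v)"
    by auto
  ultimately show ?case
    using Suc.IH Suc.prems[THEN Ck_on_Suc_imp]
    by (intro Ck_onI[where f' = "\<lambda>x v. B (f x) (g' x v) + B (f' x v) (g x)"]
        bounded_bilinear.FDERIV[OF assms] Ck_on_add) auto
qed simp

lemma Ck_on_compose:
  fixes f :: "'b::euclidean_space \<Rightarrow> 'c::real_normed_vector"
  assumes "\<And>x. x \<in> U \<Longrightarrow> g x \<in> V"
  shows "Ck_on k V f \<Longrightarrow> Ck_on k U g \<Longrightarrow> Ck_on k U (\<lambda>x. f (g x))"
proof (induction k arbitrary: f)
  case (Suc k)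
  from Suc.prems(1) obtain f' where
    f': "\<And>x. x \<in> V \<Longrightarrow> (f has_derivative f' x) (at x)" "\<And>v. Ck_on k V (\<lambda>x. f' x v)"
    by auto
  from Suc.prems(2) obtain g' where
    g': "\<And>x. x \<in> U \<Longrightarrow> (g has_derivative g' x) (at x)" "\<And>v. Ck_on k U (\<lambda>x. g' x v)"
    by auto
  show ?case
  proof (rule Ck_onI)
    \<comment> \<open>The induction hypothesis covers \<open>f'\<close> only in a fixed direction,
      but \<open>g' x v\<close> moves with x. Expanding it in the basis leaves fixed directions b
      with smooth coefficients.\<close>
    show "((\<lambda>x. f (g x)) has_derivative (\<lambda>v. \<Sum>b\<in>Basis. (g' x v \<bullet> b) *\<^sub>R f' (g x) b)) (at x)"
      if "x \<in> U" for x
    proof -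
      have lin: "linear (f' (g x))"
        using f'(1)[OF assms[OF that]] has_derivative_linear by blast
      have "(\<lambda>v. f' (g x) (g' x v)) = (\<lambda>v. \<Sum>b\<in>Basis. (g' x v \<bullet> b) *\<^sub>R f' (g x) b)"
        by (subst (1) euclidean_representation[symmetric])
          (simp add: linear_sum[OF lin] linear_scale[OF lin])
      then show ?thesis
        using has_derivative_compose[OF g'(1)[OF that] f'(1)[OF assms[OF that]]] by simp
    qed
    show "Ck_on k U (\<lambda>x. \<Sum>b\<in>Basis. (g' x v \<bullet> b) *\<^sub>R f' (g x) b)" for v
      using Suc.prems[THEN Ck_on_Suc_imp] g' f'
      by (intro Ck_on_sum Ck_on_bilinear[OF bounded_bilinear_scaleR]
          Ck_on_bilinear[OF bounded_bilinear_inner] Suc.IH Ck_on_const) auto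
  qed
qed simp

lemma Ck_on_real_derivative:
  fixes f :: "real \<Rightarrow> real"
  assumes "\<And>x. x \<in> U \<Longrightarrow> (f has_field_derivative f' x) (at x)" "Ck_on k U f'"
  shows "Ck_on (Suc k) U f"
  using assms
  by (intro Ck_onI[where f' = "\<lambda>x v. f' x * v"] Ck_on_bilinear[OF bounded_bilinear_mult] Ck_on_const)
    (auto simp: has_field_derivative_def)

lemma Ck_on_inverse: "Ck_on k (- {0}) (inverse :: real \<Rightarrow> real)"
proof (induction k)
  case (Suc k)
  have "Ck_on k (- {0}) (\<lambda>x::real. - 1 * (inverse x * inverse x))"
    by (intro Ck_on_bilinear[OF bounded_bilinear_mult] Suc Ck_on_const)
  then show ?case
    by (rule Ck_on_real_derivative[rotated]) (auto intro!: derivative_eq_intros)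
qed simp

lemma Ck_on_sqrt: "Ck_on k {0<..} sqrt"
proof (induction k)
  case (Suc k)
  have "Ck_on k {0<..} (\<lambda>x. inverse (sqrt x) * (1 / 2))"
    by (intro Ck_on_bilinear[OF bounded_bilinear_mult] Ck_on_const
        Ck_on_compose[OF _ Ck_on_inverse, where g = sqrt] Suc) auto
  then show ?case
    by (intro Ck_on_real_derivative[where f' = "\<lambda>x. inverse (sqrt x) * (1 / 2)"])
      (auto intro!: derivative_eq_intros simp: field_simps)
qed simp

lemma smooth_on_const: "smooth_on U (\<lambda>_. c)"
proof -
  have "iter_deriv vs (\<lambda>_. c) = (\<lambda>_. if vs = [] then c else 0)" for vs :: "'a list"
    by (induction vs) auto
  then show ?thesis by (simp add: smooth_on_def)
qed

lemma smooth_on_inverse: "smooth_on (- {0}) (inverse :: real \<Rightarrow> real)"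
  using Ck_on_inverse by (subst smooth_on_iff_Ck_on) auto

lemma smooth_on_sqrt_pos: "smooth_on {0<..} sqrt"
  using Ck_on_sqrt by (subst smooth_on_iff_Ck_on) auto

context
  fixes U :: "'a::real_normed_vector set"
  assumes U: "open U"
begin

lemma smooth_on_linear: "bounded_linear f \<Longrightarrow> smooth_on U f"
  by (simp add: smooth_on_iff_Ck_on[OF U] Ck_on_linear)

lemma smooth_on_add: "smooth_on U f \<Longrightarrow> smooth_on U g \<Longrightarrow> smooth_on U (\<lambda>x. f x + g x)"
  by (simp add: smooth_on_iff_Ck_on[OF U] Ck_on_add)

lemma smooth_on_bilinear:
  "bounded_bilinear B \<Longrightarrow> smooth_on U f \<Longrightarrow> smooth_on U g \<Longrightarrow> smooth_on U (\<lambda>x. B (f x) (g x))"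
  by (simp add: smooth_on_iff_Ck_on[OF U] Ck_on_bilinear)

lemma smooth_on_compose:
  fixes f :: "'b::euclidean_space \<Rightarrow> 'c::real_normed_vector"
  assumes "open V" "smooth_on V f" "smooth_on U g" "\<And>x. x \<in> U \<Longrightarrow> g x \<in> V"
  shows "smooth_on U (\<lambda>x. f (g x))"
  using assms Ck_on_compose[of U g V _ f] by (simp add: smooth_on_iff_Ck_on U)

lemma smooth_on_bounded_linear:
  fixes g :: "'a \<Rightarrow> 'b::euclidean_space"
  shows "bounded_linear f \<Longrightarrow> smooth_on U g \<Longrightarrow> smooth_on U (\<lambda>x. f (g x))"
  using Ck_on_compose[of U g UNIV _ f] by (simp add: smooth_on_iff_Ck_on U Ck_on_linear)

lemma smooth_on_scaleR:
  "smooth_on U f \<Longrightarrow> smooth_on U g \<Longrightarrow> smooth_on U (\<lambda>x. f x *\<^sub>R g x)"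
  by (rule smooth_on_bilinear[OF bounded_bilinear_scaleR])

lemma smooth_on_inner:
  "smooth_on U f \<Longrightarrow> smooth_on U g \<Longrightarrow> smooth_on U (\<lambda>x. f x \<bullet> g x)"
  by (rule smooth_on_bilinear[OF bounded_bilinear_inner])

lemma smooth_on_mult:
  fixes f g :: "'a \<Rightarrow> real"
  shows "smooth_on U f \<Longrightarrow> smooth_on U g \<Longrightarrow> smooth_on U (\<lambda>x. f x * g x)"
  by (rule smooth_on_bilinear[OF bounded_bilinear_mult])

lemma smooth_on_diff:
  fixes f g :: "'a \<Rightarrow> 'b::real_normed_vector"
  assumes "smooth_on U f" "smooth_on U g" shows "smooth_on U (\<lambda>x. f x - g x)"
  using smooth_on_add[OF assms(1) smooth_on_scaleR[OF smooth_on_const[of U "- 1"] assms(2)]] by simp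

lemma smooth_on_power:
  fixes f :: "'a \<Rightarrow> real"
  assumes "smooth_on U f" shows "smooth_on U (\<lambda>x. f x ^ n)"
  by (induction n) (auto intro: smooth_on_const smooth_on_mult assms)

lemma smooth_on_divide:
  fixes f g :: "'a \<Rightarrow> real"
  assumes "smooth_on U f" "smooth_on U g" "\<And>x. x \<in> U \<Longrightarrow> g x \<noteq> 0"
  shows "smooth_on U (\<lambda>x. f x / g x)"
proof -
  have "smooth_on U (\<lambda>x. inverse (g x))"
    by (rule smooth_on_compose[of "- {0}" inverse g]) (use assms smooth_on_inverse in auto)
  from smooth_on_mult[OF assms(1) this] show ?thesis by (simp add: divide_inverse)
qed

lemma smooth_on_sqrt:
  assumes "smooth_on U f" "\<And>x. x \<in> U \<Longrightarrow> f x > 0"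
  shows "smooth_on U (\<lambda>x. sqrt (f x))"
  by (rule smooth_on_compose[of "{0<..}" sqrt f]) (use assms smooth_on_sqrt_pos in auto)

lemma smooth_on_Pair:
  fixes f :: "'a \<Rightarrow> 'b::euclidean_space" and g :: "'a \<Rightarrow> 'c::euclidean_space"
  assumes "smooth_on U f" "smooth_on U g" shows "smooth_on U (\<lambda>x. (f x, g x))"
proof -
  have "smooth_on U (\<lambda>x. (f x, 0) + (0, g x))"
    by (intro smooth_on_add smooth_on_bounded_linear[where f = "\<lambda>y. (y, 0)", OF _ assms(1)]
        smooth_on_bounded_linear[where f = "\<lambda>y. (0, y)", OF _ assms(2)] bounded_linear_intros)
  then show ?thesis by simp
qed

end

lemma smooth_on_fst: 
  fixes g :: "'a::real_normed_vector \<Rightarrow> 'b::euclidean_space \<times> 'c::euclidean_space"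
  shows "open U \<Longrightarrow> smooth_on U g \<Longrightarrow> smooth_on U (\<lambda>x. fst (g x))"
  using smooth_on_bounded_linear[OF _ bounded_linear_fst, of U g] .

lemma smooth_on_snd: 
  fixes g :: "'a::real_normed_vector \<Rightarrow> 'b::euclidean_space \<times> 'c::euclidean_space"
  shows "open U \<Longrightarrow> smooth_on U g \<Longrightarrow> smooth_on U (\<lambda>x. snd (g x))"
  using smooth_on_bounded_linear[OF _ bounded_linear_snd, of U g] .

lemma smooth_on_ident: "open U \<Longrightarrow> smooth_on U (\<lambda>x. x)"
  by (rule smooth_on_linear[OF _ bounded_linear_ident])

text \<open>Bootstrapping: g' = 1 / (f' o g) is as regular as g itself, so each order of
  differentiability of g gives the next.\<close>

lemma smooth_on_inverse_function:
  fixes f g f' :: "real \<Rightarrow> real"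
  assumes "open U" "open V" "smooth_on U f'"
    and f: "\<And>x. x \<in> U \<Longrightarrow> (f has_field_derivative f' x) (at x)" "\<And>x. x \<in> U \<Longrightarrow> f' x \<noteq> 0"
    and g: "continuous_on V g" "\<And>y. y \<in> V \<Longrightarrow> g y \<in> U \<and> f (g y) = y"
  shows "smooth_on V g"
proof -
  have g': "(g has_field_derivative inverse (f' (g y))) (at y)" if "y \<in> V" for y
  proof (rule has_field_derivative_inverse_basic)
    show "(f has_field_derivative f' (g y)) (at (g y))" "f' (g y) \<noteq> 0"
      using that f g by auto
    show "continuous (at y) g"
      using that g(1) assms(2) continuous_on_eq_continuous_at by blast
  qed (use that assms g in auto)
  have "Ck_on k V g" for k
  proof (induction k)
    case (Suc k)
    have f'k: "Ck_on k U f'" using assms by (simp add: smooth_on_iff_Ck_on)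
    have "Ck_on k V (\<lambda>y. inverse (f' (g y)))"
      by (rule Ck_on_compose[OF _ Ck_on_inverse Ck_on_compose[OF _ f'k Suc]]) (use f g in auto)
    then show ?case
      using Ck_on_real_derivative[of V g "\<lambda>y. inverse (f' (g y))"] g' by blast
  qed simp
  then show ?thesis using assms(2) by (simp add: smooth_on_iff_Ck_on)
qed


section \<open>Convergence with all derivatives from joint smoothness\<close>

text \<open>Differentiating a slice along v is differentiating F along (0, v). Hence all derivatives
  of the whole family are slices of one function on \<open>W\<close>.\<close>

lemma iter_deriv_slice:
  fixes F :: "'p::euclidean_space \<times> 'a::euclidean_space \<Rightarrow> 'b::real_normed_vector"
  assumes "open W" "smooth_on W F" "(e, x) \<in> W"
  shows "iter_deriv vs (\<lambda>y. F (e, y)) x = iter_deriv (map (Pair 0) vs) F (e, x)"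
  using assms(3)
proof (induction vs arbitrary: x)
  case (Cons v vs)
  let ?G = "iter_deriv (map (Pair 0) vs) F"
  have op: "open {y. (e, y) \<in> W}"
    using open_vimage[OF assms(1), of "Pair e"] by (simp add: vimage_def continuous_on_Pair)
  have "(?G has_derivative frechet_derivative ?G (at (e, x))) (at (e, x))"
    using assms(2) Cons.prems frechet_derivative_works smooth_on_def by blast
  moreover have "(Pair e has_derivative Pair 0) (at x)"
    by (auto intro!: derivative_eq_intros)
  ultimately have "((\<lambda>y. ?G (e, y)) has_derivative (\<lambda>v. frechet_derivative ?G (at (e, x)) (0, v))) (at x)"
    using has_derivative_compose by blast
  then have "frechet_derivative (\<lambda>y. ?G (e, y)) (at x) v = frechet_derivative ?G (at (e, x)) (0, v)"
    by (metis frechet_derivative_at)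
  moreover have "frechet_derivative (iter_deriv vs (\<lambda>y. F (e, y))) (at x)
      = frechet_derivative (\<lambda>y. ?G (e, y)) (at x)"
    by (rule frechet_derivative_cong_open[OF op]) (use Cons in auto)
  ultimately show ?case by simp
qed simp

text \<open>A tube of radius d/2 around the compact set {0} x C still lies in \<open>W\<close>, and
  G is uniformly continuous on it.\<close>

lemma uniform_limit_slice:
  fixes G :: "'p::euclidean_space \<times> 'a::euclidean_space \<Rightarrow> 'b::real_normed_vector"
  assumes "open W" "continuous_on W G" "compact C" "{0} \<times> C \<subseteq> W" "(e \<longlongrightarrow> 0) F"
  shows "uniform_limit C (\<lambda>n x. G (e n, x)) (\<lambda>x. G (0, x)) F"
proof -
  have "compact ({0::'p} \<times> C)" using assms by (intro compact_Times) auto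
  then obtain d where d: "d > 0" "(\<Union>z\<in>{0}\<times>C. ball z d) \<subseteq> W"
    using compact_subset_open_imp_ball_epsilon_subset[OF _ assms(1,4)] by blast
  define K where "K = cball (0::'p) (d/2) \<times> C"
  have "K \<subseteq> W"
  proof
    fix z assume "z \<in> K"
    then obtain s x where z: "z = (s, x)" "norm s \<le> d/2" "x \<in> C" by (auto simp: K_def)
    then have "dist (0, x) z < d" using d(1) by (simp add: dist_Pair_Pair)
    then have "z \<in> ball (0, x) d" by simp
    then show "z \<in> W" using d(2) z by blast
  qed
  then have "uniformly_continuous_on K G"
    using assms by (intro compact_uniformly_continuous) (auto simp: K_def intro: compact_Times continuous_on_subset)
  show ?thesis
  proof (rule uniform_limitI)
    fix \<epsilon> :: real assume "\<epsilon> > 0"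
    then obtain \<eta> where \<eta>: "\<eta> > 0" "\<And>z z'. z \<in> K \<Longrightarrow> z' \<in> K \<Longrightarrow> dist z' z < \<eta> \<Longrightarrow> dist (G z') (G z) < \<epsilon>"
      using \<open>uniformly_continuous_on K G\<close> unfolding uniformly_continuous_on_def by metis
    have "\<forall>\<^sub>F n in F. dist (e n) 0 < min \<eta> (d/2)"
      using d(1) \<eta>(1) by (intro tendstoD[OF assms(5)]) auto
    then show "\<forall>\<^sub>F n in F. \<forall>x\<in>C. dist (G (e n, x)) (G (0, x)) < \<epsilon>"
    proof eventually_elim
      case (elim n)
      then show ?case
        using d(1) by (intro ballI \<eta>(2)) (auto simp: K_def dist_Pair_Pair)
    qed
  qed
qed

text \<open>The compact set \<open>C\<close> is kept apart from \<open>S\<close> and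
  \<open>U\<close>: for the open unit ball S = U, compactness comes from the closed ball, which is
  not contained in \<open>U\<close>. Joint smoothness on \<open>W\<close> around {0} x C replaces
  all derivative estimates.\<close>

lemma converges_with_derivs_param:
  fixes \<Phi> :: "'a::euclidean_space \<Rightarrow> 'p::euclidean_space \<times> 'a \<Rightarrow> 'b::real_normed_vector"
  assumes U: "open U" and W: "open W" "{0} \<times> U \<subseteq> W"
    and C: "S \<subseteq> C" "compact C" "{0} \<times> C \<subseteq> W" "S \<subseteq> U"
    and smooth: "\<And>w. smooth_on W (\<Phi> w)"
    and e: "(e \<longlongrightarrow> 0) F" "\<forall>\<^sub>F n in F. {e n} \<times> U \<subseteq> W"
    and eq: "\<forall>\<^sub>F n in F. \<forall>w. \<forall>x\<in>U. \<omega> n x w = \<Phi> w (e n, x)" "\<And>w x. x \<in> U \<Longrightarrow> \<omega>' x w = \<Phi> w (0, x)"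
  shows "converges_with_derivs U S \<omega> \<omega>' F"
proof -
  have sl: "smooth_on U (\<lambda>x. \<Phi> w (s, x))" if "{s} \<times> U \<subseteq> W" for s w
    using that U by (intro smooth_on_compose[OF U W(1) smooth] smooth_on_Pair smooth_on_const smooth_on_ident) auto
  have ev: "\<forall>\<^sub>F n in F. {e n} \<times> U \<subseteq> W \<and> (\<forall>w. \<forall>x\<in>U. \<omega> n x w = \<Phi> w (e n, x))"
    using e(2) eq(1) by eventually_elim auto
  show ?thesis
    unfolding converges_with_derivs_def
  proof (intro conjI allI)
    show "\<forall>\<^sub>F n in F. smooth_form U (\<omega> n)"
      using ev
    proof eventually_elim
      case (elim n)
      then show ?case unfolding smooth_form_def
        using smooth_on_cong[OF U sl] by metis
    qed
    show "smooth_form U \<omega>'"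
      unfolding smooth_form_def using smooth_on_cong[OF U sl[OF W(2)]] eq(2) by metis
    fix w vs
    let ?G = "iter_deriv (map (Pair 0) vs) (\<Phi> w)"
    have "uniform_limit C (\<lambda>n x. ?G (e n, x)) (\<lambda>x. ?G (0, x)) F"
      using W C e smooth by (intro uniform_limit_slice[of W] smooth_on_imp_continuous_on smooth_on_iter_deriv) auto
    then have "uniform_limit S (\<lambda>n x. ?G (e n, x)) (\<lambda>x. ?G (0, x)) F"
      using C(1) uniform_limit_on_subset by blast
    moreover have "\<forall>\<^sub>F n in F. \<forall>x\<in>S. ?G (e n, x) = iter_deriv vs (\<lambda>x. \<omega> n x w) x"
      using ev
    proof eventually_elim
      case (elim n)
      show ?case
      proof
        fix x assume "x \<in> S"
        then have x: "x \<in> U" using C by auto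
        have "iter_deriv vs (\<lambda>x. \<omega> n x w) x = iter_deriv vs (\<lambda>x. \<Phi> w (e n, x)) x"
          by (rule iter_deriv_cong_open[OF U x]) (use elim in auto)
        then show "?G (e n, x) = iter_deriv vs (\<lambda>x. \<omega> n x w) x"
          using iter_deriv_slice[OF W(1) smooth, of "e n" x] elim x by auto
      qed
    qed
    moreover have "?G (0, x) = iter_deriv vs (\<lambda>x. \<omega>' x w) x" if "x \<in> S" for x
    proof -
      have x: "x \<in> U" using C that by auto
      have "iter_deriv vs (\<lambda>x. \<omega>' x w) x = iter_deriv vs (\<lambda>x. \<Phi> w (0, x)) x"
        by (rule iter_deriv_cong_open[OF U x]) (use eq in auto)
      then show ?thesis using iter_deriv_slice[OF W(1) smooth, of 0 x] W(2) x by auto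
    qed
    ultimately show "uniform_limit S (\<lambda>n. iter_deriv vs (\<lambda>x. \<omega> n x w)) (iter_deriv vs (\<lambda>x. \<omega>' x w)) F"
      by (subst uniform_limit_cong[symmetric]) (auto elim: eventually_mono)
  qed
qed

section \<open>The radial function of the Bryant--Salamon metric\<close>

text \<open>With \<open>r = 1 + w\<close> the substitution \<open>s = 1 + w \<sigma>\<^sup>2\<close> gives
  \<open>t_of_r (1 + w) = sqrt w * avg w\<close>, where \<open>avg\<close> is smooth up to and across \<open>w = 0\<close>.  Hence
  \<open>t\<^sup>2 = w * (avg w)\<^sup>2\<close> can be inverted smoothly, and \<open>r_of_t t\<close> is a smooth function of \<open>t\<^sup>2\<close>.\<close>

definition kern :: "real \<Rightarrow> real" where
  "kern z = 2 * ((1 + z) * sqrt (1 + z)) / sqrt (3 + 3 * z + z\<^sup>2)"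

definition avg :: "real \<Rightarrow> real" where
  "avg w = integral {0..1} (\<lambda>s. kern (w * s\<^sup>2))"

definition tsq :: "real \<Rightarrow> real" where
  "tsq w = w * (avg w)\<^sup>2"

definition tsq_inv :: "real \<Rightarrow> real" where
  "tsq_inv = the_inv_into {-1<..} tsq"

lemma kern_denominator_pos: "z > -1 \<Longrightarrow> 3 + 3 * z + z\<^sup>2 > (0::real)"
  using zero_le_power2[of "z + 3/2"] by (simp add: power2_eq_square algebra_simps)

lemma kern_pos: "z > -1 \<Longrightarrow> kern z > 0"
  by (simp add: kern_def kern_denominator_pos)

lemma smooth_on_kern: "smooth_on {-1<..} kern"
  unfolding kern_def
  by (intro smooth_on_divide smooth_on_mult smooth_on_sqrt smooth_on_add smooth_on_power
      smooth_on_const smooth_on_ident) (auto dest: kern_denominator_pos)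

lemma smooth_on_has_real_derivative:
  fixes h :: "real \<Rightarrow> real"
  assumes "smooth_on U h" "z \<in> U"
  shows "(h has_field_derivative frechet_derivative h (at z) 1) (at z)"
proof -
  let ?D = "frechet_derivative h (at z)"
  have D: "(h has_derivative ?D) (at z)"
    using smooth_on_imp_differentiable[OF assms] frechet_derivative_works by blast
  have "?D v = ?D 1 * v" for v
    using linear_scale[OF has_derivative_linear[OF D], of v 1] by simp
  then have "?D = (*) (?D 1)" by blast
  then show ?thesis using D by (simp add: has_field_derivative_def)
qed

lemma scaled_gt_minus1: "w > -1 \<Longrightarrow> 0 \<le> s \<Longrightarrow> s \<le> 1 \<Longrightarrow> w * s\<^sup>2 > (-1::real)"
proof (cases "w \<ge> 0")
  case False
  assume a: "w > -1" "0 \<le> s" "s \<le> 1"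
  then have "s\<^sup>2 \<le> 1" by (simp add: power_le_one)
  then have "w * s\<^sup>2 \<ge> w * 1" using False by (intro mult_left_mono_neg) auto
  then show ?thesis using a by linarith
next
  case True
  assume "w > -1"
  have "w * s\<^sup>2 \<ge> 0" using True by simp
  then show ?thesis by linarith
qed

lemma continuous_on_scaled:
  assumes "smooth_on {-1<..} h"
  shows "continuous_on ({-1<..} \<times> {0..1}) (\<lambda>(w, s). s ^ j * h (w * s\<^sup>2) :: real)"
  unfolding case_prod_beta
  by (intro continuous_intros continuous_on_compose2[OF smooth_on_imp_continuous_on[OF assms]])
    (auto dest: scaled_gt_minus1)

lemma integrable_scaled:
  assumes "smooth_on {-1<..} h" "w > -1"
  shows "(\<lambda>s. s ^ j * h (w * s\<^sup>2) :: real) integrable_on {0..1}"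
proof (rule integrable_continuous_real)
  have "continuous_on {0..1} (\<lambda>s. (\<lambda>(w, s). s ^ j * h (w * s\<^sup>2) :: real) (w, s))"
    by (rule continuous_on_compose2[OF continuous_on_scaled[OF assms(1)]])
      (use assms(2) in \<open>auto intro!: continuous_intros\<close>)
  then show "continuous_on {0..1} (\<lambda>s. s ^ j * h (w * s\<^sup>2))" by simp
qed

text \<open>The weight s^j is carried along because differentiation under the integral maps (h, j)
  to (h', j + 2). The family is thus closed under differentiation, and smoothness follows by
  induction.\<close>

lemma has_derivative_scaled_integral:
  assumes h: "smooth_on {-1<..} h" and w: "w > -1"
    and h': "h' = (\<lambda>z. frechet_derivative h (at z) 1)"
  shows "((\<lambda>w. integral {0..1} (\<lambda>s. s ^ j * h (w * s\<^sup>2) :: real)) has_field_derivative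
     integral {0..1} (\<lambda>s. s ^ (j + 2) * h' (w * s\<^sup>2))) (at w)"
proof -
  have D: "(h has_field_derivative h' z) (at z)" if "z > -1" for z
    unfolding h' using smooth_on_has_real_derivative[OF h] that by simp
  have h's: "smooth_on {-1<..} h'" unfolding h' by (rule smooth_on_frechet_derivative[OF h])
  have "((\<lambda>w. integral (cbox 0 1) (\<lambda>s. s ^ j * h (w * s\<^sup>2))) has_field_derivative
     integral (cbox 0 1) (\<lambda>s. s ^ (j + 2) * h' (w * s\<^sup>2))) (at w within {-1<..})"
  proof (rule leibniz_rule_field_derivative)
    fix x t :: real assume x: "x \<in> {-1<..}" "t \<in> cbox 0 1"
    have "((\<lambda>w. h (w * t\<^sup>2)) has_field_derivative h' (x * t\<^sup>2) * t\<^sup>2) (at x)"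
      by (rule DERIV_chain'[of _ _ _ _ h, THEN DERIV_cong])
        (use x in \<open>auto intro!: derivative_eq_intros D scaled_gt_minus1\<close>)
    then have "((\<lambda>w. t ^ j * h (w * t\<^sup>2)) has_field_derivative t ^ (j + 2) * h' (x * t\<^sup>2)) (at x)"
      by (auto intro!: derivative_eq_intros simp: power_add power2_eq_square)
    then show "((\<lambda>w. t ^ j * h (w * t\<^sup>2)) has_field_derivative t ^ (j + 2) * h' (x * t\<^sup>2))
        (at x within {-1<..})"
      by (rule has_field_derivative_at_within)
  qed (use w integrable_scaled[OF h] continuous_on_scaled[OF h's, of "j + 2"] in auto)
  then show ?thesis
    using w by (simp add: at_within_open[of w "{-1<..}"])
qed

lemma smooth_on_scaled_integral:
  assumes "smooth_on {-1<..} h"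
  shows "smooth_on {-1<..} (\<lambda>w. integral {0..1} (\<lambda>s. s ^ j * h (w * s\<^sup>2) :: real))"
proof -
  have "Ck_on k {-1<..} (\<lambda>w. integral {0..1} (\<lambda>s. s ^ j * h (w * s\<^sup>2) :: real))" for k
    using assms
  proof (induction k arbitrary: h j)
    case (Suc k)
    show ?case
      by (rule Ck_on_real_derivative[OF has_derivative_scaled_integral[OF Suc.prems _ refl]],
          simp, rule Suc.IH[OF smooth_on_frechet_derivative[OF Suc.prems]])
  qed simp
  then show ?thesis by (subst smooth_on_iff_Ck_on) auto
qed

lemma smooth_on_avg: "smooth_on {-1<..} avg"
  using smooth_on_scaled_integral[OF smooth_on_kern, of 0] by (simp add: avg_def[abs_def])

text \<open>Integrating the derivative of s * kern (w s^2) over [0, 1] gives the differential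
  equation. It says that sqrt w * avg w has derivative kern w / (2 sqrt w), the integrand of
  \<open>t_of_r\<close>, but in a form that is regular at w = 0.\<close>

lemma avg_derivative:
  assumes "w > -1"
  obtains a where "(avg has_field_derivative a) (at w)" "avg w + 2 * w * a = kern w"
proof
  define k' where "k' = (\<lambda>z. frechet_derivative kern (at z) 1)"
  define a where "a = integral {0..1} (\<lambda>s. s ^ 2 * k' (w * s\<^sup>2))"
  show "(avg has_field_derivative a) (at w)"
    using has_derivative_scaled_integral[OF smooth_on_kern assms k'_def, of 0]
    by (simp add: avg_def[abs_def] a_def power2_eq_square)
  have D: "(kern has_field_derivative k' z) (at z)" if "z > -1" for z
    unfolding k'_def using smooth_on_has_real_derivative[OF smooth_on_kern] that by simp
  have k's: "smooth_on {-1<..} k'" unfolding k'_def by (rule smooth_on_frechet_derivative[OF smooth_on_kern])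
  have "((\<lambda>s. kern (w * s\<^sup>2) + 2 * w * (s\<^sup>2 * k' (w * s\<^sup>2))) has_integral
      1 * kern (w * 1\<^sup>2) - 0 * kern (w * 0\<^sup>2)) {0..1}"
  proof (rule fundamental_theorem_of_calculus)
    fix s :: real assume s: "s \<in> {0..1}"
    have "((\<lambda>s. kern (w * s\<^sup>2)) has_field_derivative k' (w * s\<^sup>2) * (2 * w * s)) (at s)"
      by (rule DERIV_chain'[of _ _ _ _ kern, THEN DERIV_cong])
        (use s assms in \<open>auto intro!: derivative_eq_intros D scaled_gt_minus1\<close>)
    then have "((\<lambda>s. s * kern (w * s\<^sup>2)) has_field_derivative
        kern (w * s\<^sup>2) + 2 * w * (s\<^sup>2 * k' (w * s\<^sup>2))) (at s)"
      by (auto intro!: derivative_eq_intros simp: power2_eq_square)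
    then show "((\<lambda>s. s * kern (w * s\<^sup>2)) has_vector_derivative
        kern (w * s\<^sup>2) + 2 * w * (s\<^sup>2 * k' (w * s\<^sup>2))) (at s within {0..1})"
      using has_real_derivative_iff_has_vector_derivative has_field_derivative_at_within by blast
  qed simp
  then have "kern w = integral {0..1} (\<lambda>s. kern (w * s\<^sup>2) + 2 * w * (s\<^sup>2 * k' (w * s\<^sup>2)))"
    by (simp add: integral_unique)
  also have "\<dots> = avg w + 2 * w * a"
    using integrable_scaled[OF smooth_on_kern assms, of 0] integrable_scaled[OF k's assms, of 2]
    by (subst integral_add) (auto simp: avg_def a_def intro: integrable_on_mult_right)
  finally show "avg w + 2 * w * a = kern w" by simp
qed

lemma avg_pos:
  assumes "w > -1" shows "avg w > 0"
proof -
  have "continuous_on {0..1} (\<lambda>s. kern (w * s\<^sup>2))"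
    by (rule continuous_on_compose2[OF smooth_on_imp_continuous_on[OF smooth_on_kern]])
      (use assms in \<open>auto intro!: continuous_intros scaled_gt_minus1\<close>)
  then obtain m where m: "m \<in> {0..1}" "\<And>s. s \<in> {0..1} \<Longrightarrow> kern (w * m\<^sup>2) \<le> kern (w * s\<^sup>2)"
    using continuous_attains_inf[of "{0..1::real}" "\<lambda>s. kern (w * s\<^sup>2)"] by auto
  have "integral {0..1} (\<lambda>s::real. kern (w * m\<^sup>2)) \<le> avg w"
    unfolding avg_def using integrable_scaled[OF smooth_on_kern assms, of 0] m
    by (intro integral_le) auto
  moreover have "kern (w * m\<^sup>2) > 0"
    using m assms by (intro kern_pos scaled_gt_minus1) auto
  ultimately show ?thesis by simp
qed

lemma kern_lower:
  assumes "z \<ge> 0" shows "2 * sqrt (1 + z) / sqrt 3 \<le> kern z"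
proof -
  have "sqrt (3 + 3 * z + z\<^sup>2) \<le> sqrt (3 * (1 + z)\<^sup>2)"
    using assms by (intro real_sqrt_le_mono) (simp add: power2_eq_square algebra_simps)
  then have "sqrt (3 + 3 * z + z\<^sup>2) \<le> sqrt 3 * (1 + z)"
    using assms by (simp add: real_sqrt_mult)
  then have "2 * sqrt (1 + z) * sqrt (3 + 3 * z + z\<^sup>2) \<le> 2 * sqrt (1 + z) * (sqrt 3 * (1 + z))"
    using assms by (intro mult_left_mono) auto
  then show ?thesis
    using kern_denominator_pos[of z] assms by (simp add: kern_def field_simps)
qed

lemma kern_upper:
  assumes "z \<ge> 0" shows "kern z \<le> 2 * sqrt (1 + z)"
proof -
  have "sqrt ((1 + z)\<^sup>2) \<le> sqrt (3 + 3 * z + z\<^sup>2)"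
    using assms by (intro real_sqrt_le_mono) (simp add: power2_eq_square algebra_simps)
  then have "1 + z \<le> sqrt (3 + 3 * z + z\<^sup>2)" using assms by simp
  then have "2 * sqrt (1 + z) * (1 + z) \<le> 2 * sqrt (1 + z) * sqrt (3 + 3 * z + z\<^sup>2)"
    using assms by (intro mult_left_mono) auto
  then show ?thesis
    using kern_denominator_pos[of z] assms by (simp add: kern_def field_simps)
qed

text \<open>From s^2 (1 + w) <= 1 + w s^2 the bound \<open>kern_lower\<close> becomes linear in s,
  and the integral of s over [0, 1] is 1/2. With \<open>avg_upper\<close> this shows that avg has
  the exact growth sqrt r, which controls t and the volume at infinity.\<close>

lemma avg_lower:
  assumes "w \<ge> 0" shows "sqrt (1 + w) / sqrt 3 \<le> avg w"
proof -
  have "((\<lambda>s. s * (2 * sqrt (1 + w) / sqrt 3)) has_integral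
      1\<^sup>2 / 2 * (2 * sqrt (1 + w) / sqrt 3) - 0\<^sup>2 / 2 * (2 * sqrt (1 + w) / sqrt 3)) {0..1}"
    by (rule fundamental_theorem_of_calculus)
      (auto intro!: derivative_eq_intros simp: field_simps
        simp flip: has_real_derivative_iff_has_vector_derivative)
  moreover have "(\<lambda>s. kern (w * s\<^sup>2)) integrable_on {0..1}"
    using integrable_scaled[OF smooth_on_kern, of w 0] assms by simp
  moreover have "s * (2 * sqrt (1 + w) / sqrt 3) \<le> kern (w * s\<^sup>2)" if "s \<in> {0..1}" for s
  proof -
    have "s\<^sup>2 \<le> 1" using that by (simp add: power_le_one)
    then have "sqrt (s\<^sup>2 * (1 + w)) \<le> sqrt (1 + w * s\<^sup>2)"
      by (intro real_sqrt_le_mono) (simp add: algebra_simps)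
    then have "s * sqrt (1 + w) \<le> sqrt (1 + w * s\<^sup>2)"
      using that by (simp add: real_sqrt_mult)
    then have "s * (2 * sqrt (1 + w) / sqrt 3) \<le> 2 * sqrt (1 + w * s\<^sup>2) / sqrt 3"
      by (simp add: field_simps)
    also have "\<dots> \<le> kern (w * s\<^sup>2)" using assms by (intro kern_lower) auto
    finally show ?thesis .
  qed
  ultimately show ?thesis
    unfolding avg_def by (auto dest!: has_integral_le[OF _ integrable_integral])
qed

lemma avg_upper:
  assumes "w \<ge> 0" shows "avg w \<le> 2 * sqrt (1 + w)"
proof -
  have "avg w \<le> integral {0..1} (\<lambda>s::real. 2 * sqrt (1 + w))"
    unfolding avg_def
  proof (rule integral_le)
    show "(\<lambda>s. kern (w * s\<^sup>2)) integrable_on {0..1}"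
      using integrable_scaled[OF smooth_on_kern, of w 0] assms by simp
    fix s :: real assume "s \<in> {0..1}"
    then have "s\<^sup>2 \<le> 1" by (simp add: power_le_one)
    then have "w * s\<^sup>2 \<le> w" using assms mult_left_le by blast
    then have "2 * sqrt (1 + w * s\<^sup>2) \<le> 2 * sqrt (1 + w)" by simp
    moreover have "kern (w * s\<^sup>2) \<le> 2 * sqrt (1 + w * s\<^sup>2)"
      using assms by (intro kern_upper) simp
    ultimately show "kern (w * s\<^sup>2) \<le> 2 * sqrt (1 + w)" by (rule order_trans[rotated])
  qed (rule integrable_const_ivl)
  then show ?thesis by simp
qed

lemma avg_0: "avg 0 = 2 / sqrt 3"
  by (simp add: avg_def kern_def)

section \<open>The square of the distance to the singular orbit, and its inverse\<close>

lemma tsq_derivative: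
  assumes "w > -1" shows "(tsq has_field_derivative avg w * kern w) (at w)"
proof -
  obtain a where a: "(avg has_field_derivative a) (at w)" "avg w + 2 * w * a = kern w"
    using avg_derivative assms by blast
  have "(tsq has_field_derivative (avg w)\<^sup>2 + w * (2 * avg w * a)) (at w)"
    unfolding tsq_def[abs_def] by (auto intro!: derivative_eq_intros a(1))
  moreover have "(avg w)\<^sup>2 + w * (2 * avg w * a) = avg w * kern w"
    unfolding a(2)[symmetric] by (simp add: power2_eq_square algebra_simps)
  ultimately show ?thesis by simp
qed

lemma tsq_less:
  assumes "v > -1" "v < w" shows "tsq v < tsq w"
proof (rule DERIV_pos_imp_increasing[OF assms(2)])
  fix x assume "v \<le> x"
  then have x: "x > -1" using assms(1) by simp
  then have "avg x * kern x > 0" using avg_pos kern_pos by simp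
  then show "\<exists>y. (tsq has_real_derivative y) (at x) \<and> y > 0"
    using tsq_derivative[OF x] by blast
qed

lemma inj_on_tsq: "inj_on tsq {-1<..}"
  by (rule inj_onI) (metis greaterThan_iff less_irrefl linorder_neqE_linordered_idom tsq_less)

lemma tsq_0: "tsq 0 = 0"
  by (simp add: tsq_def)

text \<open>Coercivity of \<open>tsq\<close>; it supplies the right endpoint 3 * \<bar>u\<bar> in
  the intermediate value argument for \<open>tsq_tsq_inv\<close>.\<close>

lemma tsq_ge: "w \<ge> 0 \<Longrightarrow> w / 3 \<le> tsq w"
proof -
  assume w: "w \<ge> 0"
  have "1 \<le> sqrt (1 + w)" using w by simp
  then have "1 / sqrt 3 \<le> avg w"
    using avg_lower[OF w] by (smt (verit) divide_right_mono real_sqrt_ge_0_iff)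
  then have "(1 / sqrt 3)\<^sup>2 \<le> (avg w)\<^sup>2" by (intro power_mono) auto
  then show ?thesis using w mult_left_mono[of "1/3" "(avg w)\<^sup>2" w]
    by (simp add: tsq_def power_divide)
qed

text \<open>An open neighbourhood of [0, \<infinity>): smoothness at t = 0 needs room for slightly
  negative t^2. The point -1/2 is an arbitrary choice between -1, where \<open>kern\<close> stops
  being defined smoothly, and 0.\<close>

definition tsq_range :: "real set" where
  "tsq_range = {tsq (- 1 / 2)<..}"

lemma open_tsq_range: "open tsq_range"
  by (simp add: tsq_range_def)

lemma tsq_range_nonneg: "u \<ge> 0 \<Longrightarrow> u \<in> tsq_range"
proof -
  have "tsq (- 1 / 2) < tsq 0" by (rule tsq_less) auto
  then show "u \<ge> 0 \<Longrightarrow> u \<in> tsq_range" by (simp add: tsq_range_def tsq_0)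
qed

lemma tsq_inv_tsq: "w > -1 \<Longrightarrow> tsq_inv (tsq w) = w"
  unfolding tsq_inv_def by (rule the_inv_into_f_f[OF inj_on_tsq]) simp

lemma tsq_tsq_inv:
  assumes "u \<in> tsq_range"
  shows "tsq_inv u > -1" "tsq (tsq_inv u) = u"
proof -
  have "continuous_on {-1/2..3 * \<bar>u\<bar>} tsq"
    by (rule DERIV_continuous_on[where D = "\<lambda>w. avg w * kern w"])
      (auto intro!: has_field_derivative_at_within tsq_derivative)
  moreover have "tsq (-1/2) \<le> u" using assms by (simp add: tsq_range_def)
  moreover have "u \<le> tsq (3 * \<bar>u\<bar>)" using tsq_ge[of "3 * \<bar>u\<bar>"] by simp
  ultimately obtain w where "-1/2 \<le> w" "tsq w = u"
    using IVT'[of tsq "-1/2" u "3 * \<bar>u\<bar>"] by fastforce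
  then show "tsq_inv u > -1" "tsq (tsq_inv u) = u"
    using tsq_inv_tsq[of w] by auto
qed

lemma tsq_inv_nonneg:
  assumes "u \<ge> 0" shows "tsq_inv u \<ge> 0"
proof (rule ccontr)
  assume "\<not> tsq_inv u \<ge> 0"
  then have "tsq (tsq_inv u) < tsq 0"
    using tsq_tsq_inv(1)[OF tsq_range_nonneg[OF assms]] by (intro tsq_less) auto
  then show False using assms tsq_tsq_inv(2)[OF tsq_range_nonneg[OF assms]] by (simp add: tsq_0)
qed

lemma isCont_tsq_inv:
  assumes "u \<in> tsq_range" shows "isCont tsq_inv u"
proof -
  define w where "w = tsq_inv u"
  have w: "w > -1" "tsq w = u" using tsq_tsq_inv[OF assms] by (auto simp: w_def)
  have "isCont tsq_inv (tsq w)"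
  \<comment> \<open>Half the distance from w to -1, so that the closed interval around w stays
    inside (-1, \<infinity>), where \<open>tsq\<close> is injective.\<close>
  proof (rule isCont_inverse_function[where f = tsq and x = w and d = "(w + 1) / 2"])
    show "0 < (w + 1) / 2" using w by simp
    show "\<And>z. \<bar>z - w\<bar> \<le> (w + 1) / 2 \<Longrightarrow> tsq_inv (tsq z) = z"
      using w(1) by (intro tsq_inv_tsq) (simp add: abs_if field_simps split: if_splits)
    show "\<And>z. \<bar>z - w\<bar> \<le> (w + 1) / 2 \<Longrightarrow> isCont tsq z"
      using w(1) by (intro DERIV_isCont[OF tsq_derivative]) (simp add: abs_if field_simps split: if_splits)
  qed
  then show ?thesis using w by simp
qed

lemma smooth_on_tsq_inv: "smooth_on tsq_range tsq_inv"
proof (rule smooth_on_inverse_function[where U = "{-1<..}"])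
  show "smooth_on {-1<..} (\<lambda>w. avg w * kern w)"
    by (intro smooth_on_mult smooth_on_avg smooth_on_kern) auto
  show "avg w * kern w \<noteq> 0" if "w \<in> {-1<..}" for w
    using that avg_pos[of w] kern_pos[of w] by simp
  show "continuous_on tsq_range tsq_inv"
    using isCont_tsq_inv by (simp add: continuous_at_imp_continuous_on)
  show "tsq_inv u \<in> {-1<..} \<and> tsq (tsq_inv u) = u" if "u \<in> tsq_range" for u
    using tsq_tsq_inv[OF that] by simp
  show "(tsq has_field_derivative avg w * kern w) (at w)" if "w \<in> {-1<..}" for w
    using tsq_derivative that by simp
qed (simp_all add: open_tsq_range)

text \<open>With u = t^2 one has dr/dt = 2 t d, so the second identity is (dr/dt)^2 = 1 - 1/r^3, the
  defining differential equation of r.\<close>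

lemma tsq_inv_derivative:
  assumes "u > 0"
  obtains d where "(tsq_inv has_field_derivative d) (at u)" "4 * u * d\<^sup>2 = 1 - 1 / (1 + tsq_inv u) ^ 3"
proof
  define w where "w = tsq_inv u"
  have w: "w \<ge> 0" "tsq w = u"
    using assms tsq_inv_nonneg[of u] tsq_tsq_inv[OF tsq_range_nonneg[of u]] by (auto simp: w_def)
  have pos: "avg w > 0" "kern w > 0" using w avg_pos kern_pos by auto
  show "(tsq_inv has_field_derivative inverse (avg w * kern w)) (at u)"
  proof (rule has_field_derivative_inverse_basic[where f = tsq])
    show "(tsq has_field_derivative avg w * kern w) (at (tsq_inv u))"
      using w tsq_derivative[of w] by (simp add: w_def)
    show "\<And>y. y \<in> tsq_range \<Longrightarrow> tsq (tsq_inv y) = y" by (rule tsq_tsq_inv)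
  qed (use pos assms isCont_tsq_inv open_tsq_range tsq_range_nonneg in auto)
  have "(kern w)\<^sup>2 = 4 * (1 + w) ^ 3 / (3 + 3 * w + w\<^sup>2)"
    using w kern_denominator_pos[of w]
    by (simp add: kern_def power_divide power_mult_distrib power2_eq_square power3_eq_cube)
  moreover have "4 * u * (inverse (avg w * kern w))\<^sup>2 = 4 * w / (kern w)\<^sup>2"
    using pos unfolding w(2)[symmetric] tsq_def by (simp add: field_simps power_mult_distrib)
  moreover have "4 * w / (4 * (1 + w) ^ 3 / (3 + 3 * w + w\<^sup>2)) = 1 - 1 / (1 + w) ^ 3"
  proof -
    have "w * (3 + 3 * w + w\<^sup>2) = (1 + w) ^ 3 - 1"
      by (simp add: power2_eq_square power3_eq_cube algebra_simps)
    then have "4 * w / (4 * (1 + w) ^ 3 / (3 + 3 * w + w\<^sup>2)) = ((1 + w) ^ 3 - 1) / (1 + w) ^ 3"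
      using w kern_denominator_pos[of w] by simp
    then show ?thesis using w by (simp add: diff_divide_distrib)
  qed
  ultimately show "4 * u * (inverse (avg w * kern w))\<^sup>2 = 1 - 1 / (1 + tsq_inv u) ^ 3"
    by (simp add: w_def)
qed

text \<open>The primitive sqrt (s - 1) * avg (s - 1) is continuous at s = 1 but not differentiable
  there, so the fundamental theorem is used in the version that asks for derivatives only in the
  open interval.\<close>

lemma t_of_r_eq:
  assumes "r \<ge> 1" shows "t_of_r r = sqrt (tsq (r - 1))"
proof -
  define F where "F = (\<lambda>s. sqrt (s - 1) * avg (s - 1))"
  have "((\<lambda>s. 1 / sqrt (1 - 1 / s ^ 3)) has_integral F r - F 1) {1..r}"
  proof (rule fundamental_theorem_of_calculus_interior[OF assms])
    have "continuous_on {1..r} (\<lambda>s. avg (s - 1))"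
      by (rule continuous_on_compose2[OF smooth_on_imp_continuous_on[OF smooth_on_avg]])
        (auto intro!: continuous_intros)
    then show "continuous_on {1..r} F"
      unfolding F_def by (intro continuous_intros)
    fix s assume s: "s \<in> {1<..<r}"
    then obtain a where a: "(avg has_field_derivative a) (at (s - 1))"
        "avg (s - 1) + 2 * (s - 1) * a = kern (s - 1)"
      using avg_derivative[of "s - 1"] by auto
    have "((\<lambda>s. avg (s - 1)) has_field_derivative a * 1) (at s)"
      by (rule DERIV_chain2[where f = avg and g = "\<lambda>s. s - 1" and x = s, OF a(1)]) (auto intro!: derivative_eq_intros)
    then have "(F has_field_derivative avg (s - 1) * (inverse (sqrt (s - 1)) / 2) + sqrt (s - 1) * a) (at s)"
      unfolding F_def using s by (auto intro!: derivative_eq_intros)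
    moreover have "avg (s - 1) * (inverse (sqrt (s - 1)) / 2) + sqrt (s - 1) * a = 1 / sqrt (1 - 1 / s ^ 3)"
    proof -
      define m where "m = sqrt (s - 1)"
      have m: "m > 0" "m\<^sup>2 = s - 1" using s by (auto simp: m_def)
      have "avg (s - 1) * (inverse m / 2) + m * a = (avg (s - 1) + 2 * m\<^sup>2 * a) / (2 * m)"
        using m(1) by (simp add: field_simps power2_eq_square)
      also have "\<dots> = kern (s - 1) / (2 * m)" unfolding m(2) a(2) ..
      also have "\<dots> = s * sqrt s / (sqrt (3 + 3 * (s - 1) + (s - 1)\<^sup>2) * sqrt (s - 1))"
        by (simp add: kern_def m_def)
      also have "\<dots> = sqrt (s\<^sup>2 * s) / sqrt ((3 + 3 * (s - 1) + (s - 1)\<^sup>2) * (s - 1))"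
        using s by (simp only: real_sqrt_mult) simp
      also have "\<dots> = sqrt (s\<^sup>2 * s / ((3 + 3 * (s - 1) + (s - 1)\<^sup>2) * (s - 1)))"
        by (simp add: real_sqrt_divide)
      also have "s\<^sup>2 * s / ((3 + 3 * (s - 1) + (s - 1)\<^sup>2) * (s - 1)) = 1 / (1 - 1 / s ^ 3)"
      proof -
        have "(3 + 3 * (s - 1) + (s - 1)\<^sup>2) * (s - 1) = s ^ 3 - 1"
          by (simp add: power2_eq_square power3_eq_cube algebra_simps)
        moreover have "1 < s ^ 3" using s by (intro one_less_power) auto
        ultimately show ?thesis
          using s by (simp add: field_simps power2_eq_square power3_eq_cube)
      qed
      finally show ?thesis by (simp add: m_def real_sqrt_divide)
    qed
    ultimately show "(F has_vector_derivative 1 / sqrt (1 - 1 / s ^ 3)) (at s)"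
      by (simp add: has_real_derivative_iff_has_vector_derivative)
  qed
  then have "t_of_r r = F r" by (simp add: t_of_r_def F_def integral_unique)
  then show ?thesis
    using assms avg_pos[of "r - 1"] by (simp add: F_def tsq_def real_sqrt_mult)
qed

lemma r_of_t_eq:
  assumes "t \<ge> 0" shows "r_of_t t = 1 + tsq_inv (t\<^sup>2)"
proof -
  have inj: "inj_on t_of_r {1..}"
  proof (rule inj_onI)
    fix x y assume xy: "x \<in> {1..}" "y \<in> {1..}" "t_of_r x = t_of_r y"
    then have "tsq (x - 1) = tsq (y - 1)" by (simp add: t_of_r_eq)
    then have "x - 1 = y - 1" using inj_onD[OF inj_on_tsq, of "x - 1" "y - 1"] xy(1,2) by simp
    then show "x = y" by simp
  qed
  have "t_of_r (1 + tsq_inv (t\<^sup>2)) = t"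
    using tsq_inv_nonneg[of "t\<^sup>2"] tsq_tsq_inv(2)[OF tsq_range_nonneg[of "t\<^sup>2"]] assms
    by (simp add: t_of_r_eq)
  then show ?thesis
    unfolding r_of_t_def using the_inv_into_f_f[OF inj, of "1 + tsq_inv (t\<^sup>2)"] tsq_inv_nonneg[of "t\<^sup>2"]
    by simp
qed

text \<open>The quotient (r - 1) / t^2 as a function of u = t^2, regular at u = 0. The
  factorizations of r^3 - 1 and r^2 - 1 by r - 1 turn it into \<open>A1q\<close> = A1^2 / u and
  \<open>B1q\<close> = (B1^2 - 1/3) / u.\<close>

definition wq :: "real \<Rightarrow> real" where
  "wq u = 1 / (avg (tsq_inv u))\<^sup>2"

definition A1q :: "real \<Rightarrow> real" where
  "A1q u = wq u * (((1 + tsq_inv u)\<^sup>2 + (1 + tsq_inv u) + 1) / (9 * (1 + tsq_inv u)))"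

definition B1q :: "real \<Rightarrow> real" where
  "B1q u = wq u * ((2 + tsq_inv u) / 3)"

lemma tsq_inv_eq: "u \<in> tsq_range \<Longrightarrow> tsq_inv u = u * wq u"
  using tsq_tsq_inv[of u] avg_pos[of "tsq_inv u"] by (simp add: wq_def tsq_def field_simps)

lemma tsq_inv_0: "tsq_inv 0 = 0"
  using tsq_inv_tsq[of 0] by (simp add: tsq_0)

lemma wq_0: "wq 0 = 3 / 4"
  by (simp add: wq_def tsq_inv_0 avg_0 power_divide)

lemma wq_pos: "u \<in> tsq_range \<Longrightarrow> wq u > 0"
  using tsq_tsq_inv[of u] avg_pos[of "tsq_inv u"] by (simp add: wq_def)

lemma smooth_on_wq: "smooth_on tsq_range wq"
  unfolding wq_def
  by (intro smooth_on_divide smooth_on_const smooth_on_power open_tsq_range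
      smooth_on_compose[OF open_tsq_range _ smooth_on_avg] smooth_on_tsq_inv)
    (use tsq_tsq_inv avg_pos in force)+

text \<open>The value 1/4 is the condition for the metric to close up smoothly: it kills the factor
  4 * A1q - 1 in \<open>bs_metric_expand\<close>. Together the two values determine the parameter of
  the bubble.\<close>

lemma A1q_0: "A1q 0 = 1 / 4" and B1q_0: "B1q 0 = 1 / 2"
  by (simp_all add: A1q_def B1q_def wq_0 tsq_inv_0)

lemma A1q_pos: "u \<in> tsq_range \<Longrightarrow> A1q u > 0"
proof -
  assume u: "u \<in> tsq_range"
  then have "1 + tsq_inv u > 0" using tsq_tsq_inv(1) by fastforce
  then have "((1 + tsq_inv u)\<^sup>2 + (1 + tsq_inv u) + 1) / (9 * (1 + tsq_inv u)) > 0"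
    using zero_le_power2[of "1 + tsq_inv u"] by (intro divide_pos_pos add_nonneg_pos) auto
  with wq_pos[OF u] show ?thesis unfolding A1q_def by (rule mult_pos_pos)
qed

lemma B1q_pos: "u \<in> tsq_range \<Longrightarrow> B1q u > 0"
  using tsq_tsq_inv(1)[of u] wq_pos[of u] by (simp add: B1q_def)

lemma smooth_on_A1q: "smooth_on tsq_range A1q"
  unfolding A1q_def
  by (intro smooth_on_mult smooth_on_divide smooth_on_add smooth_on_power smooth_on_const
      open_tsq_range smooth_on_wq smooth_on_tsq_inv) (use tsq_tsq_inv in force)

lemma smooth_on_B1q: "smooth_on tsq_range B1q"
  unfolding B1q_def
  by (intro smooth_on_mult smooth_on_divide smooth_on_add smooth_on_const
      open_tsq_range smooth_on_wq smooth_on_tsq_inv) auto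

section \<open>The metric coefficients in terms of t^2 and of r\<close>

lemma A1_nonneg: "t \<ge> 0 \<Longrightarrow> A1 t \<ge> 0"
  using tsq_inv_nonneg[of "t\<^sup>2"] by (auto simp: A1_def r_of_t_eq divide_simps)

lemma A1_square_r:
  assumes "t \<ge> 0"
  shows "(A1 t)\<^sup>2 = (r_of_t t ^ 3 - 1) / (9 * r_of_t t)"
proof -
  have r: "r_of_t t \<ge> 1" using assms tsq_inv_nonneg[of "t\<^sup>2"] by (simp add: r_of_t_eq)
  then have "1 - 1 / r_of_t t ^ 3 \<ge> 0" by simp
  then show ?thesis
    using r by (simp add: A1_def power_mult_distrib power_divide field_simps power2_eq_square power3_eq_cube)
qed

lemma A1_square: "t \<ge> 0 \<Longrightarrow> (A1 t)\<^sup>2 = t\<^sup>2 * A1q (t\<^sup>2)"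
proof -
  assume t: "t \<ge> 0"
  define w where "w = tsq_inv (t\<^sup>2)"
  have w: "w \<ge> 0" using tsq_inv_nonneg[of "t\<^sup>2"] by (simp add: w_def)
  have "t\<^sup>2 * A1q (t\<^sup>2) = w * (((1 + w)\<^sup>2 + (1 + w) + 1) / (9 * (1 + w)))"
    using tsq_inv_eq[OF tsq_range_nonneg[of "t\<^sup>2"]] by (simp add: A1q_def w_def)
  also have "\<dots> = ((1 + w) ^ 3 - 1) / (9 * (1 + w))"
    by (simp add: power2_eq_square power3_eq_cube algebra_simps)
  finally show ?thesis using A1_square_r[OF t] by (simp add: r_of_t_eq[OF t] w_def)
qed

lemma B1_square: "t \<ge> 0 \<Longrightarrow> (B1 t)\<^sup>2 - 1 / 3 = t\<^sup>2 * B1q (t\<^sup>2)"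
proof -
  assume t: "t \<ge> 0"
  define w where "w = tsq_inv (t\<^sup>2)"
  have "t\<^sup>2 * B1q (t\<^sup>2) = w * ((2 + w) / 3)"
    using tsq_inv_eq[OF tsq_range_nonneg[of "t\<^sup>2"]] by (simp add: B1q_def w_def)
  then show ?thesis by (simp add: B1_def r_of_t_eq[OF t] w_def power_divide field_simps power2_eq_square)
qed

lemma A1_pos: "t > 0 \<Longrightarrow> A1 t > 0"
proof -
  assume t: "t > 0"
  then have "t\<^sup>2 * A1q (t\<^sup>2) > 0" using A1q_pos[OF tsq_range_nonneg, of "t\<^sup>2"] by simp
  then have "(A1 t)\<^sup>2 > 0" using A1_square[of t] t by simp
  then show ?thesis using A1_nonneg[of t] t by (auto simp: less_le)
qed

lemma B1_pos: "t \<ge> 0 \<Longrightarrow> B1 t > 0"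
  using tsq_inv_nonneg[of "t\<^sup>2"] by (simp add: B1_def r_of_t_eq)

section \<open>The connections in quaternionic form\<close>

lemmas quat_expand = qmult_def qconj_def prod_eq_iff vec_eq_iff forall_3 inner_vec_def sum_3
  cross3_def vector_3

lemma bounded_bilinear_qmult: "bounded_bilinear (\<odot>)"
  unfolding bilinear_conv_bounded_bilinear[symmetric] bilinear_def
  by (intro conjI allI linearI) (simp_all add: quat_expand algebra_simps)

lemmas qmult_add_left = bounded_bilinear.add_left[OF bounded_bilinear_qmult]
  and qmult_add_right = bounded_bilinear.add_right[OF bounded_bilinear_qmult]
  and qmult_diff_left = bounded_bilinear.diff_left[OF bounded_bilinear_qmult]
  and qmult_diff_right = bounded_bilinear.diff_right[OF bounded_bilinear_qmult]
  and qmult_minus_left = bounded_bilinear.minus_left[OF bounded_bilinear_qmult]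
  and qmult_minus_right = bounded_bilinear.minus_right[OF bounded_bilinear_qmult]
  and qmult_scaleR_left = bounded_bilinear.scaleR_left[OF bounded_bilinear_qmult]
  and qmult_scaleR_right = bounded_bilinear.scaleR_right[OF bounded_bilinear_qmult]
  and qmult_zero_left = bounded_bilinear.zero_left[OF bounded_bilinear_qmult]
  and qmult_zero_right = bounded_bilinear.zero_right[OF bounded_bilinear_qmult]

lemma bounded_linear_qconj: "bounded_linear qconj"
  unfolding linear_conv_bounded_linear[symmetric]
  by (intro linearI) (simp_all add: qconj_def prod_eq_iff)

lemmas linear_qconj = bounded_linear.linear[OF bounded_linear_qconj]

lemmas qconj_linear_simps = linear_add[OF linear_qconj] linear_scale[OF linear_qconj]
  linear_0[OF linear_qconj] linear_neg[OF linear_qconj] linear_diff[OF linear_qconj]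

lemmas qmult_linear_simps = qmult_add_left qmult_add_right qmult_diff_left qmult_diff_right
  qmult_minus_left qmult_minus_right qmult_scaleR_left qmult_scaleR_right qmult_zero_left
  qmult_zero_right

lemma qmult_assoc: "(x \<odot> y) \<odot> z = x \<odot> (y \<odot> z)"
  by (simp add: quat_expand algebra_simps)

lemma qconj_qmult: "qconj (x \<odot> y) = qconj y \<odot> qconj x"
  by (simp add: quat_expand algebra_simps)

lemma qconj_qconj [simp]: "qconj (qconj x) = x"
  by (simp add: qconj_def)

lemma fst_qconj [simp]: "fst (qconj x) = fst x" and snd_qconj [simp]: "snd (qconj x) = - snd x"
  by (simp_all add: qconj_def)

lemma norm_qconj [simp]: "norm (qconj x) = norm x"
  by (simp add: qconj_def norm_prod_def)

lemma qmult_qconj: "x \<odot> qconj x = ((norm x)\<^sup>2, 0)"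
  by (simp only: power2_norm_eq_inner inner_prod_def) (simp add: quat_expand algebra_simps)

lemma qconj_qmult_self: "qconj x \<odot> x = ((norm x)\<^sup>2, 0)"
  using qmult_qconj[of "qconj x"] by simp

lemma qmult_real_left: "(c, 0) \<odot> x = c *\<^sub>R x" and qmult_real_right: "x \<odot> (c, 0) = c *\<^sub>R x"
  by (simp_all add: qmult_def prod_eq_iff)

lemma fst_qconj_qmult: "fst (qconj x \<odot> y) = x \<bullet> y"
  by (simp add: qmult_def inner_prod_def)

lemma fst_qmult_qconj: "fst (x \<odot> qconj y) = x \<bullet> y"
  by (simp add: qmult_def inner_prod_def)

lemma sum_scaleR_T: "(\<Sum>i\<in>UNIV. c i *\<^sub>R T i) = (0, \<chi> i. c i)"
  by (simp add: sum_3 T_def prod_eq_iff vec_eq_iff forall_3 axis_def)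

text \<open>Multiplication by |p|^2 clears the denominator of the left-invariant form of p / |p|,
  leaving a polynomial in p and dp.\<close>

definition im_fibre :: "quat \<times> quat \<Rightarrow> quat \<times> quat \<Rightarrow> real^3" where
  "im_fibre x v = snd (qconj (fst x) \<odot> fst v)"

text \<open>For unit q the second group coordinate is a2 = q^-1 a1, and a2^-1 da2 - a1^-1 da1 =
  a1^-1 (q d(qconj q)) a1. This is |p|^2 times that difference.\<close>

definition im_base :: "quat \<times> quat \<Rightarrow> quat \<times> quat \<Rightarrow> real^3" where
  "im_base x v = snd (qconj (fst x) \<odot> (snd x \<odot> qconj (snd v)) \<odot> fst x)"

lemma has_derivative_sgn:
  fixes p :: "'a::real_inner"
  assumes "p \<noteq> 0"
  shows "(sgn has_derivative (\<lambda>v. inverse (norm p) *\<^sub>R v - ((p \<bullet> v) / norm p ^ 3) *\<^sub>R p)) (at p)"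
proof -
  have "((\<lambda>x. inverse (norm x) *\<^sub>R x) has_derivative
      (\<lambda>v. inverse (norm p) *\<^sub>R v - ((p \<bullet> v) / norm p ^ 3) *\<^sub>R p)) (at p)"
    using assms
    by (auto intro!: derivative_eq_intros has_derivative_norm ext
        simp: sgn_div_norm field_simps inner_commute power2_eq_square power3_eq_cube)
  moreover have "sgn = (\<lambda>x::'a. inverse (norm x) *\<^sub>R x)"
    by (simp add: sgn_div_norm fun_eq_iff)
  ultimately show ?thesis by simp
qed

lemma dt_eq:
  assumes "fst x \<noteq> 0" shows "dt x v = fst x \<bullet> fst v / norm (fst x)"
proof -
  have "((\<lambda>y. norm (fst y)) has_derivative (\<lambda>v. fst v \<bullet> sgn (fst x))) (at x)"
    by (rule has_derivative_compose[OF bounded_linear_imp_has_derivative[OF bounded_linear_fst]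
          has_derivative_norm[OF assms]])
  then have "dt x v = fst v \<bullet> sgn (fst x)"
    unfolding dt_def by (metis frechet_derivative_at)
  then show ?thesis by (simp add: sgn_div_norm inner_commute field_simps)
qed

lemma has_derivative_group_part:
  assumes "fst x \<noteq> 0"
  defines "S \<equiv> \<lambda>v. inverse (norm (fst x)) *\<^sub>R v - ((fst x \<bullet> v) / norm (fst x) ^ 3) *\<^sub>R fst x"
  shows "(group_part has_derivative (\<lambda>v. (S (fst v),
     qconj (snd x) \<odot> S (fst v) + qconj (snd v) \<odot> sgn (fst x)))) (at x)"
proof -
  have 1: "((\<lambda>y. sgn (fst y)) has_derivative (\<lambda>v. S (fst v))) (at x)"
    unfolding S_def
    by (rule has_derivative_compose[OF bounded_linear_imp_has_derivative[OF bounded_linear_fst]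
          has_derivative_sgn[OF assms(1)]])
  have 2: "((\<lambda>y. qconj (snd y)) has_derivative (\<lambda>v. qconj (snd v))) (at x)"
    by (rule has_derivative_compose[OF bounded_linear_imp_has_derivative[OF bounded_linear_snd]
          bounded_linear_imp_has_derivative[OF bounded_linear_qconj]])
  show ?thesis
    unfolding group_part_def[abs_def]
    by (intro has_derivative_Pair 1 bounded_bilinear.FDERIV[OF bounded_bilinear_qmult 2 1])
qed

text \<open>The factor |q|^2 equals 1 on the manifold but is kept: the curvature is computed by
  ambient derivatives, so the formula has to hold at nearby points with q off the sphere.\<close>

lemma eta_pullback:
  assumes "fst x \<noteq> 0"
  shows "\<eta>\<^sub>L i (fst (group_part x)) (fst (frechet_derivative group_part (at x) v))
      = im_fibre x v $ i / (norm (fst x))\<^sup>2" (is ?A)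
    and "\<eta>\<^sub>L i (snd (group_part x)) (snd (frechet_derivative group_part (at x) v))
      = ((norm (snd x))\<^sup>2 * im_fibre x v $ i + im_base x v $ i) / (norm (fst x))\<^sup>2" (is ?B)
proof -
  define p q where "p = fst x" and "q = snd x"
  define S where "S = (\<lambda>v. inverse (norm p) *\<^sub>R v - ((p \<bullet> v) / norm p ^ 3) *\<^sub>R p)"
  have p: "norm p \<noteq> 0" using assms by (simp add: p_def)
  have D: "frechet_derivative group_part (at x) v =
      (S (fst v), qconj q \<odot> S (fst v) + qconj (snd v) \<odot> sgn p)"
    using has_derivative_group_part[OF assms] unfolding S_def p_def q_def
    by (metis (no_types, lifting) frechet_derivative_at)
  have a: "sgn p = inverse (norm p) *\<^sub>R p" by (simp add: sgn_div_norm)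
  have S: "snd (qconj (sgn p) \<odot> S w) = (1 / (norm p)\<^sup>2) *\<^sub>R snd (qconj p \<odot> w)" for w
    by (simp add: S_def a qconj_linear_simps qmult_linear_simps qconj_qmult_self power2_eq_square
        divide_inverse)
  show ?A
    using S[of "fst v"] by (simp add: D group_part_def \<eta>\<^sub>L_def im_fibre_def flip: p_def)
  have "qconj (qconj q \<odot> sgn p) \<odot> (qconj q \<odot> S (fst v) + qconj (snd v) \<odot> sgn p)
      = (norm q)\<^sup>2 *\<^sub>R (qconj (sgn p) \<odot> S (fst v)) + qconj (sgn p) \<odot> (q \<odot> qconj (snd v)) \<odot> sgn p"
  proof -
    have "q \<odot> (qconj q \<odot> z) = (norm q)\<^sup>2 *\<^sub>R z" for z
      by (simp add: qmult_assoc[symmetric] qmult_qconj qmult_real_left)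
    then show ?thesis
      by (simp add: qconj_qmult qmult_linear_simps qmult_assoc)
  qed
  moreover have "snd (qconj (sgn p) \<odot> (q \<odot> qconj (snd v)) \<odot> sgn p) = (1 / (norm p)\<^sup>2) *\<^sub>R im_base x v"
    by (simp add: a im_base_def qconj_linear_simps qmult_linear_simps power2_eq_square
        divide_inverse flip: p_def q_def)
  ultimately show ?B
    using S[of "fst v"] 
    by (simp add: D group_part_def \<eta>\<^sub>L_def im_fibre_def add_divide_distrib flip: p_def q_def)
qed

lemma eta_plus_eq:
  assumes "fst x \<noteq> 0"
  shows "\<eta>_plus i x v =
    ((1 + (norm (snd x))\<^sup>2) * im_fibre x v $ i + im_base x v $ i) / (2 * (norm (fst x))\<^sup>2)"
  using eta_pullback[OF assms, of i v] assms
  by (simp add: \<eta>_plus_def pullback_def \<eta>G_plus_def field_simps)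

lemma eta_minus_eq:
  assumes "fst x \<noteq> 0"
  shows "\<eta>_minus i x v =
    ((1 - (norm (snd x))\<^sup>2) * im_fibre x v $ i - im_base x v $ i) / (2 * (norm (fst x))\<^sup>2)"
  using eta_pullback[OF assms, of i v] assms
  by (simp add: \<eta>_minus_def pullback_def \<eta>G_minus_def field_simps)

text \<open>On the manifold this is 2 |p|^2 times the sum of T_i tensor eta_i^+. The factor 1 +
  |q|^2 is the ambient form of the constant 2; its derivative vanishes in tangent
  directions.\<close>

definition pform :: "(quat \<times> quat, quat) form1" where
  "pform x v = (0, (1 + (norm (snd x))\<^sup>2) *\<^sub>R im_fibre x v + im_base x v)"

lemma sum_eta_plus_T:
  assumes "fst x \<noteq> 0"
  shows "(\<Sum>i\<in>UNIV. \<eta>_plus i x v *\<^sub>R T i) = (1 / (2 * (norm (fst x))\<^sup>2)) *\<^sub>R pform x v"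
  by (simp add: sum_scaleR_T eta_plus_eq[OF assms] pform_def prod_eq_iff vec_eq_iff)

definition profile :: "real \<Rightarrow> real \<Rightarrow> real" where
  "profile e u = A1q u / (e + u * B1q u)"

text \<open>Dividing the coefficient by \<open>x1\<close> makes x1 = \<infinity> a regular value,
  and the t^2 in A1^2 cancels the 1 / (2 t^2) from \<open>sum_eta_plus_T\<close>. Over the singular
  orbit both sides vanish.\<close>

lemma A_clarke_eq:
  assumes "x1 > 0" shows "A_clarke x1 x v = profile (1 / x1) ((norm (fst x))\<^sup>2) *\<^sub>R pform x v"
proof (cases "fst x = 0")
  case True
  then show ?thesis
    using A1_square[of 0]
    by (simp add: A_clarke_def pform_def im_fibre_def im_base_def qconj_linear_simps
        qmult_linear_simps flip: zero_prod_def)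
next
  case False
  define t where "t = norm (fst x)"
  have t: "t > 0" using False by (simp add: t_def)
  have "B1q (t\<^sup>2) > 0" by (rule B1q_pos[OF tsq_range_nonneg]) simp
  then have pos: "1 + x1 * (t\<^sup>2 * B1q (t\<^sup>2)) > 0" using assms by (intro add_pos_nonneg) auto
  then have "2 * x1 * (t\<^sup>2 * A1q (t\<^sup>2)) / (1 + x1 * (t\<^sup>2 * B1q (t\<^sup>2))) * (1 / (2 * t\<^sup>2))
      = profile (1 / x1) (t\<^sup>2)"
    using t assms by (simp add: profile_def field_simps)
  then show ?thesis
    using A1_square[of t] B1_square[of t] t
    by (simp add: A_clarke_def sum_eta_plus_T[OF False] flip: t_def)
qed

lemma A_lim_eq:
  assumes "fst x \<noteq> 0" shows "A_lim x v = profile 0 ((norm (fst x))\<^sup>2) *\<^sub>R pform x v"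
proof -
  define t where "t = norm (fst x)"
  have t: "t > 0" using assms by (simp add: t_def)
  have "B1q (t\<^sup>2) > 0" by (rule B1q_pos[OF tsq_range_nonneg]) simp
  then have c: "(A1 t)\<^sup>2 / (1 / 2 * ((B1 t)\<^sup>2 - 1 / 3)) * (1 / (2 * t\<^sup>2)) = profile 0 (t\<^sup>2)"
    using A1_square[of t] B1_square[of t] t by (simp add: profile_def field_simps)
  have "A_lim x v = ((A1 t)\<^sup>2 / (1 / 2 * ((B1 t)\<^sup>2 - 1 / 3)) * (1 / (2 * t\<^sup>2))) *\<^sub>R pform x v"
    by (simp add: A_lim_def sum_eta_plus_T[OF assms] flip: t_def)
  then show ?thesis unfolding c by (simp add: t_def)
qed

lemma A_ASD_eq: "A_ASD l x w = (l / (1 + l * (norm x)\<^sup>2)) *\<^sub>R (0, snd (qconj x \<odot> w))"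
proof (cases "x = 0")
  case True
  then show ?thesis by (simp add: A_ASD_def qconj_linear_simps qmult_linear_simps flip: zero_prod_def)
next
  case False
  have "frechet_derivative sgn (at x) = (\<lambda>v. inverse (norm x) *\<^sub>R v - ((x \<bullet> v) / norm x ^ 3) *\<^sub>R x)"
    by (rule frechet_derivative_at[OF has_derivative_sgn[OF False], symmetric])
  then have "pullback sgn (\<eta>\<^sub>L i) x w = snd (qconj x \<odot> w) $ i / (norm x)\<^sup>2" for i
    by (simp add: pullback_def \<eta>\<^sub>L_def sgn_div_norm qconj_linear_simps qmult_linear_simps
        qconj_qmult_self power2_eq_square divide_inverse)
  moreover have "(\<chi> i. snd (qconj x \<odot> w) $ i / (norm x)\<^sup>2) = (1 / (norm x)\<^sup>2) *\<^sub>R snd (qconj x \<odot> w)"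
    by (simp add: vec_eq_iff)
  ultimately show ?thesis
    using False by (simp add: A_ASD_def Let_def sum_scaleR_T)
qed

lemma has_derivative_slice: "(slice \<delta> p has_derivative (\<lambda>w. (\<delta> *\<^sub>R w, 0))) (at x)"
  unfolding slice_def[abs_def] by (auto intro!: derivative_eq_intros)

section \<open>Bubbling and convergence away from the singular orbit\<close>

lemma smooth_on_norm_square:
  fixes f :: "'a::real_normed_vector \<Rightarrow> 'b::euclidean_space"
  assumes "open U" "smooth_on U f" shows "smooth_on U (\<lambda>x. (norm (f x))\<^sup>2)"
  unfolding power2_norm_eq_inner by (intro smooth_on_inner assms)

text \<open>With \<delta>^2 = 2 l / x1 all powers of x1 cancel in \<delta>^2 * profile. What remains
  depends on \<delta> only through u = |\<delta> x|^2, and A1q 0 = 1/4, B1q 0 = 1/2 give l / (1 + l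
  |x|^2) at \<delta> = 0.\<close>

theorem bubbling:
  assumes l: "l > 0" and p: "p \<in> sphere 0 1"
  shows "converges_with_derivs (ball 0 1) (ball 0 1)
    (\<lambda>x1. pullback (slice (sqrt (2 * l / x1)) p) (A_clarke x1)) (A_ASD l) at_top"
proof (rule converges_with_derivs_param)
  let ?W = "UNIV :: (real \<times> quat) set"
  \<comment> \<open>Written as a square, u is nonnegative for every real parameter, hence always in
    \<open>tsq_range\<close>; so the family is smooth on the whole product space.\<close>
  define u where "u = (\<lambda>z :: real \<times> quat. (norm (fst z *\<^sub>R snd z))\<^sup>2)"
  define \<Phi> where "\<Phi> = (\<lambda>w z. (4 * l * A1q (u z) / (1 + 2 * l * ((norm (snd z))\<^sup>2 * B1q (u z)))) *\<^sub>R
      ((0, snd (qconj (snd z) \<odot> w)) :: quat))"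
  have u: "smooth_on ?W u" "\<And>z. u z \<in> tsq_range"
    unfolding u_def
    by (intro smooth_on_norm_square smooth_on_scaleR smooth_on_fst smooth_on_snd smooth_on_ident
        open_UNIV tsq_range_nonneg zero_le_power2)+
  have pos: "1 + 2 * l * ((norm (snd z))\<^sup>2 * B1q (u z)) > 0" for z
    using l B1q_pos[OF u(2)[of z]] by (intro add_pos_nonneg) auto
  show "smooth_on ?W (\<Phi> w)" for w
  proof -
    have "bounded_linear (\<lambda>x::quat. (0::real, snd (qconj x \<odot> w)))"
      unfolding linear_conv_bounded_linear[symmetric]
      by (intro linearI) (auto simp: qconj_linear_simps qmult_linear_simps)
    note lin = smooth_on_bounded_linear[OF open_UNIV this, of snd]
    show ?thesis
      unfolding \<Phi>_def
      by (intro smooth_on_scaleR smooth_on_divide smooth_on_mult smooth_on_add smooth_on_const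
          smooth_on_compose[OF _ open_tsq_range smooth_on_A1q u(1)]
          smooth_on_compose[OF _ open_tsq_range smooth_on_B1q u(1)]
          smooth_on_norm_square smooth_on_snd smooth_on_ident open_UNIV lin u(2)
          less_imp_neq[OF pos, symmetric])
  qed
  show "((\<lambda>x1. sqrt (2 * l / x1)) \<longlongrightarrow> 0) at_top"
    using l by real_asymp
  show "\<forall>\<^sub>F x1 in at_top. \<forall>w. \<forall>x\<in>ball 0 1.
      pullback (slice (sqrt (2 * l / x1)) p) (A_clarke x1) x w = \<Phi> w (sqrt (2 * l / x1), x)"
    using eventually_gt_at_top[of 0]
  proof eventually_elim
    case (elim x1)
    define d where "d = sqrt (2 * l / x1)"
    have d: "d > 0" "d\<^sup>2 = 2 * l / x1" using elim l by (auto simp: d_def)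
    show ?case
    proof (intro allI ballI)
      fix w x :: quat
      have fd: "frechet_derivative (slice d p) (at x) w = (d *\<^sub>R w, 0)"
        using has_derivative_slice frechet_derivative_at by metis
      \<comment> \<open>The slice keeps the base point fixed, so \<open>im_base\<close> vanishes;
        one factor \<delta> comes from the point and one from the tangent vector.\<close>
      have pf: "pform (slice d p x) (d *\<^sub>R w, 0) = (2 * d\<^sup>2) *\<^sub>R (0, snd (qconj x \<odot> w))"
        using p by (simp add: pform_def slice_def im_fibre_def im_base_def qconj_linear_simps
            qmult_linear_simps power2_eq_square)
      have "profile (1 / x1) (u (d, x)) * (2 * d\<^sup>2) =
          4 * l * A1q (u (d, x)) / (1 + 2 * l * ((norm x)\<^sup>2 * B1q (u (d, x))))"
      proof -
        define a b m where "a = A1q (u (d, x))" and "b = B1q (u (d, x))" and "m = (norm x)\<^sup>2"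
        have un: "u (d, x) = 2 * l / x1 * m"
          using d by (simp add: u_def m_def power_mult_distrib)
        have "b > 0" "m \<ge> 0" using B1q_pos[OF u(2)] by (auto simp: b_def m_def)
        then have "1 + 2 * l * (m * b) > 0" using l by (intro add_pos_nonneg) auto
        then have "a / (1 / x1 + 2 * l / x1 * m * b) * (2 * (2 * l / x1)) = 4 * l * a / (1 + 2 * l * (m * b))"
          using elim l by (simp add: field_simps)
        then show ?thesis
          unfolding profile_def d(2) by (fold a_def b_def m_def) (simp add: un)
      qed
      moreover have "(norm (fst (slice d p x)))\<^sup>2 = u (d, x)" by (simp add: slice_def u_def)
      ultimately show "pullback (slice (sqrt (2 * l / x1)) p) (A_clarke x1) x w = \<Phi> w (sqrt (2 * l / x1), x)"
        by (simp add: pullback_def fd A_clarke_eq[OF elim] pf \<Phi>_def flip: d_def)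
    qed
  qed
  show "A_ASD l x w = \<Phi> w (0, x)" for w x
    using l by (simp add: A_ASD_eq \<Phi>_def u_def A1q_0 B1q_0)
  show "compact (cball (0::quat) 1)" by simp
qed (auto simp: ball_subset_cball)

theorem convergence_away_from_orbit:
  "converges_with_derivs_on_compact M_reg K A_clarke A_lim at_top"
  unfolding converges_with_derivs_on_compact_def
proof (intro allI impI)
  fix U :: "(real^7) set" and \<phi> C
  assume "local_param M_reg U \<phi> \<and> compact C \<and> C \<subseteq> U \<and> \<phi> ` C \<subseteq> K"
  then have U: "open U" "smooth_on U \<phi>" "\<phi> ` U \<subseteq> M_reg" and C: "compact C" "C \<subseteq> U"
    unfolding local_param_def by auto
  define u where "u = (\<lambda>y. (norm (fst (\<phi> y)))\<^sup>2)"
  have upos: "u y > 0" if "y \<in> U" for y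
    using that U(3) unfolding u_def M_reg_def by (force simp: image_subset_iff mem_Times_iff)
  have ran: "u y \<in> tsq_range" for y by (simp add: u_def tsq_range_nonneg)
  have Bpos: "B1q (u y) > 0" for y by (rule B1q_pos[OF ran])
  define g where "g = (\<lambda>z. fst z + u (snd z) * B1q (u (snd z)))"
  \<comment> \<open>An open set around e = 0 contains negative e, for which the denominator of
    \<open>profile\<close> may vanish. \<open>W\<close> removes those points and still contains {e}
    x U for all e >= 0, because u > 0 on \<open>U\<close>.\<close>
  define W where "W = {z \<in> UNIV \<times> U. g z \<in> {0<..}}"
  define \<Phi> where "\<Phi> = (\<lambda>w z. profile (fst z) (u (snd z)) *\<^sub>R
      pform (\<phi> (snd z)) (frechet_derivative \<phi> (at (snd z)) w))"
  have oUU: "open (UNIV \<times> U :: (real \<times> (real^7)) set)" using U by (intro open_Times) auto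
  have snds: "smooth_on (UNIV \<times> U) (\<lambda>z::real \<times> (real^7). h (snd z))" if "smooth_on U h" 
    for h :: "real^7 \<Rightarrow> 'z::real_normed_vector"
    using smooth_on_compose[OF oUU U(1) that smooth_on_snd[OF oUU smooth_on_ident[OF oUU]]] by auto
  have su: "smooth_on U u" unfolding u_def by (intro smooth_on_norm_square smooth_on_fst U)
  have uz: "smooth_on (UNIV \<times> U) (\<lambda>z::real \<times> (real^7). u (snd z))" by (rule snds[OF su])
  have gs: "smooth_on (UNIV \<times> U) g"
    unfolding g_def
    by (intro smooth_on_add smooth_on_mult smooth_on_fst smooth_on_ident oUU uz
        smooth_on_compose[OF _ open_tsq_range smooth_on_B1q uz] ran)
  have oW: "open W"
    unfolding W_def using continuous_open_preimage[OF smooth_on_imp_continuous_on[OF gs] oUU, of "{0<..}"]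
    by (simp add: vimage_def Int_def)
  have subW: "W \<subseteq> UNIV \<times> U" by (auto simp: W_def)
  have pf: "smooth_on U (\<lambda>y. pform (\<phi> y) (frechet_derivative \<phi> (at y) w))" for w
  proof -
    have fd: "smooth_on U (\<lambda>y. frechet_derivative \<phi> (at y) w)"
      by (rule smooth_on_frechet_derivative[OF U(2)])
    have qc: "smooth_on U (\<lambda>y. qconj (f y))" if "smooth_on U f" for f
      by (rule smooth_on_bounded_linear[OF U(1) bounded_linear_qconj that])
    note qm = smooth_on_bilinear[OF U(1) bounded_bilinear_qmult]
    show ?thesis
      unfolding pform_def im_fibre_def im_base_def
      by (intro smooth_on_Pair smooth_on_const smooth_on_add smooth_on_scaleR smooth_on_norm_square
          smooth_on_snd qm qc smooth_on_fst fd U)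
  qed
  show "converges_with_derivs U C (\<lambda>n. pullback \<phi> (A_clarke n)) (pullback \<phi> A_lim) at_top"
  proof (rule converges_with_derivs_param[where W = W and C = C and \<Phi> = \<Phi> and e = "\<lambda>x1::real. 1 / x1"])
    show "{0} \<times> U \<subseteq> W" "{0} \<times> C \<subseteq> W"
      using C upos Bpos by (auto simp: W_def g_def)
    show "smooth_on W (\<Phi> w)" for w
      unfolding \<Phi>_def profile_def
    proof (intro smooth_on_scaleR smooth_on_divide oW)
      show "smooth_on W (\<lambda>x. A1q (u (snd x)))"
        by (rule smooth_on_subset[OF smooth_on_compose[OF oUU open_tsq_range smooth_on_A1q uz ran] subW])
      show "smooth_on W (\<lambda>x. fst x + u (snd x) * B1q (u (snd x)))"
        using smooth_on_subset[OF gs subW] by (simp add: g_def)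
      show "smooth_on W (\<lambda>x. pform (\<phi> (snd x)) (frechet_derivative \<phi> (at (snd x)) w))"
        by (rule smooth_on_subset[OF snds[OF pf] subW])
      show "\<And>x. x \<in> W \<Longrightarrow> fst x + u (snd x) * B1q (u (snd x)) \<noteq> 0"
        by (auto simp: W_def g_def)
    qed
    show "((\<lambda>x1::real. 1 / x1) \<longlongrightarrow> 0) at_top" by real_asymp
    show "\<forall>\<^sub>F x1 in at_top. {1 / x1} \<times> U \<subseteq> W"
      using eventually_gt_at_top[of 0]
    proof eventually_elim
      case (elim x1)
      then show ?case
        using upos Bpos by (auto simp: W_def g_def intro!: add_pos_pos mult_pos_pos)
    qed
    show "\<forall>\<^sub>F x1 in at_top. \<forall>w. \<forall>x\<in>U. pullback \<phi> (A_clarke x1) x w = \<Phi> w (1 / x1, x)"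
      using eventually_gt_at_top[of 0]
      by eventually_elim (simp add: pullback_def A_clarke_eq \<Phi>_def u_def)
    show "pullback \<phi> A_lim x w = \<Phi> w (0, x)" if "x \<in> U" for w x
      using upos[OF that] by (simp add: pullback_def A_lim_eq \<Phi>_def u_def)
  qed (use U C oW in auto)
qed

section \<open>Curvature\<close>

type_synonym frame_coord = "real \<times> (real^3) \<times> (real^3)"

text \<open>The orthonormal coframe dt, 2 A1 eta_i^+, 2 B1 eta_i^-: it turns the metric into the
  standard inner product, so that sums over orthonormal frames become sums over
  \<open>Basis\<close>.\<close>

definition frame_coord :: "quat \<times> quat \<Rightarrow> quat \<times> quat \<Rightarrow> frame_coord" where
  "frame_coord x v = (dt x v, (2 * A1 (norm (fst x))) *\<^sub>R (\<chi> i. \<eta>_plus i x v),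
                      (2 * B1 (norm (fst x))) *\<^sub>R (\<chi> i. \<eta>_minus i x v))"

lemma bs_metric_frame_coord:
  "fst x \<noteq> 0 \<Longrightarrow> bs_metric x v w = frame_coord x v \<bullet> frame_coord x w"
  by (simp add: bs_metric_def bs_metric_reg_def frame_coord_def inner_prod_def inner_vec_def
      sum_distrib_left power2_eq_square algebra_simps)

lemma frame_coord_eq:
  assumes "fst x \<noteq> 0" "norm (snd x) = 1"
  shows "frame_coord x v = (fst x \<bullet> fst v / norm (fst x),
    (A1 (norm (fst x)) / (norm (fst x))\<^sup>2) *\<^sub>R (2 *\<^sub>R im_fibre x v + im_base x v),
    (- B1 (norm (fst x)) / (norm (fst x))\<^sup>2) *\<^sub>R im_base x v)"
  using assms by (simp add: frame_coord_def dt_eq eta_plus_eq eta_minus_eq vec_eq_iff field_simps)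

text \<open>In the frame coordinates the curvature of the connections at hand is of this form.\<close>

definition curv_form :: "real \<Rightarrow> real \<Rightarrow> real \<Rightarrow> frame_coord \<Rightarrow> frame_coord \<Rightarrow> real^3" where
  "curv_form k1 k2 k3 v w =
     k1 *\<^sub>R (fst v *\<^sub>R fst (snd w) - fst w *\<^sub>R fst (snd v))
     + k2 *\<^sub>R cross3 (fst (snd v)) (fst (snd w)) + k3 *\<^sub>R cross3 (snd (snd v)) (snd (snd w))"

lemma bilinear_curv_form: "bilinear (curv_form k1 k2 k3)"
  unfolding bilinear_def
  by (intro conjI allI linearI)
    (simp_all add: curv_form_def cross_add_left cross_add_right cross_mult_left cross_mult_right
      algebra_simps)

lemma has_derivative_pform:
  "((\<lambda>y. pform y w) has_derivative (\<lambda>v. (0, (2 * (snd x \<bullet> snd v)) *\<^sub>R im_fibre x w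
     + (1 + (norm (snd x))\<^sup>2) *\<^sub>R snd (qconj (fst v) \<odot> fst w)
     + snd (qconj (fst v) \<odot> (snd x \<odot> qconj (snd w)) \<odot> fst x
            + qconj (fst x) \<odot> (snd v \<odot> qconj (snd w)) \<odot> fst x
            + qconj (fst x) \<odot> (snd x \<odot> qconj (snd w)) \<odot> fst v)))) (at x)"
proof -
  note qm = bounded_bilinear.FDERIV[OF bounded_bilinear_qmult]
  have f: "(fst has_derivative fst) (at x)" and s: "(snd has_derivative snd) (at x)"
    by (auto intro: bounded_linear_imp_has_derivative bounded_linear_fst bounded_linear_snd)
  have cf: "((\<lambda>y. qconj (fst y)) has_derivative (\<lambda>v. qconj (fst v))) (at x)"
    by (rule has_derivative_compose[OF f bounded_linear_imp_has_derivative[OF bounded_linear_qconj]])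
  have n: "((\<lambda>y. 1 + (norm (snd y))\<^sup>2) has_derivative (\<lambda>v. 2 * (snd x \<bullet> snd v))) (at x)"
    unfolding power2_norm_eq_inner by (auto intro!: derivative_eq_intros s simp: inner_commute)
  have 1: "((\<lambda>y. im_fibre y w) has_derivative (\<lambda>v. snd (qconj (fst v) \<odot> fst w))) (at x)"
    unfolding im_fibre_def
    by (rule has_derivative_snd[OF has_derivative_eq_rhs[OF qm[OF cf has_derivative_const]]])
      (simp add: qmult_linear_simps)
  have 2: "((\<lambda>y. im_base y w) has_derivative (\<lambda>v.
      snd (qconj (fst v) \<odot> (snd x \<odot> qconj (snd w)) \<odot> fst x
            + qconj (fst x) \<odot> (snd v \<odot> qconj (snd w)) \<odot> fst x
            + qconj (fst x) \<odot> (snd x \<odot> qconj (snd w)) \<odot> fst v))) (at x)"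
    unfolding im_base_def
    by (rule has_derivative_snd[OF has_derivative_eq_rhs[OF
            qm[OF qm[OF cf qm[OF s has_derivative_const]] f]]])
      (simp add: qmult_linear_simps algebra_simps)
  have "((\<lambda>y. (0::real, (1 + (norm (snd y))\<^sup>2) *\<^sub>R im_fibre y w + im_base y w)) has_derivative (\<lambda>v. (0,
      ((1 + (norm (snd x))\<^sup>2) *\<^sub>R snd (qconj (fst v) \<odot> fst w) + (2 * (snd x \<bullet> snd v)) *\<^sub>R im_fibre x w)
     + snd (qconj (fst v) \<odot> (snd x \<odot> qconj (snd w)) \<odot> fst x
            + qconj (fst x) \<odot> (snd v \<odot> qconj (snd w)) \<odot> fst x
            + qconj (fst x) \<odot> (snd x \<odot> qconj (snd w)) \<odot> fst v)))) (at x)"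
    by (intro has_derivative_Pair has_derivative_const has_derivative_add has_derivative_scaleR n 1 2)
  then show ?thesis
    unfolding pform_def[abs_def] by (simp add: add.commute)
qed

lemma qcomm_imaginary: "qcomm (0, a) (0, b) = (0, 2 *\<^sub>R cross3 a b)"
  by (simp add: qcomm_def qmult_def cross_skew[of b a] inner_commute scaleR_2)

lemma fst_qconj_conjugate: "fst (qconj p \<odot> z \<odot> p) = (norm p)\<^sup>2 * fst z"
proof -
  have comm: "fst (a \<odot> b) = fst (b \<odot> a)" for a b
    by (simp add: qmult_def inner_commute mult.commute)
  have "fst (qconj p \<odot> z \<odot> p) = fst (p \<odot> qconj p \<odot> z)" by (metis comm qmult_assoc)
  then show ?thesis by (simp add: qmult_qconj qmult_real_left)
qed

text \<open>This is the Maurer-Cartan equation of SU(2)^2. In the basis T_i^+, T_i^- both [T^+, T^+]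
  and [T^-, T^-] lie in the span of the T_k^+, whereas [T^+, T^-] does not contribute; hence the
  terms \<open>P\<close> x \<open>P\<close> and \<open>im_base\<close> x \<open>im_base\<close>
  appear, and no mixed ones.\<close>

lemma curvature_pform:
  assumes p: "fst x \<noteq> 0" and q: "norm (snd x) = 1"
    and A: "\<And>y v. fst y \<noteq> 0 \<Longrightarrow> A y v = G ((norm (fst y))\<^sup>2) *\<^sub>R pform y v"
    and G: "(G has_field_derivative G') (at ((norm (fst x))\<^sup>2))"
    and tan: "v \<in> tangent_M x" "w \<in> tangent_M x"
  defines "n \<equiv> (norm (fst x))\<^sup>2"
  defines "P \<equiv> \<lambda>v. 2 *\<^sub>R im_fibre x v + im_base x v"
  shows "curvature A x v w = (0,
     (2 * G' + 2 * G n / n) *\<^sub>R ((fst x \<bullet> fst v) *\<^sub>R P w - (fst x \<bullet> fst w) *\<^sub>R P v)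
     + (2 * (G n)\<^sup>2 - G n / n) *\<^sub>R cross3 (P v) (P w) - (G n / n) *\<^sub>R cross3 (im_base x v) (im_base x w))"
proof -
  define p q where "p = fst x" and "q = snd x"
  define X Y where "X = im_base x v" and "Y = im_base x w"
  \<comment> \<open>Every derivative term is rewritten in V, W, X, Y by inserting p (qconj p) = n,
    at the price of a factor m = 1 / n each time.\<close>
  define V W where "V = qconj p \<odot> fst v" and "W = qconj p \<odot> fst w"
  define m g where "m = 1 / n" and "g = G n"
  have npos: "n > 0" using p by (simp add: n_def)
  have ppc: "p \<odot> (qconj p \<odot> z) = n *\<^sub>R z" for z
    by (simp add: qmult_assoc[symmetric] qmult_qconj qmult_real_left n_def p_def)
  have base: "qconj p \<odot> (q \<odot> qconj (snd u)) \<odot> p = (0, im_base x u)" if "u \<in> tangent_M x" for u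
    using that fst_qconj_conjugate[of p "q \<odot> qconj (snd u)"]
    by (simp add: prod_eq_iff im_base_def fst_qmult_qconj tangent_M_def p_def q_def)
  have a: "qconj (fst v) \<odot> fst w = m *\<^sub>R (qconj V \<odot> W)" "qconj (fst w) \<odot> fst v = m *\<^sub>R (qconj W \<odot> V)"
    using npos by (simp_all add: V_def W_def qconj_qmult qmult_assoc ppc qmult_linear_simps m_def)
  have c: "qconj (fst v) \<odot> (q \<odot> qconj (snd w)) \<odot> p = m *\<^sub>R (qconj V \<odot> (0, Y))"
      "qconj (fst w) \<odot> (q \<odot> qconj (snd v)) \<odot> p = m *\<^sub>R (qconj W \<odot> (0, X))"
    unfolding X_def Y_def base[OF tan(1), symmetric] base[OF tan(2), symmetric]
    using npos by (simp_all add: V_def W_def qconj_qmult qmult_assoc ppc qmult_linear_simps m_def)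
  have d: "qconj p \<odot> (q \<odot> qconj (snd w)) \<odot> fst v = m *\<^sub>R ((0, Y) \<odot> V)"
      "qconj p \<odot> (q \<odot> qconj (snd v)) \<odot> fst w = m *\<^sub>R ((0, X) \<odot> W)"
    unfolding X_def Y_def base[OF tan(1), symmetric] base[OF tan(2), symmetric]
    using npos by (simp_all add: V_def W_def qconj_qmult qmult_assoc ppc qmult_linear_simps m_def)
  \<comment> \<open>For unit q and a tangent vector u the quaternion q (qconj u) is imaginary, hence
    equal to minus its conjugate. This expresses the dq terms through
    \<open>im_base\<close>.\<close>
  have refl: "snd u = - (q \<odot> (qconj (snd u) \<odot> q))" if "u \<in> tangent_M x" for u
  proof -
    have "fst (q \<odot> qconj (snd u)) = 0"
      using that by (simp add: fst_qmult_qconj tangent_M_def q_def)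
    then have "q \<odot> qconj (snd u) = - qconj (q \<odot> qconj (snd u))"
      by (simp add: prod_eq_iff)
    then have "q \<odot> qconj (snd u) \<odot> q = - (snd u \<odot> qconj q) \<odot> q"
      by (simp add: qconj_qmult)
    then show ?thesis
      using assms(2) by (simp add: qmult_assoc qmult_linear_simps qconj_qmult_self qmult_real_right q_def)
  qed
  have e: "qconj p \<odot> (snd v \<odot> qconj (snd w)) \<odot> p = - (m *\<^sub>R ((0, X) \<odot> (0, Y)))"
      "qconj p \<odot> (snd w \<odot> qconj (snd v)) \<odot> p = - (m *\<^sub>R ((0, Y) \<odot> (0, X)))"
    unfolding X_def Y_def base[OF tan(1), symmetric] base[OF tan(2), symmetric]
    using npos
    by (simp_all add: refl[OF tan(1), THEN arg_cong[where f = "\<lambda>u. u \<odot> qconj (snd w)"]]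
        refl[OF tan(2), THEN arg_cong[where f = "\<lambda>u. u \<odot> qconj (snd v)"]]
        qmult_assoc ppc qmult_linear_simps m_def)
  have V: "fst V = p \<bullet> fst v" "snd V = im_fibre x v" and W: "fst W = p \<bullet> fst w" "snd W = im_fibre x w"
    by (simp_all add: V_def W_def fst_qconj_qmult im_fibre_def p_def)
  have "open {y :: quat \<times> quat. fst y \<noteq> 0}"
    by (intro open_Collect_neq continuous_intros)
  then have fd: "frechet_derivative (\<lambda>y. A y w) (at x) = frechet_derivative
      (\<lambda>y. G ((norm (fst y))\<^sup>2) *\<^sub>R pform y w) (at x)" for w
    by (rule frechet_derivative_cong_open) (use p A in auto)
  have nd: "((\<lambda>y. (norm (fst y))\<^sup>2) has_derivative (\<lambda>v. 2 * (p \<bullet> fst v))) (at x)"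
    unfolding power2_norm_eq_inner p_def
    by (auto intro!: derivative_eq_intros bounded_linear_imp_has_derivative bounded_linear_fst
        simp: inner_commute)
  have Gd: "((\<lambda>y. G ((norm (fst y))\<^sup>2)) has_derivative (\<lambda>v. G' * (2 * (p \<bullet> fst v)))) (at x)"
    using has_derivative_compose[OF nd G[unfolded has_field_derivative_def]] .
  have "frechet_derivative (\<lambda>y. A y w) (at x) v =
      (0, (G' * (2 * (p \<bullet> fst v))) *\<^sub>R P w + g *\<^sub>R (2 *\<^sub>R snd (qconj (fst v) \<odot> fst w)
       + snd (qconj (fst v) \<odot> (q \<odot> qconj (snd w)) \<odot> p + qconj p \<odot> (snd v \<odot> qconj (snd w)) \<odot> p
            + qconj p \<odot> (q \<odot> qconj (snd w)) \<odot> fst v)))"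
    if "v \<in> tangent_M x" for v w
    unfolding fd frechet_derivative_at[OF has_derivative_scaleR[OF Gd has_derivative_pform], symmetric]
    using that q by (simp add: tangent_M_def P_def pform_def p_def q_def g_def n_def)
  note this[OF tan(1), of w] this[OF tan(2), of v]
  moreover have "qcomm (A x v) (A x w) = (0, (2 * g\<^sup>2) *\<^sub>R cross3 (P v) (P w))"
    using p q by (simp add: A pform_def P_def qcomm_imaginary cross_mult_left cross_mult_right
        power2_eq_square g_def n_def)
  ultimately have "curvature A x v w =
     (0, (G' * (2 * fst V)) *\<^sub>R P w + g *\<^sub>R (2 *\<^sub>R snd (m *\<^sub>R (qconj V \<odot> W))
       + snd (m *\<^sub>R (qconj V \<odot> (0, Y)) + - (m *\<^sub>R ((0, X) \<odot> (0, Y))) + m *\<^sub>R ((0, Y) \<odot> V)))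
       - ((G' * (2 * fst W)) *\<^sub>R P v + g *\<^sub>R (2 *\<^sub>R snd (m *\<^sub>R (qconj W \<odot> V))
       + snd (m *\<^sub>R (qconj W \<odot> (0, X)) + - (m *\<^sub>R ((0, Y) \<odot> (0, X))) + m *\<^sub>R ((0, X) \<odot> W))))
       + (2 * g\<^sup>2) *\<^sub>R cross3 (P v) (P w))"
    unfolding curvature_def a c d e V W by simp
  \<comment> \<open>A polynomial identity in the components of V, W, X, Y, in which the products of
    X with W and of Y with V combine into \<open>P\<close>.\<close>
  also have "\<dots> = (0,
     (2 * G' + 2 * g * m) *\<^sub>R (fst V *\<^sub>R P w - fst W *\<^sub>R P v)
     + (2 * g\<^sup>2 - g * m) *\<^sub>R cross3 (P v) (P w) - (g * m) *\<^sub>R cross3 X Y)"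
    unfolding P_def V(2)[symmetric] W(2)[symmetric] X_def[symmetric] Y_def[symmetric]
    by (simp add: vec_eq_iff forall_3 qmult_def qconj_def cross3_def vector_3 algebra_simps
        power2_eq_square)
  finally show ?thesis
    by (simp add: V W m_def g_def X_def Y_def p_def)
qed


text \<open>Invariance of the Hilbert-Schmidt norm, from Parseval. It frees
  \<open>curv_norm2\<close> from the frame picked by Hilbert choice.\<close>

lemma sum_norm_linear_orthonormal:
  fixes u :: "'n::finite \<Rightarrow> 'a::euclidean_space" and g :: "'a \<Rightarrow> 'b::real_inner"
  assumes u: "\<And>i j. u i \<bullet> u j = (if i = j then 1 else 0)" and card: "CARD('n) = DIM('a)"
    and g: "linear g"
  shows "(\<Sum>i\<in>UNIV. (norm (g (u i)))\<^sup>2) = (\<Sum>b\<in>Basis. (norm (g b))\<^sup>2)"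
proof -
  have inj: "inj u" by (rule injI) (metis u zero_neq_one)
  have orth: "pairwise orthogonal (range u)"
    using u by (auto simp: pairwise_def orthogonal_def)
  have nz: "0 \<notin> range u" using u by (metis imageE inner_zero_left zero_neq_one)
  have "dim (range u) = card (range u)"
    using pairwise_orthogonal_independent[OF orth nz] by (rule dim_eq_card_independent)
  also have "\<dots> = DIM('a)" using card_image[OF inj] card by simp
  finally have span: "span (range u) = UNIV" by (rule dim_eq_full[THEN iffD1])
  have parseval: "(\<Sum>i\<in>UNIV. (u i \<bullet> x) * (u i \<bullet> y)) = x \<bullet> y" for x y
  proof -
    define z where "z = x - (\<Sum>i\<in>UNIV. (u i \<bullet> x) *\<^sub>R u i)"
    have "z \<bullet> u j = 0" for j
      by (simp add: z_def inner_diff_left inner_sum_left u inner_commute[of x]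
          if_distrib[of "\<lambda>y. _ * y"] cong: if_cong)
    then have "orthogonal z y" if "y \<in> range u" for y using that by (auto simp: orthogonal_def)
    then have "orthogonal z z"
      using orthogonal_to_span[of z "range u" z] span by auto
    then have "x = (\<Sum>i\<in>UNIV. (u i \<bullet> x) *\<^sub>R u i)" by (simp add: z_def orthogonal_self)
    then have "x \<bullet> y = (\<Sum>i\<in>UNIV. (u i \<bullet> x) *\<^sub>R u i) \<bullet> y" by simp
    then show ?thesis by (simp add: inner_sum_left)
  qed
  have ex: "g (u i) = (\<Sum>b\<in>Basis. (u i \<bullet> b) *\<^sub>R g b)" for i
    by (subst (1) euclidean_representation[symmetric])
      (simp add: linear_sum[OF g] linear_scale[OF g])
  have "(\<Sum>i\<in>UNIV. (norm (g (u i)))\<^sup>2)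
      = (\<Sum>i\<in>UNIV. \<Sum>b\<in>Basis. \<Sum>c\<in>Basis. (u i \<bullet> b) * (u i \<bullet> c) * (g b \<bullet> g c))"
    unfolding ex power2_norm_eq_inner
    by (simp add: inner_sum_left inner_sum_right sum_distrib_left mult.assoc)
      (simp add: inner_commute)
  also have "\<dots> = (\<Sum>b\<in>Basis. \<Sum>c\<in>Basis. \<Sum>i\<in>UNIV. (u i \<bullet> b) * (u i \<bullet> c) * (g b \<bullet> g c))"
    by (subst sum.swap, rule sum.cong[OF refl], rule sum.swap)
  also have "\<dots> = (\<Sum>b\<in>Basis. \<Sum>c\<in>Basis. (b \<bullet> c) * (g b \<bullet> g c))"
    by (simp add: parseval flip: sum_distrib_right)
  also have "\<dots> = (\<Sum>b\<in>Basis. g b \<bullet> g b)"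
    by (intro sum.cong refl) (simp add: inner_Basis if_distrib[of "\<lambda>x. x * _"] cong: if_cong)
  finally show ?thesis by (simp add: power2_norm_eq_inner)
qed

lemma sum_norm_bilinear_orthonormal:
  fixes u :: "'n::finite \<Rightarrow> 'a::euclidean_space" and B :: "'a \<Rightarrow> 'a \<Rightarrow> 'b::real_inner"
  assumes u: "\<And>i j. u i \<bullet> u j = (if i = j then 1 else 0)" and card: "CARD('n) = DIM('a)"
    and B: "bilinear B"
  shows "(\<Sum>i\<in>UNIV. \<Sum>j\<in>UNIV. (norm (B (u i) (u j)))\<^sup>2) = (\<Sum>b\<in>Basis. \<Sum>c\<in>Basis. (norm (B b c))\<^sup>2)"
proof -
  have lin: "linear (B v)" "linear (\<lambda>v. B v w)" for v w using B by (auto simp: bilinear_def)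
  have "(\<Sum>i\<in>UNIV. \<Sum>j\<in>UNIV. (norm (B (u i) (u j)))\<^sup>2) = (\<Sum>i\<in>UNIV. \<Sum>c\<in>Basis. (norm (B (u i) c))\<^sup>2)"
    by (simp add: sum_norm_linear_orthonormal[OF u card lin(1)])
  also have "\<dots> = (\<Sum>c\<in>Basis. \<Sum>i\<in>UNIV. (norm (B (u i) c))\<^sup>2)" by (rule sum.swap)
  also have "\<dots> = (\<Sum>c\<in>Basis. \<Sum>b\<in>Basis. (norm (B b c))\<^sup>2)"
    by (simp add: sum_norm_linear_orthonormal[OF u card lin(2)])
  finally show ?thesis by (subst sum.swap)
qed

lemma sum_Basis_prod:
  fixes f :: "'a::euclidean_space \<times> 'b::euclidean_space \<Rightarrow> 'c::comm_monoid_add"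
  shows "sum f Basis = (\<Sum>i\<in>Basis. f (i, 0)) + (\<Sum>i\<in>Basis. f (0, i))"
proof -
  have "inj_on (\<lambda>u. (u::'a, 0::'b)) Basis" "inj_on (\<lambda>u. (0::'a, u::'b)) Basis"
    by (auto intro!: inj_onI Pair_inject)
  then show ?thesis
    unfolding Basis_prod_def
    by (subst sum.union_disjoint) (auto simp: Basis_prod_def sum.reindex)
qed

lemma sum_Basis_real3: "(\<Sum>b\<in>Basis. f (b::real^3)) = f (axis 1 1) + f (axis 2 1) + f (axis 3 1)"
proof -
  have "(Basis :: (real^3) set) = {axis 1 1, axis 2 1, axis 3 1}"
    by (auto simp: Basis_vec_def UNIV_3)
  show ?thesis unfolding \<open>Basis = _\<close> by (simp add: axis_eq_axis add.assoc)
qed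

text \<open>Each of the three terms is nonzero on exactly 6 ordered pairs of basis vectors, with
  unit value there up to sign, and no pair is shared by two terms.\<close>

lemma sum_norm_curv_form:
  "(\<Sum>b\<in>Basis. \<Sum>c\<in>Basis. (norm (curv_form k1 k2 k3 b c))\<^sup>2) = 6 * (k1\<^sup>2 + k2\<^sup>2 + k3\<^sup>2)"
  unfolding sum_Basis_prod sum_Basis_real3 Basis_real_def
  by (simp add: curv_form_def cross_basis norm_axis_1 power_mult_distrib
      cross_skew[of "axis 1 1" "axis 3 1"])

lemma exists_tangent_frame_coord:
  assumes p: "fst x \<noteq> 0" and q: "norm (snd x) = 1"
  shows "\<exists>v\<in>tangent_M x. frame_coord x v = z"
proof -
  define t where "t = norm (fst x)"
  have t: "t > 0" using p by (simp add: t_def)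
  have AB: "A1 t > 0" "B1 t > 0" using t by (simp_all add: A1_pos B1_pos)
  obtain a b c where z: "z = (a, b, c)" by (metis prod.exhaust)
  \<comment> \<open>Inverse of \<open>frame_coord_eq\<close>: the last coordinate determines X, the
    first two then determine V, and (qconj p) \<xi> p = X is solved by \<xi> = p X (qconj p) /
    |p|^4. The tangent vector is read off from (qconj p) dp = V and q (qconj dq) = \<xi>.\<close>
  define X where "X = (- t\<^sup>2 / B1 t) *\<^sub>R c"
  define V where "V = (t * a, (1/2) *\<^sub>R ((t\<^sup>2 / A1 t) *\<^sub>R b - X))"
  define \<xi> where "\<xi> = (1 / t ^ 4) *\<^sub>R (fst x \<odot> (0, X) \<odot> qconj (fst x))"
  define v where "v = ((1 / t\<^sup>2) *\<^sub>R (fst x \<odot> V), qconj (qconj (snd x) \<odot> \<xi>))"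
  have cpp: "qconj (fst x) \<odot> (fst x \<odot> y) = t\<^sup>2 *\<^sub>R y" for y
    by (simp add: qmult_assoc[symmetric] qconj_qmult_self qmult_real_left t_def)
  have pc: "y \<odot> (qconj (fst x) \<odot> fst x) = t\<^sup>2 *\<^sub>R y" for y
    by (simp add: qconj_qmult_self qmult_real_right t_def)
  have q1: "snd x \<odot> (qconj (snd x) \<odot> y) = y" for y
    using q by (simp add: qmult_assoc[symmetric] qmult_qconj qmult_real_left)
  have V: "qconj (fst x) \<odot> fst v = V"
    using t by (simp add: v_def qmult_linear_simps cpp)
  have \<xi>: "snd x \<odot> qconj (snd v) = \<xi>" by (simp add: v_def q1)
  have "fst \<xi> = 0"
    by (simp add: \<xi>_def quat_expand algebra_simps)
  then have "v \<in> tangent_M x"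
    using fst_qmult_qconj[of "snd x" "snd v"] by (simp add: tangent_M_def \<xi>)
  moreover have "im_base x v = X"
    using t unfolding im_base_def \<xi>
    by (simp add: \<xi>_def qmult_linear_simps qmult_assoc cpp pc power2_eq_square power4_eq_xxxx)
  moreover have "im_fibre x v = snd V" "fst x \<bullet> fst v = fst V"
    using V by (simp_all add: im_fibre_def flip: fst_qconj_qmult)
  ultimately show ?thesis
    using t AB by (intro bexI[of _ v])
      (simp_all add: frame_coord_eq[OF p q] z V_def X_def flip: t_def)
qed

lemma su2_inner_imaginary: "su2_inner (0, a) (0, a) = 2 * (norm a)\<^sup>2"
  by (simp add: su2_inner_eq qmult_def power2_norm_eq_inner)

lemma exists_bs_orthonormal_frame:
  assumes p: "fst x \<noteq> 0" and q: "norm (snd x) = 1"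
  shows "\<exists>e. bs_orthonormal_frame x e"
proof -
  have "card (UNIV :: 7 set) = card (Basis :: frame_coord set)" by simp
  then obtain b where b: "bij_betw b (UNIV :: 7 set) (Basis :: frame_coord set)"
    using finite_same_card_bij[of "UNIV :: 7 set" "Basis :: frame_coord set"] by auto
  obtain e where e: "\<And>i. e i \<in> tangent_M x" "\<And>i. frame_coord x (e i) = b i"
  proof -
    have "\<forall>i. \<exists>v. v \<in> tangent_M x \<and> frame_coord x v = b i"
      using exists_tangent_frame_coord[OF assms] by blast
    from choice[OF this] that show ?thesis by blast
  qed
  have "b i \<bullet> b j = (if i = j then 1 else 0)" for i j
  proof -
    have "b i \<in> Basis" "b j \<in> Basis" "b i = b j \<longleftrightarrow> i = j"
      using b by (auto simp: bij_betw_def inj_on_def)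
    then show ?thesis by (simp add: inner_Basis)
  qed
  then show ?thesis
    unfolding bs_orthonormal_frame_def using e by (intro exI[of _ e]) (simp add: bs_metric_frame_coord[OF p])
qed

text \<open>The coefficients of \<open>curvature_pform\<close> refer to the forms p . dp,
  \<open>P\<close> and \<open>im_base\<close>, whose lengths in the orthonormal coframe are t, t^2 /
  A1 and t^2 / B1. The extra factors are products of two such lengths.\<close>

lemma curv_norm2_pform:
  assumes p: "fst x \<noteq> 0" and q: "norm (snd x) = 1"
    and A: "\<And>y v. fst y \<noteq> 0 \<Longrightarrow> A y v = G ((norm (fst y))\<^sup>2) *\<^sub>R pform y v"
    and G: "(G has_field_derivative G') (at ((norm (fst x))\<^sup>2))"
  defines "t \<equiv> norm (fst x)"
  shows "curv_norm2 A x = 6 * (((2 * G' + 2 * G (t\<^sup>2) / t\<^sup>2) * (t ^ 3 / A1 t))\<^sup>2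
    + ((2 * (G (t\<^sup>2))\<^sup>2 - G (t\<^sup>2) / t\<^sup>2) * (t ^ 4 / (A1 t)\<^sup>2))\<^sup>2 + (G (t\<^sup>2) * t\<^sup>2 / (B1 t)\<^sup>2)\<^sup>2)"
proof -
  have t: "t > 0" using p by (simp add: t_def)
  have AB: "A1 t > 0" "B1 t > 0" using t by (simp_all add: A1_pos B1_pos)
  define k1 k2 k3 where "k1 = (2 * G' + 2 * G (t\<^sup>2) / t\<^sup>2) * (t ^ 3 / A1 t)"
    and "k2 = (2 * (G (t\<^sup>2))\<^sup>2 - G (t\<^sup>2) / t\<^sup>2) * (t ^ 4 / (A1 t)\<^sup>2)"
    and "k3 = - (G (t\<^sup>2) * t\<^sup>2 / (B1 t)\<^sup>2)"
  have F: "curvature A x v w = (0, curv_form k1 k2 k3 (frame_coord x v) (frame_coord x w))"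
    if "v \<in> tangent_M x" "w \<in> tangent_M x" for v w
  proof -
    define P where "P = (\<lambda>v. 2 *\<^sub>R im_fibre x v + im_base x v)"
    have fc: "frame_coord x v = (fst x \<bullet> fst v / t, (A1 t / t\<^sup>2) *\<^sub>R P v, (- B1 t / t\<^sup>2) *\<^sub>R im_base x v)" for v
      unfolding frame_coord_eq[OF p q] P_def t_def ..
    have 1: "(t ^ 3 / A1 t) * (1 / t * (A1 t / t\<^sup>2)) = 1" "(t ^ 4 / (A1 t)\<^sup>2) * (A1 t / t\<^sup>2 * (A1 t / t\<^sup>2)) = 1"
      using t AB by (simp_all add: field_simps power2_eq_square power3_eq_cube power4_eq_xxxx)
    have "curv_form k1 k2 k3 (frame_coord x v) (frame_coord x w)
      = (k1 * (1 / t * (A1 t / t\<^sup>2))) *\<^sub>R ((fst x \<bullet> fst v) *\<^sub>R P w - (fst x \<bullet> fst w) *\<^sub>R P v)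
      + (k2 * (A1 t / t\<^sup>2 * (A1 t / t\<^sup>2))) *\<^sub>R cross3 (P v) (P w)
      + (k3 * (B1 t / t\<^sup>2 * (B1 t / t\<^sup>2))) *\<^sub>R cross3 (im_base x v) (im_base x w)"
      unfolding fc curv_form_def by (simp add: cross_mult_left cross_mult_right scaleR_diff_right mult_ac)
    moreover have "k1 * (1 / t * (A1 t / t\<^sup>2)) = 2 * G' + 2 * G (t\<^sup>2) / t\<^sup>2"
      "k2 * (A1 t / t\<^sup>2 * (A1 t / t\<^sup>2)) = 2 * (G (t\<^sup>2))\<^sup>2 - G (t\<^sup>2) / t\<^sup>2"
      unfolding k1_def k2_def mult.assoc 1 by simp_all
    moreover have "k3 * (B1 t / t\<^sup>2 * (B1 t / t\<^sup>2)) = - (G (t\<^sup>2) / t\<^sup>2)"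
      unfolding k3_def using t AB by (simp add: field_simps power2_eq_square)
    moreover     have "curvature A x v w = (0, (2 * G' + 2 * G (t\<^sup>2) / t\<^sup>2) *\<^sub>R ((fst x \<bullet> fst v) *\<^sub>R P w - (fst x \<bullet> fst w) *\<^sub>R P v)
     + (2 * (G (t\<^sup>2))\<^sup>2 - G (t\<^sup>2) / t\<^sup>2) *\<^sub>R cross3 (P v) (P w)
     - (G (t\<^sup>2) / t\<^sup>2) *\<^sub>R cross3 (im_base x v) (im_base x w))"
      unfolding P_def t_def by (rule curvature_pform[OF p q A G that])
    ultimately show ?thesis by simp
  qed
  define e where "e = (SOME e. bs_orthonormal_frame x e)"
  have "bs_orthonormal_frame x e"
    unfolding e_def using exists_bs_orthonormal_frame[OF p q] by (rule someI_ex)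
  then have e: "\<And>i. e i \<in> tangent_M x"
      "\<And>i j. frame_coord x (e i) \<bullet> frame_coord x (e j) = (if i = j then 1 else 0)"
    by (auto simp: bs_orthonormal_frame_def bs_metric_frame_coord[OF p])
  \<comment> \<open>The factor 2 of \<open>su2_inner\<close> on imaginary quaternions cancels the
    1/2 for counting ordered pairs.\<close>
  have "curv_norm2 A x = (\<Sum>i\<in>UNIV. \<Sum>j\<in>UNIV. (norm (curv_form k1 k2 k3 (frame_coord x (e i)) (frame_coord x (e j))))\<^sup>2)"
    unfolding curv_norm2_def Let_def e_def[symmetric] F[OF e(1) e(1)] su2_inner_imaginary
    by (simp flip: sum_distrib_left)
  also have "\<dots> = 6 * (k1\<^sup>2 + k2\<^sup>2 + k3\<^sup>2)"
    using sum_norm_bilinear_orthonormal[OF e(2) _ bilinear_curv_form] by (simp add: sum_norm_curv_form)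
  finally show ?thesis unfolding k1_def k2_def k3_def by simp
qed


text \<open>The three curvature components as functions of \<open>r\<close>, with \<open>e = 3 / x1\<close> for \<open>A_clarke x1\<close> and
  \<open>e = 0\<close> for \<open>A_lim\<close>.\<close>

definition curv1 :: "real \<Rightarrow> real \<Rightarrow> real" where
  "curv1 e r = (e * (2 * r ^ 3 + 1) - (r - 1)\<^sup>2 * (2 * r + 1)) / (r ^ 3 * (r\<^sup>2 - 1 + e)\<^sup>2)"

definition curv2 :: "real \<Rightarrow> real \<Rightarrow> real" where
  "curv2 e r = - ((r - 1)\<^sup>2 * (r + 2) + 3 * r * e) / (r * (r\<^sup>2 - 1 + e)\<^sup>2)"

definition curv3 :: "real \<Rightarrow> real \<Rightarrow> real" where
  "curv3 e r = - (r ^ 3 - 1) / (r ^ 3 * (r\<^sup>2 - 1 + e))"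

definition curv_sq :: "real \<Rightarrow> real \<Rightarrow> real" where
  "curv_sq e r = 6 * ((curv1 e r)\<^sup>2 + (curv2 e r)\<^sup>2 + (curv3 e r)\<^sup>2)"

lemma r_of_t_gt_1: "t > 0 \<Longrightarrow> r_of_t t > 1"
  using tsq_inv_eq[OF tsq_range_nonneg, of "t\<^sup>2"] wq_pos[OF tsq_range_nonneg, of "t\<^sup>2"]
  by (simp add: r_of_t_eq)

text \<open>u * profile is half the coefficient of the sum of T_i tensor eta_i^+. The argument e / 3
  absorbs the 1/3 in B1^2 - 1/3 = (r^2 - 1) / 3.\<close>

lemma profile_eq:
  assumes "u > 0" "e \<ge> 0"
  defines "r \<equiv> 1 + tsq_inv u"
  shows "u * profile (e / 3) u = (r ^ 3 - 1) / (3 * r * (r\<^sup>2 - 1 + e))"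
proof -
  define t where "t = sqrt u"
  have t: "t > 0" "t\<^sup>2 = u" using assms by (auto simp: t_def)
  have r: "r = r_of_t t" using t by (simp add: r_def r_of_t_eq)
  have A: "u * A1q u = (r ^ 3 - 1) / (9 * r)"
    using A1_square[of t] A1_square_r[of t] t by (simp add: r)
  have B: "u * B1q u = (r\<^sup>2 - 1) / 3"
    using B1_square[of t] t by (simp add: r B1_def power_divide field_simps)
  have r1: "r > 1" using r_of_t_gt_1[OF t(1)] r by simp
  then have "1 < r\<^sup>2" by (intro one_less_power) auto
  then have "r\<^sup>2 - 1 + e > 0" using assms(2) by linarith
  moreover have "u * profile (e / 3) u = ((r ^ 3 - 1) / (9 * r)) / (e / 3 + (r\<^sup>2 - 1) / 3)"
    unfolding profile_def A[symmetric] B[symmetric] by simp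
  moreover have "e / 3 + (r\<^sup>2 - 1) / 3 = (r\<^sup>2 - 1 + e) / 3" by simp
  moreover have "(a / (9 * r)) / (D / 3) = a / (3 * r * D)" if "D > 0" for a D
    using that r1 by simp
  ultimately show ?thesis by (simp only:)
qed

lemma smooth_profile_differentiable:
  assumes "u > 0" "e \<ge> 0"
  shows "\<exists>G'. (profile e has_field_derivative G') (at u)"
proof -
  have "\<exists>a. (A1q has_field_derivative a) (at u)" "\<exists>b. (B1q has_field_derivative b) (at u)"
    using smooth_on_has_real_derivative[OF smooth_on_A1q] smooth_on_has_real_derivative[OF smooth_on_B1q]
      tsq_range_nonneg[of u] assms(1) by auto
  then obtain a b where "(A1q has_field_derivative a) (at u)" "(B1q has_field_derivative b) (at u)"
    by blast
  moreover have "e + u * B1q u \<noteq> 0"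
    using assms B1q_pos[OF tsq_range_nonneg[of u]] by (intro less_imp_neq[symmetric] add_nonneg_pos) auto
  ultimately show ?thesis
    unfolding profile_def[abs_def] by (intro exI) (rule derivative_eq_intros refl | assumption)+
qed

text \<open>The first identity is stated for squares because dr/du enters it through
  \<open>tsq_inv_derivative\<close>, which records only its square. In the third the two sides
  before squaring have opposite signs.\<close>

lemma profile_curvature:
  assumes t: "t > 0" and e: "e \<ge> 0"
    and G': "(profile (e / 3) has_field_derivative G') (at (t\<^sup>2))"
  defines "r \<equiv> r_of_t t" and "G \<equiv> profile (e / 3) (t\<^sup>2)"
  shows "((2 * G' + 2 * G / t\<^sup>2) * (t ^ 3 / A1 t))\<^sup>2 = (curv1 e r)\<^sup>2"
    and "(2 * G\<^sup>2 - G / t\<^sup>2) * (t ^ 4 / (A1 t)\<^sup>2) = curv2 e r"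
    and "(G * t\<^sup>2 / (B1 t)\<^sup>2)\<^sup>2 = (curv3 e r)\<^sup>2"
proof -
  define u where "u = t\<^sup>2"
  define D where "D = r\<^sup>2 - 1 + e"
  have u: "u > 0" using t by (simp add: u_def)
  have r1: "r > 1" using r_of_t_gt_1[OF t] by (simp add: r_def)
  have D: "D > 0" using e one_less_power[OF r1, of 2] by (simp add: D_def)
  have r3: "r ^ 3 - 1 > 0" using one_less_power[OF r1, of 3] by simp
  have ru: "r = 1 + tsq_inv u" using t by (simp add: r_def u_def r_of_t_eq)
  have A: "(A1 t)\<^sup>2 = (r ^ 3 - 1) / (9 * r)" using A1_square_r[of t] t by (simp add: r_def)
  have h: "u * G = (r ^ 3 - 1) / (3 * r * D)"
    using profile_eq[OF u e] by (simp add: G_def u_def D_def ru)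
  obtain d where d: "(tsq_inv has_field_derivative d) (at u)" "4 * u * d\<^sup>2 = 1 - 1 / r ^ 3"
    using tsq_inv_derivative[OF u] ru by metis
  \<comment> \<open>G + u G' is the derivative of u G, which is next computed a second time as a
    function of r; comparing the two eliminates G'.\<close>
  have "((\<lambda>u. u * profile (e / 3) u) has_field_derivative G + u * G') (at u)"
    using G' by (auto intro!: derivative_eq_intros simp: G_def u_def)
  moreover have "((\<lambda>u. u * profile (e / 3) u) has_field_derivative (r * curv1 e r / 3) * d) (at u)"
  proof (rule has_field_derivative_transform_within_open)
    have "((\<lambda>r. (r ^ 3 - 1) / (3 * r * (r\<^sup>2 - 1 + e))) has_field_derivative (r * curv1 e r / 3)) (at r)"
    proof (rule DERIV_cong)
      show "((\<lambda>r. (r ^ 3 - 1) / (3 * r * (r\<^sup>2 - 1 + e))) has_field_derivative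
        ((3 * r\<^sup>2) * (3 * r * (r\<^sup>2 - 1 + e)) - (r ^ 3 - 1) * (3 * (r\<^sup>2 - 1 + e) + 3 * r * (2 * r)))
         / (3 * r * (r\<^sup>2 - 1 + e))\<^sup>2) (at r)"
        using r1 D by (auto intro!: derivative_eq_intros simp: D_def power2_eq_square)
      have cancel: "3 * N / (3 * r * D)\<^sup>2 = r * (N / (r ^ 3 * D\<^sup>2)) / 3" for N
        using r1 D by (simp add: field_simps power2_eq_square power3_eq_cube)
      have "(3 * r\<^sup>2) * (3 * r * D) - (r ^ 3 - 1) * (3 * D + 3 * r * (2 * r))
         = 3 * (e * (2 * r ^ 3 + 1) - (r - 1)\<^sup>2 * (2 * r + 1))"
        by (simp add: D_def power2_eq_square power3_eq_cube algebra_simps)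
      then show "((3 * r\<^sup>2) * (3 * r * (r\<^sup>2 - 1 + e)) - (r ^ 3 - 1) * (3 * (r\<^sup>2 - 1 + e) + 3 * r * (2 * r)))
         / (3 * r * (r\<^sup>2 - 1 + e))\<^sup>2 = r * curv1 e r / 3"
        unfolding curv1_def D_def[symmetric] by (simp only: cancel)
    qed
    then have "((\<lambda>r. (r ^ 3 - 1) / (3 * r * (r\<^sup>2 - 1 + e))) has_field_derivative (r * curv1 e r / 3))
        (at (1 + tsq_inv u))" by (simp only: ru)
    moreover have "((\<lambda>u. 1 + tsq_inv u) has_field_derivative d) (at u)"
      using d(1) by (auto intro!: derivative_eq_intros)
    ultimately show "((\<lambda>u. (\<lambda>r. (r ^ 3 - 1) / (3 * r * (r\<^sup>2 - 1 + e))) (1 + tsq_inv u))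
        has_field_derivative (r * curv1 e r / 3) * d) (at u)"
      by (rule DERIV_chain2)
    show "\<And>u. u \<in> {0<..} \<Longrightarrow> (\<lambda>r. (r ^ 3 - 1) / (3 * r * (r\<^sup>2 - 1 + e))) (1 + tsq_inv u)
        = u * profile (e / 3) u"
      using profile_eq[OF _ e] by simp
  qed (use u in auto)
  ultimately have "G + u * G' = (r * curv1 e r / 3) * d" by (rule DERIV_unique)
  moreover have "2 * G' + 2 * G / t\<^sup>2 = 2 / u * (G + u * G')"
    using u by (simp add: field_simps flip: u_def)
  ultimately have E: "2 * G' + 2 * G / t\<^sup>2 = 2 / u * ((r * curv1 e r / 3) * d)" by (simp only:)
  have t3: "t ^ 3 = t * u" by (simp add: u_def power2_eq_square power3_eq_cube)
  have "((2 * G' + 2 * G / t\<^sup>2) * (t ^ 3 / A1 t))\<^sup>2 = (2 * r * curv1 e r / 3 * d * t / A1 t)\<^sup>2"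
    unfolding E t3 using u by (simp add: mult_ac)
  also have "\<dots> = (r * curv1 e r / 3)\<^sup>2 * (4 * u * d\<^sup>2) / (A1 t)\<^sup>2"
    by (simp add: power_mult_distrib power_divide u_def)
  also have "(r * curv1 e r / 3)\<^sup>2 * (4 * u * d\<^sup>2) / (A1 t)\<^sup>2 = (curv1 e r)\<^sup>2 * ((r\<^sup>2 / 9) * (1 - 1 / r ^ 3) / ((r ^ 3 - 1) / (9 * r)))"
    unfolding d(2) A by (simp add: power_mult_distrib power_divide)
  \<comment> \<open>By the equation for dr/dt the factor (r^2 / 9) (dr/dt)^2 is exactly
    A1^2.\<close>
  also have "(r\<^sup>2 / 9) * (1 - 1 / r ^ 3) / ((r ^ 3 - 1) / (9 * r)) = 1"
  proof -
    have "(r\<^sup>2 / 9) * (1 - 1 / r ^ 3) = (r ^ 3 - 1) / (9 * r)"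
      using r1 by (simp add: field_simps power2_eq_square power3_eq_cube)
    moreover have "(r ^ 3 - 1) / (9 * r) > 0" using r1 r3 by (intro divide_pos_pos) auto
    ultimately show ?thesis by (metis divide_self less_irrefl)
  qed
  finally show "((2 * G' + 2 * G / t\<^sup>2) * (t ^ 3 / A1 t))\<^sup>2 = (curv1 e r)\<^sup>2" by simp
  \<comment> \<open>With a = 2 u G, the coefficient of the connection, the numerator is a (a - 1) /
    2. It vanishes for the two flat connections a = 0 and a = 1 on the 3-spheres in the
    fibres.\<close>
  have "(2 * G\<^sup>2 - G / t\<^sup>2) * (t ^ 4 / (A1 t)\<^sup>2) = (u * G) * (2 * (u * G) - 1) / (A1 t)\<^sup>2"
  proof -
    have "(2 * G\<^sup>2 - G / t\<^sup>2) * t ^ 4 = (u * G) * (2 * (u * G) - 1)"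
      using t by (simp add: u_def field_simps power2_eq_square power4_eq_xxxx)
    then show ?thesis by (metis times_divide_eq_right)
  qed
  also have "\<dots> = curv2 e r"
  proof -
    have c1: "(u * G) / (A1 t)\<^sup>2 = 3 / D"
    proof -
      have "(N / (3 * r * D)) / (N / (9 * r)) = 3 / D" if "N > 0" for N
        using that r1 D by (simp add: field_simps)
      then show ?thesis unfolding h A using r3 by blast
    qed
    have c2: "2 * (u * G) - 1 = - ((r - 1)\<^sup>2 * (r + 2) + 3 * r * e) / (3 * r * D)"
    proof -
      have "2 * (r ^ 3 - 1) - 3 * r * D = - ((r - 1)\<^sup>2 * (r + 2) + 3 * r * e)"
        by (simp add: D_def power2_eq_square power3_eq_cube algebra_simps)
      moreover have "2 * (u * G) - 1 = (2 * (r ^ 3 - 1) - 3 * r * D) / (3 * r * D)"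
        unfolding h using r1 D by (simp add: diff_divide_distrib)
      ultimately show ?thesis by simp
    qed
    have "(u * G) * (2 * (u * G) - 1) / (A1 t)\<^sup>2 = (u * G) / (A1 t)\<^sup>2 * (2 * (u * G) - 1)" by simp
    also have "\<dots> = 3 / D * (- ((r - 1)\<^sup>2 * (r + 2) + 3 * r * e) / (3 * r * D))"
      by (simp only: c1 c2)
    also have "\<dots> = - ((r - 1)\<^sup>2 * (r + 2) + 3 * r * e) / (r * D\<^sup>2)"
    proof -
      have "3 / D * (N / (3 * r * D)) = N / (r * D\<^sup>2)" for N
        using r1 D by (simp add: power2_eq_square)
      then show ?thesis .
    qed
    finally show ?thesis by (simp only: curv2_def D_def)
  qed
  finally show "(2 * G\<^sup>2 - G / t\<^sup>2) * (t ^ 4 / (A1 t)\<^sup>2) = curv2 e r" .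
  have "G * t\<^sup>2 / (B1 t)\<^sup>2 = (u * G) * (3 / r\<^sup>2)"
    by (simp add: u_def B1_def r_def power_divide)
  also have "\<dots> = - curv3 e r"
  proof -
    have "N / (3 * r * D) * (3 / r\<^sup>2) = - (- N / (r ^ 3 * D))" for N
      using r1 D by (simp add: power2_eq_square power3_eq_cube)
    then show ?thesis unfolding h curv3_def D_def[symmetric] .
  qed
  finally show "(G * t\<^sup>2 / (B1 t)\<^sup>2)\<^sup>2 = (curv3 e r)\<^sup>2" by simp
qed

lemma curv_norm2_clarke:
  assumes "x1 > 0" "fst x \<noteq> 0" "norm (snd x) = 1"
  shows "curv_norm2 (A_clarke x1) x = curv_sq (3 / x1) (r_of_t (norm (fst x)))"
proof -
  define t where "t = norm (fst x)"
  have t: "t > 0" using assms by (simp add: t_def)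
  obtain G' where G': "(profile (1 / x1) has_field_derivative G') (at (t\<^sup>2))"
    using smooth_profile_differentiable[of "t\<^sup>2" "1 / x1"] t assms(1) by auto
  show ?thesis
    using curv_norm2_pform[OF assms(2,3) A_clarke_eq[OF assms(1)] G'[unfolded t_def], folded t_def]
      profile_curvature[OF t, of "3 / x1" G'] G' assms(1)
    by (simp add: curv_sq_def t_def)
qed

lemma curv_norm2_lim:
  assumes "fst x \<noteq> 0" "norm (snd x) = 1"
  shows "curv_norm2 A_lim x = curv_sq 0 (r_of_t (norm (fst x)))"
proof -
  define t where "t = norm (fst x)"
  have t: "t > 0" using assms by (simp add: t_def)
  obtain G' where G': "(profile 0 has_field_derivative G') (at (t\<^sup>2))"
    using smooth_profile_differentiable[of "t\<^sup>2" 0] t by auto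
  show ?thesis
    using curv_norm2_pform[OF assms A_lim_eq G'[unfolded t_def], folded t_def]
      profile_curvature[OF t, of 0 G'] G'
    by (simp add: curv_sq_def t_def)
qed

section \<open>The Riemannian volume\<close>

text \<open>The map z to (qconj p) z p is |p|^2 times a rotation fixing the real axis, so it scales
  inner products of imaginary parts by |p|^4.\<close>

lemma im_base_inner:
  "im_base (p, q) v \<bullet> im_base (p, q) w
     = (norm p) ^ 4 * (snd (q \<odot> qconj (snd v)) \<bullet> snd (q \<odot> qconj (snd w)))"
proof -
  define a b where "a = q \<odot> qconj (snd v)" and "b = q \<odot> qconj (snd w)"
  have snd_inner: "snd x \<bullet> snd y = x \<bullet> y - fst x * fst y" for x y :: quat
    by (simp add: inner_prod_def)
  have "qconj (qconj p \<odot> a \<odot> p) \<odot> (qconj p \<odot> b \<odot> p) = (norm p)\<^sup>2 *\<^sub>R (qconj p \<odot> (qconj a \<odot> b) \<odot> p)"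
  proof -
    have "p \<odot> (qconj p \<odot> z) = (norm p)\<^sup>2 *\<^sub>R z" for z
      by (simp add: qmult_assoc[symmetric] qmult_qconj qmult_real_left)
    then show ?thesis by (simp add: qconj_qmult qmult_assoc qmult_linear_simps)
  qed
  then have "(qconj p \<odot> a \<odot> p) \<bullet> (qconj p \<odot> b \<odot> p) = (norm p) ^ 4 * (a \<bullet> b)"
    by (simp add: fst_qconj_qmult[symmetric] fst_qconj_conjugate power2_eq_square power4_eq_xxxx)
  then show ?thesis
    unfolding im_base_def fst_conv snd_conv a_def[symmetric] b_def[symmetric] snd_inner
    by (simp add: fst_qconj_conjugate power2_eq_square power4_eq_xxxx algebra_simps)
qed

lemma norm_snd_le_norm: "norm (snd z) \<le> norm z"
  by (metis norm_snd_le prod.collapse)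

text \<open>Multiplication by qconj p is |p| times an isometry; the real part of (qconj p) v is p .
  v.\<close>

lemma im_fibre_inner:
  "(p \<bullet> fst v) * (p \<bullet> fst w) + im_fibre (p, q) v \<bullet> im_fibre (p, q) w = (norm p)\<^sup>2 * (fst v \<bullet> fst w)"
proof -
  have n: "(norm p)\<^sup>2 = (fst p)\<^sup>2 + (snd p $ 1)\<^sup>2 + (snd p $ 2)\<^sup>2 + (snd p $ 3)\<^sup>2"
    by (simp only: power2_norm_eq_inner inner_prod_def)
      (simp add: inner_vec_def sum_3 power2_eq_square)
  show ?thesis
    unfolding im_fibre_def by (simp add: n quat_expand inner_prod_def) algebra
qed

lemma norm_im_fibre_le: "norm (im_fibre (p, q) v) \<le> norm p * norm (fst v)"
  using norm_snd_le_norm[of "qconj p \<odot> fst v"] by (simp add: im_fibre_def norm_qmult)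

lemma norm_im_base_le: "norm (im_base (p, q) v) \<le> (norm p)\<^sup>2 * (norm q * norm (snd v))"
  using norm_snd_le_norm[of "qconj p \<odot> (q \<odot> qconj (snd v)) \<odot> p"]
  by (simp add: im_base_def norm_qmult power2_eq_square mult_ac)

text \<open>The terms are grouped for the limit p to 0: the second carries a coefficient that
  vanishes there, the third is of order |p|, and the other two converge to the metric along the
  singular orbit.\<close>

lemma bs_metric_expand:
  assumes p: "p \<noteq> 0" and q: "norm q = 1"
  shows "bs_metric (p, q) v w = fst v \<bullet> fst w
     + (4 * A1q ((norm p)\<^sup>2) - 1) * ((im_fibre (p, q) v \<bullet> im_fibre (p, q) w) / (norm p)\<^sup>2)
     + 2 * A1q ((norm p)\<^sup>2) * ((im_fibre (p, q) v \<bullet> im_base (p, q) w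
          + im_base (p, q) v \<bullet> im_fibre (p, q) w) / (norm p)\<^sup>2)
     + ((norm p)\<^sup>2 * A1q ((norm p)\<^sup>2) + (B1 (norm p))\<^sup>2)
        * (snd (q \<odot> qconj (snd v)) \<bullet> snd (q \<odot> qconj (snd w)))"
proof -
  define t a where "t = norm p" and "a = A1q ((norm p)\<^sup>2)"
  define Fv Fw Xv Xw where "Fv = im_fibre (p, q) v" and "Fw = im_fibre (p, q) w"
    and "Xv = im_base (p, q) v" and "Xw = im_base (p, q) w"
  define z where "z = snd (q \<odot> qconj (snd v)) \<bullet> snd (q \<odot> qconj (snd w))"
  have t: "t > 0" using p by (simp add: t_def)
  have A: "A1 t * A1 t = t\<^sup>2 * a" using A1_square[of t] t by (simp add: t_def a_def power2_eq_square)
  have X: "Xv \<bullet> Xw = t ^ 4 * z" by (simp add: Xv_def Xw_def z_def t_def im_base_inner)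
  have F: "(p \<bullet> fst v) * (p \<bullet> fst w) = t\<^sup>2 * (fst v \<bullet> fst w) - Fv \<bullet> Fw"
    using im_fibre_inner[of p v w q] by (simp add: Fv_def Fw_def t_def)
  have "bs_metric (p, q) v w = frame_coord (p, q) v \<bullet> frame_coord (p, q) w"
    using p by (simp add: bs_metric_frame_coord)
  also have "\<dots> = (p \<bullet> fst v) * (p \<bullet> fst w) / t\<^sup>2
      + (A1 t * A1 t) / t ^ 4 * ((2 *\<^sub>R Fv + Xv) \<bullet> (2 *\<^sub>R Fw + Xw)) + (B1 t)\<^sup>2 / t ^ 4 * (Xv \<bullet> Xw)"
    using p q by (simp add: frame_coord_eq inner_prod_def Fv_def Fw_def Xv_def Xw_def t_def
        power2_eq_square power4_eq_xxxx)
  also have "(2 *\<^sub>R Fv + Xv) \<bullet> (2 *\<^sub>R Fw + Xw) = 4 * (Fv \<bullet> Fw) + 2 * (Fv \<bullet> Xw + Xv \<bullet> Fw) + t ^ 4 * z"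
    unfolding X[symmetric] by (simp add: inner_add_left inner_add_right)
  also have "(p \<bullet> fst v) * (p \<bullet> fst w) / t\<^sup>2
      + (A1 t * A1 t) / t ^ 4 * (4 * (Fv \<bullet> Fw) + 2 * (Fv \<bullet> Xw + Xv \<bullet> Fw) + t ^ 4 * z)
      + (B1 t)\<^sup>2 / t ^ 4 * (Xv \<bullet> Xw)
    = fst v \<bullet> fst w + (4 * a - 1) * ((Fv \<bullet> Fw) / t\<^sup>2) + 2 * a * ((Fv \<bullet> Xw + Xv \<bullet> Fw) / t\<^sup>2)
      + (t\<^sup>2 * a + (B1 t)\<^sup>2) * z"
    unfolding A X F using t by (simp add: field_simps power2_eq_square power4_eq_xxxx)
  finally show ?thesis
    by (simp add: Fv_def Fw_def Xv_def Xw_def z_def t_def a_def)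
qed

text \<open>\<open>Lim\<close> is determined by convergence only along a nontrivial filter.\<close>

lemma M_reg_approach: "at (0, q) within M_reg \<noteq> bot" if "q \<in> sphere 0 1" for q :: quat
proof -
  have "(0::quat, q) islimpt M_reg"
  proof (rule islimptI)
    fix T :: "(quat \<times> quat) set" assume T: "(0, q) \<in> T" "open T"
    then obtain d where d: "d > 0" "ball (0, q) d \<subseteq> T" using open_contains_ball by blast
    define y :: "quat \<times> quat" where "y = ((d / 2, 0), q)"
    have "y \<in> T" using d by (intro subsetD[OF d(2)]) (simp add: y_def dist_Pair_Pair dist_norm norm_Pair)
    moreover have "y \<in> M_reg" "y \<noteq> (0, q)"
      using d that by (auto simp: y_def M_reg_def zero_prod_def)
    ultimately show "\<exists>y\<in>M_reg. y \<in> T \<and> y \<noteq> (0, q)" by blast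
  qed
  then show ?thesis by (simp add: trivial_limit_within)
qed

lemma isCont_A1q_norm: "((\<lambda>y. A1q ((norm (fst y :: quat))\<^sup>2)) \<longlongrightarrow> A1q ((norm (fst x))\<^sup>2)) (at x within S)"
proof -
  have "isCont A1q ((norm (fst x))\<^sup>2)"
    using smooth_on_imp_continuous_on[OF smooth_on_A1q] open_tsq_range tsq_range_nonneg
    by (simp add: continuous_on_eq_continuous_at)
  then show ?thesis
    by (rule isCont_tendsto_compose) (auto intro!: tendsto_intros)
qed

lemma isCont_B1: "isCont (\<lambda>y. B1 (norm y)) (y :: 'a::real_normed_vector)"
proof -
  have "isCont tsq_inv ((norm y)\<^sup>2)" by (intro isCont_tsq_inv tsq_range_nonneg) simp
  moreover have "isCont (\<lambda>y::'a. (norm y)\<^sup>2) y" by (intro continuous_intros)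
  ultimately have "isCont (\<lambda>y::'a. 1 + tsq_inv ((norm y)\<^sup>2)) y"
    by (intro continuous_add continuous_const) (rule isCont_o2)
  then have "isCont (\<lambda>y::'a. (1 + tsq_inv ((norm y)\<^sup>2)) / sqrt 3) y"
    by (intro continuous_divide continuous_const) auto
  then show ?thesis by (simp add: B1_def r_of_t_eq)
qed

text \<open>Flat along the fibre and, since B1 0 = 1 / sqrt 3, one third of the round metric along
  the sphere.\<close>

lemma bs_metric_sing:
  assumes q: "norm q = 1"
  shows "bs_metric (0, q) v w = fst v \<bullet> fst w + (snd (q \<odot> qconj (snd v)) \<bullet> snd (q \<odot> qconj (snd w))) / 3"
proof -
  let ?F = "at (0, q) within M_reg"
  have in_reg: "\<forall>\<^sub>F y in ?F. y \<in> M_reg" by (simp add: eventually_at_filter)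
  have A: "((\<lambda>y. A1q ((norm (fst y))\<^sup>2)) \<longlongrightarrow> 1 / 4) ?F"
    using isCont_A1q_norm[of "(0, q)"] by (simp add: A1q_0)
  have n: "((\<lambda>y. norm (fst y)) \<longlongrightarrow> 0) ?F"
    by (rule tendsto_eq_intros | simp)+
  have "B1 0 = 1 / sqrt 3" by (simp add: B1_def r_of_t_eq tsq_inv_0)
  moreover have "((\<lambda>y. B1 (norm (fst y))) \<longlongrightarrow> B1 (norm (0::quat))) ?F"
    by (rule isCont_tendsto_compose[OF isCont_B1]) (rule tendsto_eq_intros | simp)+
  ultimately have B: "((\<lambda>y. (B1 (norm (fst y)))\<^sup>2) \<longlongrightarrow> 1 / 3) ?F"
    using tendsto_power[of "\<lambda>y. B1 (norm (fst y))" "1 / sqrt 3" ?F 2] by (simp add: power_divide)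
  have qt: "((\<lambda>y. snd (snd y \<odot> qconj u)) \<longlongrightarrow> snd (q \<odot> qconj u)) ?F" for u
    by (rule tendsto_eq_intros bounded_bilinear.tendsto[OF bounded_bilinear_qmult] | simp)+
  \<comment> \<open>The quotient is only bounded, with no limit in general; convergence comes from
    A1q tending to 1/4.\<close>
  have 1: "((\<lambda>y. (4 * A1q ((norm (fst y))\<^sup>2) - 1) * ((im_fibre y v \<bullet> im_fibre y w) / (norm (fst y))\<^sup>2)) \<longlongrightarrow> 0) ?F"
  proof (rule Lim_null_comparison)
    show "((\<lambda>y. \<bar>4 * A1q ((norm (fst y))\<^sup>2) - 1\<bar> * (norm (fst v) * norm (fst w))) \<longlongrightarrow> 0) ?F"
      by (rule tendsto_eq_intros A | simp)+
    show "\<forall>\<^sub>F y in ?F. norm ((4 * A1q ((norm (fst y))\<^sup>2) - 1) * ((im_fibre y v \<bullet> im_fibre y w) / (norm (fst y))\<^sup>2))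
       \<le> \<bar>4 * A1q ((norm (fst y))\<^sup>2) - 1\<bar> * (norm (fst v) * norm (fst w))"
      using in_reg
    proof eventually_elim
      case (elim y)
      obtain p q' where y: "y = (p, q')" by (cases y)
      have p: "norm p > 0" using elim by (simp add: M_reg_def y)
      have "\<bar>im_fibre y v \<bullet> im_fibre y w\<bar> \<le> (norm p * norm (fst v)) * (norm p * norm (fst w))"
        using Cauchy_Schwarz_ineq2[of "im_fibre y v" "im_fibre y w"]
          mult_mono[OF norm_im_fibre_le[of p q' v] norm_im_fibre_le[of p q' w]]
        unfolding y by (smt (verit) mult_nonneg_nonneg norm_ge_zero)
      then have "\<bar>(im_fibre y v \<bullet> im_fibre y w) / (norm p)\<^sup>2\<bar> \<le> norm (fst v) * norm (fst w)"
        using p by (simp add: abs_mult divide_le_eq power2_eq_square mult_ac)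
      then show ?case
        by (simp only: y fst_conv real_norm_def abs_mult) (rule mult_left_mono, auto)
    qed
  qed
  \<comment> \<open>\<open>im_base\<close> is quadratic in |p| and \<open>im_fibre\<close> linear,
    so one power of |p| survives the division.\<close>
  have 2: "((\<lambda>y. 2 * A1q ((norm (fst y))\<^sup>2) * ((im_fibre y v \<bullet> im_base y w
          + im_base y v \<bullet> im_fibre y w) / (norm (fst y))\<^sup>2)) \<longlongrightarrow> 0) ?F"
  proof (rule Lim_null_comparison)
    let ?C = "norm (fst v) * norm (snd w) + norm (snd v) * norm (fst w)"
    have "((\<lambda>y. \<bar>2 * A1q ((norm (fst y))\<^sup>2)\<bar> * (norm (fst y) * ?C)) \<longlongrightarrow> \<bar>2 * (1 / 4)\<bar> * (0 * ?C)) ?F"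
      by (intro tendsto_intros A n)
    then show "((\<lambda>y. \<bar>2 * A1q ((norm (fst y))\<^sup>2)\<bar> * (norm (fst y) * ?C)) \<longlongrightarrow> 0) ?F" by simp
    show "\<forall>\<^sub>F y in ?F. norm (2 * A1q ((norm (fst y))\<^sup>2) * ((im_fibre y v \<bullet> im_base y w
          + im_base y v \<bullet> im_fibre y w) / (norm (fst y))\<^sup>2)) \<le> \<bar>2 * A1q ((norm (fst y))\<^sup>2)\<bar> * (norm (fst y) * ?C)"
      using in_reg
    proof eventually_elim
      case (elim y)
      obtain p q' where y: "y = (p, q')" by (cases y)
      have p: "norm p > 0" and q': "norm q' = 1" using elim by (auto simp: M_reg_def y)
      have b: "norm (im_base y u) \<le> (norm p)\<^sup>2 * norm (snd u)" for u
        using norm_im_base_le[of p q' u] q' by (simp add: y)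
      have f: "norm (im_fibre y u) \<le> norm p * norm (fst u)" for u
        using norm_im_fibre_le[of p q' u] by (simp add: y)
      have "\<bar>im_fibre y v \<bullet> im_base y w\<bar> \<le> (norm p * norm (fst v)) * ((norm p)\<^sup>2 * norm (snd w))"
        by (rule order_trans[OF Cauchy_Schwarz_ineq2 mult_mono[OF f b]]) auto
      moreover have "\<bar>im_base y v \<bullet> im_fibre y w\<bar> \<le> ((norm p)\<^sup>2 * norm (snd v)) * (norm p * norm (fst w))"
        by (rule order_trans[OF Cauchy_Schwarz_ineq2 mult_mono[OF b f]]) auto
      ultimately have "\<bar>im_fibre y v \<bullet> im_base y w + im_base y v \<bullet> im_fibre y w\<bar> \<le> (norm p)\<^sup>2 * (norm p * ?C)"
        by (simp add: algebra_simps)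
      then have "\<bar>(im_fibre y v \<bullet> im_base y w + im_base y v \<bullet> im_fibre y w) / (norm p)\<^sup>2\<bar> \<le> norm p * ?C"
        using p by (simp add: divide_le_eq mult_ac)
      then show ?case
        by (simp only: y fst_conv real_norm_def abs_mult) (rule mult_left_mono, auto)
    qed
  qed
  have 3: "((\<lambda>y. ((norm (fst y))\<^sup>2 * A1q ((norm (fst y))\<^sup>2) + (B1 (norm (fst y)))\<^sup>2)
        * (snd (snd y \<odot> qconj (snd v)) \<bullet> snd (snd y \<odot> qconj (snd w)))) \<longlongrightarrow>
        (0\<^sup>2 * (1 / 4) + 1 / 3) * (snd (q \<odot> qconj (snd v)) \<bullet> snd (q \<odot> qconj (snd w)))) ?F"
    by (intro tendsto_intros n A B qt)
  have "((\<lambda>y. bs_metric_reg y v w) \<longlongrightarrow> fst v \<bullet> fst w + 0 + 0 +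
      (0\<^sup>2 * (1 / 4) + 1 / 3) * (snd (q \<odot> qconj (snd v)) \<bullet> snd (q \<odot> qconj (snd w)))) ?F"
  proof (rule Lim_transform_eventually[OF tendsto_add[OF tendsto_add[OF tendsto_add[OF tendsto_const 1] 2] 3]])
    show "\<forall>\<^sub>F y in ?F. fst v \<bullet> fst w
     + (4 * A1q ((norm (fst y))\<^sup>2) - 1) * ((im_fibre y v \<bullet> im_fibre y w) / (norm (fst y))\<^sup>2)
     + 2 * A1q ((norm (fst y))\<^sup>2) * ((im_fibre y v \<bullet> im_base y w + im_base y v \<bullet> im_fibre y w) / (norm (fst y))\<^sup>2)
     + ((norm (fst y))\<^sup>2 * A1q ((norm (fst y))\<^sup>2) + (B1 (norm (fst y)))\<^sup>2)
        * (snd (snd y \<odot> qconj (snd v)) \<bullet> snd (snd y \<odot> qconj (snd w))) = bs_metric_reg y v w"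
      using in_reg
    proof eventually_elim
      case (elim y)
      then have "fst y \<noteq> 0" "norm (snd y) = 1" by (auto simp: M_reg_def)
      then show ?case
        using bs_metric_expand[of "fst y" "snd y" v w] by (simp add: bs_metric_def)
    qed
  qed
  then have "Lim ?F (\<lambda>y. bs_metric_reg y v w) = fst v \<bullet> fst w + 0 + 0 +
      (0\<^sup>2 * (1 / 4) + 1 / 3) * (snd (q \<odot> qconj (snd v)) \<bullet> snd (q \<odot> qconj (snd w)))"
    using M_reg_approach q by (intro tendsto_Lim) auto
  then show ?thesis by (simp add: bs_metric_def)
qed

section \<open>Stereographic coordinates on the sphere\<close>

definition stereo_deriv :: "real^3 \<Rightarrow> real^3 \<Rightarrow> quat" where
  "stereo_deriv y w = (4 * (y \<bullet> w) / ((norm y)\<^sup>2 + 1)\<^sup>2,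
     (2 / ((norm y)\<^sup>2 + 1)) *\<^sub>R w - (4 * (y \<bullet> w) / ((norm y)\<^sup>2 + 1)\<^sup>2) *\<^sub>R y)"

lemma norm_square_plus_1_pos: "(norm y)\<^sup>2 + 1 > 0"
  by (simp add: add_nonneg_pos)

lemma has_derivative_stereo: "(stereo has_derivative stereo_deriv y) (at y)"
proof -
  have pos: "y \<bullet> y + 1 \<noteq> 0"
    using norm_square_plus_1_pos[of y] unfolding power2_norm_eq_inner by linarith
  have 0: "((\<lambda>y. y \<bullet> y) has_derivative (\<lambda>w. 2 * (y \<bullet> w))) (at y)"
    by (auto intro!: derivative_eq_intros simp: inner_commute)
  have i: "((\<lambda>y. 1 / (y \<bullet> y + 1)) has_derivative (\<lambda>w. - (2 * (y \<bullet> w)) / (y \<bullet> y + 1)\<^sup>2)) (at y)"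
    using pos by (auto intro!: derivative_eq_intros 0 ext simp: power2_eq_square divide_simps inner_commute)
  have "((\<lambda>y. 1 - 2 * (1 / (y \<bullet> y + 1))) has_derivative (\<lambda>w. 4 * (y \<bullet> w) / (y \<bullet> y + 1)\<^sup>2)) (at y)"
    by (rule has_derivative_eq_rhs, rule has_derivative_diff[OF has_derivative_const
          has_derivative_mult[OF has_derivative_const i]]) auto
  moreover have "1 - 2 * (1 / (y \<bullet> y + 1)) = (y \<bullet> y - 1) / (y \<bullet> y + 1)" for y :: "real^3"
  proof -
    have "y \<bullet> y + 1 \<noteq> 0"
      using norm_square_plus_1_pos[of y] unfolding power2_norm_eq_inner by linarith
    then show ?thesis by (simp add: divide_simps)
  qed
  ultimately have 1: "((\<lambda>y. ((norm y)\<^sup>2 - 1) / ((norm y)\<^sup>2 + 1)) has_derivative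
      (\<lambda>w. 4 * (y \<bullet> w) / ((norm y)\<^sup>2 + 1)\<^sup>2)) (at y)"
    unfolding power2_norm_eq_inner by simp
  have "((\<lambda>y. (2 * (1 / (y \<bullet> y + 1))) *\<^sub>R y) has_derivative
      (\<lambda>w. (2 / (y \<bullet> y + 1)) *\<^sub>R w - (4 * (y \<bullet> w) / (y \<bullet> y + 1)\<^sup>2) *\<^sub>R y)) (at y)"
    by (rule has_derivative_eq_rhs, rule has_derivative_scaleR[OF
          has_derivative_mult[OF has_derivative_const i] has_derivative_ident]) (auto simp: algebra_simps)
  then have 2: "((\<lambda>y. (2 / ((norm y)\<^sup>2 + 1)) *\<^sub>R y) has_derivative
      (\<lambda>w. (2 / ((norm y)\<^sup>2 + 1)) *\<^sub>R w - (4 * (y \<bullet> w) / ((norm y)\<^sup>2 + 1)\<^sup>2) *\<^sub>R y)) (at y)"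
    unfolding power2_norm_eq_inner by simp
  show ?thesis
    unfolding stereo_def[abs_def] stereo_deriv_def[abs_def] by (intro has_derivative_Pair 1 2)
qed

lemma stereo_deriv_inner:
  "stereo_deriv y v \<bullet> stereo_deriv y w = (2 / ((norm y)\<^sup>2 + 1))\<^sup>2 * (v \<bullet> w)"
proof -
  define N a b where "N = (norm y)\<^sup>2 + 1" and "a = y \<bullet> v" and "b = y \<bullet> w"
  have N: "N > 0" and ips: "y \<bullet> y = N - 1" "y \<bullet> v = a" "v \<bullet> y = a" "y \<bullet> w = b" "w \<bullet> y = b"
    using norm_square_plus_1_pos[of y]
    by (auto simp: N_def a_def b_def power2_norm_eq_inner inner_commute)
  have "stereo_deriv y v \<bullet> stereo_deriv y w = (4 * a / N\<^sup>2) * (4 * b / N\<^sup>2) + (2 / N)\<^sup>2 * (v \<bullet> w)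
     - 2 * ((2 / N) * (4 * a / N\<^sup>2) * b) + (4 * a / N\<^sup>2) * (4 * b / N\<^sup>2) * (N - 1)"
    unfolding stereo_deriv_def inner_prod_def fst_conv snd_conv N_def[symmetric] a_def[symmetric] b_def[symmetric]
    using N by (simp add: inner_diff_left inner_diff_right ips)
      (simp add: field_simps power2_eq_square power4_eq_xxxx)
  also have "\<dots> = (2 / N)\<^sup>2 * (v \<bullet> w)"
    using N by (simp add: field_simps power2_eq_square)
  finally show ?thesis by (simp add: N_def)
qed

lemma stereo_inner_deriv: "stereo y \<bullet> stereo_deriv y w = 0"
proof -
  have "((\<lambda>y. stereo y \<bullet> stereo y) has_derivative (\<lambda>w. stereo y \<bullet> stereo_deriv y w + stereo_deriv y w \<bullet> stereo y)) (at y)"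
    by (rule has_derivative_inner[OF has_derivative_stereo has_derivative_stereo])
  moreover have "(\<lambda>y. stereo y \<bullet> stereo y) = (\<lambda>_. 1)"
    using norm_stereo by (simp add: norm_eq_1 fun_eq_iff)
  ultimately have d: "((\<lambda>_. 1) has_derivative (\<lambda>w. stereo y \<bullet> stereo_deriv y w + stereo_deriv y w \<bullet> stereo y)) (at y)"
    by simp
  have "stereo y \<bullet> stereo_deriv y w + stereo_deriv y w \<bullet> stereo y = 0"
    by (rule fun_cong[OF has_derivative_unique[OF d has_derivative_const]])
  then show ?thesis by (simp add: inner_commute)
qed

lemma smooth_on_stereo: "smooth_on UNIV stereo"
  unfolding stereo_def[abs_def]
  by (intro smooth_on_Pair smooth_on_divide smooth_on_diff smooth_on_add smooth_on_scaleR
      smooth_on_norm_square smooth_on_const smooth_on_ident open_UNIV)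
    (metis norm_square_plus_1_pos less_irrefl)+

definition fibre_part :: "real^7 \<Rightarrow> quat" where
  "fibre_part u = (u $ 1, vector [u $ 2, u $ 3, u $ 4])"

definition base_part :: "real^7 \<Rightarrow> real^3" where
  "base_part u = vector [u $ 5, u $ 6, u $ 7]"

lemma param_M_eq: "param_M u = (fibre_part u, stereo (base_part u))"
  by (simp add: param_M_def fibre_part_def base_part_def)

lemma bounded_linear_fibre_part: "bounded_linear fibre_part"
  unfolding linear_conv_bounded_linear[symmetric] fibre_part_def[abs_def]
  by (intro linearI) (simp_all add: prod_eq_iff vec_eq_iff forall_3 vector_3)

lemma bounded_linear_base_part: "bounded_linear base_part"
  unfolding linear_conv_bounded_linear[symmetric] base_part_def[abs_def]
  by (intro linearI) (simp_all add: vec_eq_iff forall_3 vector_3)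

lemma has_derivative_param_M:
  "(param_M has_derivative (\<lambda>w. (fibre_part w, stereo_deriv (base_part u) (base_part w)))) (at u)"
  unfolding param_M_eq[abs_def]
  by (intro has_derivative_Pair bounded_linear_imp_has_derivative bounded_linear_fibre_part
      has_derivative_compose[OF bounded_linear_imp_has_derivative[OF bounded_linear_base_part] has_derivative_stereo])

section \<open>Gram determinants in dimension seven\<close>

lemma exhaust_7:
  fixes x :: 7
  shows "x = 1 \<or> x = 2 \<or> x = 3 \<or> x = 4 \<or> x = 5 \<or> x = 6 \<or> x = 7"
proof (induct x)
  case (of_int z)
  then have "0 \<le> z" "z < 7" by simp_all
  then have "z = 0 \<or> z = 1 \<or> z = 2 \<or> z = 3 \<or> z = 4 \<or> z = 5 \<or> z = 6" by arith
  then show ?case by auto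
qed

lemma forall_7: "(\<forall>i::7. P i) \<longleftrightarrow> P 1 \<and> P 2 \<and> P 3 \<and> P 4 \<and> P 5 \<and> P 6 \<and> P 7"
  by (metis exhaust_7)

lemma UNIV_7: "UNIV = {1, 2, 3, 4, 5, 6, 7::7}"
  using exhaust_7 by auto

lemma sum_7: "(\<Sum>i\<in>UNIV. f (i::7)) = f 1 + f 2 + f 3 + f 4 + f 5 + f 6 + f 7"
  unfolding UNIV_7 by (simp add: ac_simps)

lemma prod_7: "(\<Prod>i\<in>UNIV. f (i::7)) = f 1 * f 2 * f 3 * f 4 * f 5 * f 6 * f 7"
  unfolding UNIV_7 by (simp add: ac_simps)

lemma prod_3: "(\<Prod>i\<in>UNIV. f (i::3)) = f 1 * f 2 * f 3"
  unfolding UNIV_3 by (simp add: ac_simps)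

lemma det_frame:
  fixes g :: "7 \<Rightarrow> 7 \<Rightarrow> real"
  assumes "\<And>i j. g i j = fibre_part (axis i 1) \<bullet> fibre_part (axis j 1)
     + s * (base_part (axis i 1) \<bullet> base_part (axis j 1))"
  shows "det (\<chi> i j. g i j) = s ^ 3"
proof -
  have g: "\<forall>i j. g i j = (if i = j then if i \<in> {5, 6, 7} then s else 1 else 0)"
    unfolding forall_7 assms fibre_part_def base_part_def
    by (simp add: inner_prod_def inner_vec_def sum_3 vector_3 axis_def)
  have "det (\<chi> i j. g i j) = (\<Prod>i\<in>UNIV. (\<chi> i j. g i j) $ i $ i)"
    by (rule det_diagonal) (simp add: g)
  also have "\<dots> = s ^ 3" by (simp add: prod_7 g power3_eq_cube)
  finally show ?thesis .
qed

text \<open>The coordinates are ordered so that the matrix of a shear from the last to the middle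
  component is triangular; in type \<open>7\<close> the numeral \<open>7\<close> is the least element.\<close>

definition coord7 :: "real \<times> (real^3) \<times> (real^3) \<Rightarrow> real^7" where
  "coord7 z = (\<chi> i. if i = 7 then fst z else if i = 1 then snd (snd z) $ 1
     else if i = 2 then snd (snd z) $ 2 else if i = 3 then snd (snd z) $ 3
     else if i = 4 then fst (snd z) $ 1 else if i = 5 then fst (snd z) $ 2 else fst (snd z) $ 3)"

lemma coord7_inner: "coord7 z \<bullet> coord7 z' = z \<bullet> z'"
  by (simp add: coord7_def inner_vec_def sum_7 sum_3 inner_prod_def)

definition shear7 :: "real \<Rightarrow> real \<Rightarrow> real \<Rightarrow> real^7^7" where
  "shear7 a b c = (\<chi> i j. if i = j then if i = 7 then 1 else if i \<in> {1, 2, 3} then c else a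
     else if (i, j) \<in> {(4, 1), (5, 2), (6, 3)} then b else 0)"

lemma det_shear7: "det (shear7 a b c) = a ^ 3 * c ^ 3"
proof -
  have "\<forall>i j. i < j \<longrightarrow> shear7 a b c $ i $ j = 0"
    unfolding forall_7
    by (simp add: shear7_def less_bit1_def bit1.Rep_numeral bit1.Rep_1)
  then have "det (shear7 a b c) = (\<Prod>i\<in>UNIV. shear7 a b c $ i $ i)"
    by (intro det_lowerdiagonal) blast
  then show ?thesis by (simp add: prod_7 shear7_def power3_eq_cube)
qed

lemma shear7_mult:
  "shear7 a b c *v coord7 z = coord7 (fst z, a *\<^sub>R fst (snd z) + b *\<^sub>R snd (snd z), c *\<^sub>R snd (snd z))"
  by (simp add: vec_eq_iff forall_7 matrix_vector_mult_def sum_7 shear7_def coord7_def)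

text \<open>A Gram matrix is the transpose of a coordinate matrix times that matrix, so a linear
  change S of the vectors multiplies its determinant by (det S)^2.\<close>

lemma det_shear_gram:
  fixes O' :: "7 \<Rightarrow> real \<times> (real^3) \<times> (real^3)" and a b c :: real
  defines "N \<equiv> \<lambda>i. (fst (O' i), a *\<^sub>R fst (snd (O' i)) + b *\<^sub>R snd (snd (O' i)), c *\<^sub>R snd (snd (O' i)))"
  shows "det (\<chi> i j. N i \<bullet> N j) = (a ^ 3 * c ^ 3)\<^sup>2 * det (\<chi> i j. O' i \<bullet> O' j)"
proof -
  define Om where "Om = (\<chi> k i. coord7 (O' i) $ k)"
  have gram: "transpose Z ** Z = (\<chi> i j. column i Z \<bullet> column j Z)" for Z :: "real^7^7"
    by (simp add: vec_eq_iff matrix_matrix_mult_def transpose_def inner_vec_def column_def)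
  have colO: "column i Om = coord7 (O' i)" for i
    by (simp add: Om_def column_def vec_eq_iff)
  have "column i (Z ** Om) = Z *v column i Om" for Z :: "real^7^7" and i
    by (simp add: vec_eq_iff column_def matrix_matrix_mult_def matrix_vector_mult_def)
  then have colN: "column i (shear7 a b c ** Om) = coord7 (N i)" for i
    by (simp add: colO shear7_mult N_def)
  have "(\<chi> i j. N i \<bullet> N j) = transpose (shear7 a b c ** Om) ** (shear7 a b c ** Om)"
    unfolding gram colN coord7_inner ..
  moreover have "(\<chi> i j. O' i \<bullet> O' j) = transpose Om ** Om"
    unfolding gram colO coord7_inner ..
  ultimately show ?thesis
    by (simp add: det_mul det_transpose det_shear7 power2_eq_square)
qed

text \<open>The density of the Riemannian volume against Lebesgue measure on the fibre times the
  round unit sphere. It is (2 A1 B1 / t)^3 for t > 0; writing A1 / t as sqrt A1q extends it to t =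
  0.\<close>

definition fibre_density :: "real \<Rightarrow> real" where
  "fibre_density t = (2 * sqrt (A1q (t\<^sup>2)) * B1 t) ^ 3"

definition sphere_density :: "real^3 \<Rightarrow> real" where
  "sphere_density y = (2 / ((norm y)\<^sup>2 + 1)) ^ 3"

lemma fibre_density_0: "fibre_density 0 = (1 / sqrt 3) ^ 3"
  by (simp add: fibre_density_def A1q_0 B1_def r_of_t_eq tsq_inv_0 real_sqrt_divide)

lemma fibre_density_nonneg: "t \<ge> 0 \<Longrightarrow> fibre_density t \<ge> 0"
  using A1q_pos[OF tsq_range_nonneg[of "t\<^sup>2"]] by (simp add: fibre_density_def less_imp_le[OF B1_pos])

lemma sphere_density_pos: "sphere_density y > 0"
  using norm_square_plus_1_pos[of y] by (simp add: sphere_density_def)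

lemma im_part_stereo_inner:
  "snd (stereo y \<odot> qconj (stereo_deriv y v)) \<bullet> snd (stereo y \<odot> qconj (stereo_deriv y w))
    = (2 / ((norm y)\<^sup>2 + 1))\<^sup>2 * (v \<bullet> w)"
proof -
  let ?q = "stereo y"
  have "fst (?q \<odot> qconj (stereo_deriv y u)) = 0" for u
    by (simp add: fst_qmult_qconj stereo_inner_deriv)
  then have "snd (?q \<odot> qconj (stereo_deriv y v)) \<bullet> snd (?q \<odot> qconj (stereo_deriv y w))
      = (?q \<odot> qconj (stereo_deriv y v)) \<bullet> (?q \<odot> qconj (stereo_deriv y w))"
    by (simp add: inner_prod_def)
  also have "\<dots> = fst (qconj (?q \<odot> qconj (stereo_deriv y v)) \<odot> (?q \<odot> qconj (stereo_deriv y w)))"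
    by (simp add: fst_qconj_qmult)
  also have "\<dots> = stereo_deriv y v \<bullet> stereo_deriv y w"
    by (simp add: qconj_qmult qmult_assoc qconj_qmult_cancel[OF norm_stereo] fst_qmult_qconj)
  finally show ?thesis by (simp add: stereo_deriv_inner)
qed

lemma volume_density_param_M:
  "volume_density bs_metric param_M u = fibre_density (norm (fibre_part u)) * sphere_density (base_part u)"
proof -
  define p y t s where "p = fibre_part u" and "y = base_part u" and "t = norm p" and "s = 2 / ((norm y)\<^sup>2 + 1)"
  define d where "d = (\<lambda>i. (fibre_part (axis i 1), stereo_deriv y (base_part (axis (i::7) 1))))"
  have s: "s > 0" using norm_square_plus_1_pos[of y] by (simp add: s_def)
  have fd: "frechet_derivative param_M (at u) (axis i 1) = d i" for i
    using fun_cong[OF frechet_derivative_at[OF has_derivative_param_M[of u]], of "axis i 1"]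
    by (simp add: d_def y_def)
  have par: "param_M u = (p, stereo y)" by (simp add: param_M_eq p_def y_def)
  have "det (\<chi> i j. bs_metric (p, stereo y) (d i) (d j)) = (fibre_density t * s ^ 3)\<^sup>2"
  proof (cases "p = 0")
    \<comment> \<open>The chart passes through the singular orbit, where the metric is defined as a
      limit; there \<open>bs_metric_sing\<close> already makes the Gram matrix diagonal.\<close>
    case True
    have "det (\<chi> i j. bs_metric (p, stereo y) (d i) (d j)) = (s\<^sup>2 / 3) ^ 3"
      by (rule det_frame) (simp add: True bs_metric_sing norm_stereo d_def im_part_stereo_inner s_def)
    also have "\<dots> = (fibre_density t * s ^ 3)\<^sup>2"
    proof -
      have "(1 / sqrt 3)\<^sup>2 = (1 / 3 :: real)" by (simp add: power_divide)
      moreover have "(1 / sqrt 3) ^ 3 * (1 / sqrt 3) ^ 3 = ((1 / sqrt 3)\<^sup>2) ^ 3"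
        by (simp only: power2_eq_square power_mult_distrib)
      ultimately have "(1 / sqrt 3) ^ 3 * (1 / sqrt 3) ^ 3 = (1 / 3 :: real) ^ 3" by (simp only:)
      moreover have "(fibre_density t * s ^ 3)\<^sup>2 = ((1 / sqrt 3) ^ 3 * (1 / sqrt 3) ^ 3) * (s\<^sup>2) ^ 3"
        by (simp only: True t_def norm_zero fibre_density_0) (simp add: power2_eq_square power3_eq_cube)
      ultimately show ?thesis by (simp add: power_divide)
    qed
    finally show ?thesis .
  next
    case False
    then have t: "t > 0" by (simp add: t_def)
    \<comment> \<open>Rescaled coordinates in which the coordinate frame has the diagonal Gram
      matrix of the product metric. The frame coordinates arise from them by the shear with a = 2 A1
      / t, b = A1, c = - B1.\<close>
    define O' where "O' = (\<lambda>i. (p \<bullet> fst (d i) / t, (1 / t) *\<^sub>R im_fibre (p, stereo y) (d i),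
        (1 / t\<^sup>2) *\<^sub>R im_base (p, stereo y) (d i)))"
    have fc: "frame_coord (p, stereo y) (d i) = (fst (O' i),
        (2 * A1 t / t) *\<^sub>R fst (snd (O' i)) + A1 t *\<^sub>R snd (snd (O' i)), (- B1 t) *\<^sub>R snd (snd (O' i)))" for i
      using False t by (simp add: frame_coord_eq norm_stereo O'_def scaleR_add_right power2_eq_square flip: t_def)
    have "bs_metric (p, stereo y) (d i) (d j) = frame_coord (p, stereo y) (d i) \<bullet> frame_coord (p, stereo y) (d j)" for i j
      using False by (simp add: bs_metric_frame_coord)
    then have "det (\<chi> i j. bs_metric (p, stereo y) (d i) (d j)) =
        ((2 * A1 t / t) ^ 3 * (- B1 t) ^ 3)\<^sup>2 * det (\<chi> i j. O' i \<bullet> O' j)"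
      by (simp only: fc det_shear_gram)
    also have "det (\<chi> i j. O' i \<bullet> O' j) = (s\<^sup>2) ^ 3"
    proof (rule det_frame)
      fix i j
      have "O' i \<bullet> O' j = ((p \<bullet> fst (d i)) * (p \<bullet> fst (d j))
          + im_fibre (p, stereo y) (d i) \<bullet> im_fibre (p, stereo y) (d j)) / t\<^sup>2
          + (im_base (p, stereo y) (d i) \<bullet> im_base (p, stereo y) (d j)) / t ^ 4"
        by (simp add: O'_def add_divide_distrib power2_eq_square power4_eq_xxxx)
      also have "\<dots> = fst (d i) \<bullet> fst (d j) + s\<^sup>2 * (base_part (axis i 1) \<bullet> base_part (axis j 1))"
        unfolding im_fibre_inner im_base_inner using t
        by (simp add: t_def d_def im_part_stereo_inner s_def)
      finally show "O' i \<bullet> O' j = fibre_part (axis i 1) \<bullet> fibre_part (axis j 1)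
          + s\<^sup>2 * (base_part (axis i 1) \<bullet> base_part (axis j 1))" by (simp add: d_def)
    qed
    also have "2 * A1 t / t = 2 * sqrt (A1q (t\<^sup>2))"
    proof -
      have "A1 t = sqrt ((A1 t)\<^sup>2)" using A1_nonneg t by simp
      also have "\<dots> = t * sqrt (A1q (t\<^sup>2))" using A1_square[of t] t by (simp add: real_sqrt_mult)
      finally show ?thesis using t by simp
    qed
    finally show ?thesis
      by (simp add: fibre_density_def power_mult_distrib power_minus_odd flip: power_mult)
  qed
  moreover have "fibre_density t * s ^ 3 \<ge> 0"
    using s fibre_density_nonneg[of t] by (simp add: t_def)
  ultimately show ?thesis
    by (simp add: volume_density_def fd par t_def p_def sphere_density_def s_def y_def)
qed

lemma volume_density_param_sing:
  "volume_density bs_metric param_sing y = fibre_density 0 * sphere_density y"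
proof -
  define s where "s = 2 / ((norm y)\<^sup>2 + 1)"
  have s: "s > 0" using norm_square_plus_1_pos[of y] by (simp add: s_def)
  have ps: "(param_sing has_derivative (\<lambda>w. (0, stereo_deriv y w))) (at y)"
    unfolding param_sing_def[abs_def] by (intro has_derivative_Pair has_derivative_const has_derivative_stereo)
  have fd: "frechet_derivative param_sing (at y) (axis i 1) = (0, stereo_deriv y (axis i 1))" for i
    using fun_cong[OF frechet_derivative_at[OF ps], of "axis i 1"] by simp
  have g: "bs_metric (param_sing y) (0, stereo_deriv y (axis i 1)) (0, stereo_deriv y (axis j 1))
      = (if i = j then s\<^sup>2 / 3 else 0)" for i j :: 3
    by (simp add: param_sing_def bs_metric_sing norm_stereo im_part_stereo_inner s_def inner_axis_axis)
  have "det (\<chi> i j. bs_metric (param_sing y) (0, stereo_deriv y (axis i 1)) (0, stereo_deriv y (axis (j::3) 1)))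
     = (s\<^sup>2 / 3) ^ 3"
    unfolding g by (subst det_diagonal) (simp_all add: prod_3 power3_eq_cube)
  also have "\<dots> = ((1 / sqrt 3) ^ 3 * s ^ 3)\<^sup>2"
    by (simp add: power2_eq_square power3_eq_cube)
  finally have "volume_density bs_metric param_sing y = sqrt (((1 / sqrt 3) ^ 3 * s ^ 3)\<^sup>2)"
    by (simp add: volume_density_def fd)
  also have "\<dots> = (1 / sqrt 3) ^ 3 * s ^ 3" using s by (simp only: real_sqrt_abs) simp
  finally show ?thesis by (simp add: fibre_density_0 sphere_density_def s_def)
qed

section \<open>The excess of curvature\<close>

text \<open>Here \<open>lim\<^sub>i r = curv\<^sub>i 0 r\<close>, extended continuously to \<open>r = 1\<close>, and
  \<open>curv\<^sub>i e r - curv\<^sub>i 0 r = x * num\<^sub>i e r\<close> for \<open>x = e / (r\<^sup>2 - 1 + e)\<^sup>2\<close>; see \<open>curv_diff\<close>.\<close>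

definition num1 :: "real \<Rightarrow> real \<Rightarrow> real" where
  "num1 e r = (2 * r ^ 3 + 1) / r ^ 3 + (2 * r + 1) * (2 * (r\<^sup>2 - 1) + e) / (r ^ 3 * (r + 1)\<^sup>2)"

definition num2 :: "real \<Rightarrow> real \<Rightarrow> real" where
  "num2 e r = ((r + 2) * (2 * (r\<^sup>2 - 1) + e) / (r + 1)\<^sup>2 - 3 * r) / r"

definition num3 :: "real \<Rightarrow> real \<Rightarrow> real" where
  "num3 e r = (r\<^sup>2 + r + 1) * (r\<^sup>2 - 1 + e) / (r ^ 3 * (r + 1))"

definition lim1 :: "real \<Rightarrow> real" where "lim1 r = - (2 * r + 1) / (r ^ 3 * (r + 1)\<^sup>2)"

definition lim2 :: "real \<Rightarrow> real" where "lim2 r = - (r + 2) / (r * (r + 1)\<^sup>2)"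

definition lim3 :: "real \<Rightarrow> real" where "lim3 r = - (r\<^sup>2 + r + 1) / (r ^ 3 * (r + 1))"

text \<open>\<open>quad\<close> and \<open>lin\<close> are the coefficients of x^2 and x in 6 times
  |lim + x num|^2 - |lim|^2, where lim and num are the vectors of the three components; the 12 of
  \<open>lin\<close> contains the 2 of the cross term.\<close>

definition quad :: "real \<Rightarrow> real \<Rightarrow> real" where
  "quad e r = 6 * ((num1 e r)\<^sup>2 + (num2 e r)\<^sup>2 + (num3 e r)\<^sup>2)"

definition lin :: "real \<Rightarrow> real \<Rightarrow> real" where
  "lin e r = 12 * (num1 e r * lim1 r + num2 e r * lim2 r + num3 e r * lim3 r)"

definition excess :: "real \<Rightarrow> real \<Rightarrow> real" where
  "excess e r = e / (r\<^sup>2 - 1 + e)\<^sup>2 * (e / (r\<^sup>2 - 1 + e)\<^sup>2 * quad e r + lin e r)"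

lemmas excess_defs = quad_def lin_def num1_def num2_def num3_def lim1_def lim2_def lim3_def

lemma curv_eq_lim:
  assumes "r > 1"
  shows "curv1 0 r = lim1 r" "curv2 0 r = lim2 r" "curv3 0 r = lim3 r"
proof -
  have f: "r\<^sup>2 - 1 = (r - 1) * (r + 1)" "r ^ 3 - 1 = (r - 1) * (r\<^sup>2 + r + 1)"
    by (simp_all add: power2_eq_square power3_eq_cube algebra_simps)
  have "(r - 1)\<^sup>2 > 0" "(r - 1) > 0" "r > 0" "r + 1 > 0" using assms by auto
  then show "curv1 0 r = lim1 r" "curv2 0 r = lim2 r" "curv3 0 r = lim3 r"
    unfolding curv1_def curv2_def curv3_def lim1_def lim2_def lim3_def f
    by (simp_all add: power_mult_distrib del: minus_add_distrib)
qed

text \<open>With D = r^2 - 1 + e the numerator of 1/(r^2 - 1)^2 - 1/D^2 is D^2 - (r^2 - 1)^2 = e (2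
  (r^2 - 1) + e). This accounts for that factor in \<open>num1\<close> and \<open>num2\<close>, and
  shows that e divides the difference.\<close>

lemma curv_diff:
  assumes "r > 1" "e \<ge> 0"
  shows "curv1 e r - lim1 r = e * num1 e r / (r\<^sup>2 - 1 + e)\<^sup>2" (is ?A)
    and "curv2 e r - lim2 r = e * num2 e r / (r\<^sup>2 - 1 + e)\<^sup>2" (is ?B)
    and "curv3 e r - lim3 r = e * num3 e r / (r\<^sup>2 - 1 + e)\<^sup>2" (is ?C)
proof -
  define D s where "D = r\<^sup>2 - 1 + e" and "s = r + 1"
  have r1: "r > 0" "s > 0" using assms by (auto simp: s_def)
  have "1 < r\<^sup>2" using assms(1) by (intro one_less_power) auto
  then have D: "D > 0" using assms(2) unfolding D_def by linarith
  have e: "2 * (r\<^sup>2 - 1) + e = D + (r - 1) * s"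
    by (simp add: D_def s_def power2_eq_square algebra_simps)
  have es: "e = D - (r - 1) * s"
    by (simp add: D_def s_def power2_eq_square algebra_simps)
  have gen: "(D - (r - 1) * s) * (D + (r - 1) * s) = D\<^sup>2 - (r - 1)\<^sup>2 * s\<^sup>2"
    by (simp add: power2_eq_square algebra_simps)
  have gen': "e * (D + (r - 1) * s) = D\<^sup>2 - (r - 1)\<^sup>2 * s\<^sup>2"
    using gen es by simp
  have "e * num1 e r = e * ((2 * r ^ 3 + 1) / r ^ 3) + (2 * r + 1) * (e * (D + (r - 1) * s)) / (r ^ 3 * s\<^sup>2)"
    unfolding num1_def e s_def[symmetric] by (simp add: algebra_simps)
  also have "\<dots> = D\<^sup>2 * (curv1 e r - lim1 r)"
  proof -
    have "e * ((2 * R + 1) / R) + c * (D\<^sup>2 - (r - 1)\<^sup>2 * s\<^sup>2) / (R * s\<^sup>2)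
        = D\<^sup>2 * ((e * (2 * R + 1) - (r - 1)\<^sup>2 * c) / (R * D\<^sup>2) - - c / (R * s\<^sup>2))" if "R > 0" for R c
      using r1 D that by (simp add: field_simps)
    from this[of "r ^ 3" "2 * r + 1", OF zero_less_power[OF r1(1)]] show ?thesis
      unfolding gen' curv1_def lim1_def D_def[symmetric] s_def[symmetric] .
  qed
  finally show ?A using D by (simp add: D_def)
  have "e * num2 e r = ((r + 2) * (e * (D + (r - 1) * s)) / s\<^sup>2 - 3 * r * e) / r"
    unfolding num2_def e s_def[symmetric] by (simp add: algebra_simps)
  also have "\<dots> = D\<^sup>2 * (curv2 e r - lim2 r)"
    unfolding gen' curv2_def lim2_def D_def[symmetric] s_def[symmetric]
    using r1 D by (simp add: field_simps)
  finally show ?B using D by (simp add: D_def)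
  have c3: "r ^ 3 - 1 = (r\<^sup>2 + r + 1) * (r - 1)"
    by (simp add: power2_eq_square power3_eq_cube algebra_simps)
  have "D\<^sup>2 * (curv3 e r - lim3 r) = (r\<^sup>2 + r + 1) * D * (D - (r - 1) * s) / (r ^ 3 * s)"
    unfolding curv3_def lim3_def D_def[symmetric] s_def[symmetric] c3
    using r1 D by (simp add: divide_simps) (simp add: power2_eq_square algebra_simps)
  also have "\<dots> = e * num3 e r"
    unfolding num3_def D_def[symmetric] s_def[symmetric] es[symmetric] by simp
  finally show ?C using D by (simp add: D_def field_simps)
qed

lemma excess_eq:
  assumes "r > 1" "e \<ge> 0" shows "curv_sq e r - curv_sq 0 r = excess e r"
proof -
  define x where "x = e / (r\<^sup>2 - 1 + e)\<^sup>2"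
  have "curv1 e r = lim1 r + x * num1 e r" "curv2 e r = lim2 r + x * num2 e r"
    "curv3 e r = lim3 r + x * num3 e r"
    using curv_diff[OF assms] by (simp_all add: x_def algebra_simps)
  then show ?thesis
    unfolding excess_def x_def[symmetric] quad_def lin_def
    by (simp add: curv_sq_def curv_eq_lim[OF assms(1)] power2_eq_square algebra_simps)
qed

lemma excess_denominator: "r \<ge> 1 \<Longrightarrow> e > 0 \<Longrightarrow> r\<^sup>2 - 1 + e > (0::real)"
  using one_le_power[of r 2] by linarith

lemma continuous_on_excess: 
  assumes "e > 0" shows "continuous_on {1..} (excess e)"
  unfolding excess_def excess_defs
  using excess_denominator[OF _ assms]
  by (intro continuous_intros) (force simp: less_imp_neq[symmetric])+

text \<open>Individually \<open>curv_sq e r\<close> is only of order \<open>r\<^sup>-\<^sup>4\<close>.  Its leading variation with \<open>e\<close>, of relative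
  order \<open>r\<^sup>-\<^sup>2\<close>, cancels between \<open>curv2\<close> and \<open>curv3\<close>: on the asymptotic cone the coefficient of the
  connection is a critical point of the energy.\<close>

lemma excess_decay:
  assumes "e > 0"
  obtains C where "C > 0" "\<And>r. r \<ge> 1 \<Longrightarrow> \<bar>excess e r\<bar> \<le> C / r ^ 8"
proof -
  have "excess e \<in> O(\<lambda>r. 1 / r ^ 8)"
    unfolding excess_def excess_defs
    using assms by real_asymp
  then obtain c where "eventually (\<lambda>r. norm (excess e r) \<le> c * norm (1 / r ^ 8)) at_top"
    by (elim landau_o.bigE)
  then obtain R where R: "\<And>r. r \<ge> R \<Longrightarrow> norm (excess e r) \<le> c * norm (1 / r ^ 8)"
    by (auto simp: eventually_at_top_linorder)
  have "continuous_on {1..max 1 R} (\<lambda>r. excess e r * r ^ 8)"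
    by (intro continuous_intros continuous_on_subset[OF continuous_on_excess[OF assms]]) auto
  then have "bounded ((\<lambda>r. excess e r * r ^ 8) ` {1..max 1 R})"
    by (intro compact_imp_bounded compact_continuous_image) auto
  then obtain b where b: "\<forall>r\<in>{1..max 1 R}. \<bar>excess e r * r ^ 8\<bar> \<le> b"
    by (auto simp: bounded_iff)
  show ?thesis
  proof (rule that[of "max 1 (max b c)"])
    fix r :: real assume r: "r \<ge> 1"
    then have r8: "r ^ 8 > 0" by simp
    show "\<bar>excess e r\<bar> \<le> max 1 (max b c) / r ^ 8"
    proof (cases "r \<le> max 1 R")
      case True
      then have "\<bar>excess e r\<bar> * r ^ 8 \<le> b" using bspec[OF b, of r] r by (simp add: abs_mult)
      then show ?thesis using r8 by (simp add: le_divide_eq)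
    next
      case False
      then have "\<bar>excess e r\<bar> \<le> c / r ^ 8" using R[of r] r by simp
      also have "\<dots> \<le> max 1 (max b c) / r ^ 8" using r8 by (intro divide_right_mono) auto
      finally show ?thesis .
    qed
  qed auto
qed

text \<open>All singular behaviour at (e, r) = (0, 1) sits in x = e / (r^2 - 1 + e)^2. The functions
  \<open>quad\<close> and \<open>lin\<close> are continuous on the compact rectangle including e =
  0, so the constant does not depend on e.\<close>

lemma excess_local:
  assumes "R \<ge> 1"
  obtains C where "C > 0" "\<And>e r. \<lbrakk>0 < e; e \<le> 1; 1 \<le> r; r \<le> R\<rbrakk> \<Longrightarrow>
     \<bar>excess e r\<bar> \<le> C * ((e / (r\<^sup>2 - 1 + e)\<^sup>2) * (e / (r\<^sup>2 - 1 + e)\<^sup>2 + 1))"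
proof -
  have bd: "\<exists>b>0. \<forall>e\<in>{0..1}. \<forall>r\<in>{1..R}. \<bar>f e r\<bar> \<le> b"
    if "continuous_on ({0..1} \<times> {1..R}) (\<lambda>z. f (fst z) (snd z))" for f :: "real \<Rightarrow> real \<Rightarrow> real"
  proof -
    have "bounded ((\<lambda>z. f (fst z) (snd z)) ` ({0..1} \<times> {1..R}))"
      by (intro compact_imp_bounded compact_continuous_image that compact_Times) auto
    then obtain b where "b > 0" "\<forall>x\<in>(\<lambda>z. f (fst z) (snd z)) ` ({0..1} \<times> {1..R}). norm x \<le> b"
      unfolding bounded_pos by blast
    then show ?thesis by (intro exI[of _ b]) force
  qed
  have "continuous_on ({0..1} \<times> {1..R}) (\<lambda>z. quad (fst z) (snd z))"
    "continuous_on ({0..1} \<times> {1..R}) (\<lambda>z. lin (fst z) (snd z))"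
    unfolding excess_defs by (intro continuous_intros; force)+
  from this[THEN bd] obtain q l where ql: "q > 0" "l > 0" "\<forall>e\<in>{0..1}. \<forall>r\<in>{1..R}. \<bar>quad e r\<bar> \<le> q"
    "\<forall>e\<in>{0..1}. \<forall>r\<in>{1..R}. \<bar>lin e r\<bar> \<le> l"
    by metis
  show ?thesis
  proof (rule that[of "q + l"])
    fix e r :: real assume er: "0 < e" "e \<le> 1" "1 \<le> r" "r \<le> R"
    define x where "x = e / (r\<^sup>2 - 1 + e)\<^sup>2"
    have x: "x \<ge> 0" using er by (simp add: x_def)
    have Q: "\<bar>quad e r\<bar> \<le> q" and L: "\<bar>lin e r\<bar> \<le> l" using ql er by auto
    have "\<bar>x * quad e r\<bar> \<le> x * q" using x Q by (simp add: abs_mult mult_left_mono)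
    then have "\<bar>x * quad e r + lin e r\<bar> \<le> x * q + l"
      using L by (intro order_trans[OF abs_triangle_ineq] add_mono)
    also have "\<dots> \<le> (q + l) * (x + 1)" using x ql by (simp add: algebra_simps)
    finally have "x * \<bar>x * quad e r + lin e r\<bar> \<le> x * ((q + l) * (x + 1))"
      using x by (intro mult_left_mono)
    then show "\<bar>excess e r\<bar> \<le> (q + l) * ((e / (r\<^sup>2 - 1 + e)\<^sup>2) * (e / (r\<^sup>2 - 1 + e)\<^sup>2 + 1))"
      unfolding excess_def x_def[symmetric] using x by (simp add: abs_mult mult_ac)
  qed (use ql in simp)
qed

section \<open>Comparison of the radial variables\<close>

lemma r_of_t_ge_1: "t \<ge> 0 \<Longrightarrow> r_of_t t \<ge> 1"
  using tsq_inv_nonneg[of "t\<^sup>2"] by (simp add: r_of_t_eq)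

lemma t_square_le:
  assumes "t \<ge> 0" shows "t\<^sup>2 \<le> 4 * ((r_of_t t - 1) * r_of_t t)"
proof -
  define w where "w = tsq_inv (t\<^sup>2)"
  have w: "w \<ge> 0" "tsq w = t\<^sup>2"
    using tsq_inv_nonneg[of "t\<^sup>2"] tsq_tsq_inv(2)[OF tsq_range_nonneg[of "t\<^sup>2"]] by (auto simp: w_def)
  have "(avg w)\<^sup>2 \<le> (2 * sqrt (1 + w))\<^sup>2"
    using avg_upper[OF w(1)] avg_pos[of w] w(1) by (intro power_mono) auto
  then have "(avg w)\<^sup>2 \<le> 4 * (1 + w)" using w(1) by (simp add: power_mult_distrib)
  then have "w * (avg w)\<^sup>2 \<le> w * (4 * (1 + w))" using w(1) by (intro mult_left_mono)
  then show ?thesis using w(2) assms by (simp add: tsq_def r_of_t_eq w_def algebra_simps)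
qed

text \<open>The first bound converts decay in r into decay in |p|. The second, after rescaling by
  sqrt e, bounds the denominator r^2 - 1 + e below by a multiple of e (1 + |p|^2).\<close>

lemma r_square_ge:
  assumes "t \<ge> 0" shows "1 + t\<^sup>2 \<le> 4 * (r_of_t t)\<^sup>2" "t\<^sup>2 / 4 \<le> (r_of_t t)\<^sup>2 - 1"
proof -
  define r where "r = r_of_t t"
  have r: "r \<ge> 1" and t: "t\<^sup>2 \<le> 4 * ((r - 1) * r)"
    using assms r_of_t_ge_1 t_square_le by (auto simp: r_def)
  have 1: "(r - 1) * r = r\<^sup>2 - r" by (simp add: power2_eq_square algebra_simps)
  then show "1 + t\<^sup>2 \<le> 4 * (r_of_t t)\<^sup>2" "t\<^sup>2 / 4 \<le> (r_of_t t)\<^sup>2 - 1"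
    using r t unfolding r_def[symmetric] by linarith+
qed

text \<open>Since avg^2 >= r / 3, the quotient A1^2 / t^2 stays bounded by 1, and the cubic growth
  comes from B1 alone.\<close>

lemma fibre_density_le:
  assumes "t \<ge> 0" shows "fibre_density t \<le> 8 * r_of_t t ^ 3"
proof -
  define r w where "r = r_of_t t" and "w = tsq_inv (t\<^sup>2)"
  have r: "r \<ge> 1" "r = 1 + w" "w \<ge> 0"
    using assms r_of_t_ge_1 tsq_inv_nonneg[of "t\<^sup>2"] by (auto simp: r_def w_def r_of_t_eq)
  have "(sqrt r / sqrt 3)\<^sup>2 \<le> (avg w)\<^sup>2"
    using avg_lower[of w] r by (intro power_mono) auto
  then have a: "r / 3 \<le> (avg w)\<^sup>2" using r by (simp add: power_divide)
  have "wq (t\<^sup>2) = 1 / (avg w)\<^sup>2" by (simp add: wq_def w_def)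
  also have "\<dots> \<le> 1 / (r / 3)" using r a avg_pos[of w] by (intro divide_left_mono mult_pos_pos) auto
  finally have wq: "wq (t\<^sup>2) \<le> 3 / r" by simp
  have "A1q (t\<^sup>2) = wq (t\<^sup>2) * ((r\<^sup>2 + r + 1) / (9 * r))"
    by (simp add: A1q_def w_def r(2))
  also have "\<dots> \<le> (3 / r) * ((r\<^sup>2 + r + 1) / (9 * r))"
    using wq r by (intro mult_right_mono) auto
  also have "\<dots> \<le> 1"
  proof -
    have "r \<le> r\<^sup>2" "1 \<le> r\<^sup>2" using r(1) by (simp_all add: power2_eq_square mult_ge1_I mult_le_cancel_left1)
    then have "(r\<^sup>2 + r + 1) / (3 * r\<^sup>2) \<le> 1" using r(1) by (simp add: divide_le_eq)
    moreover have "(3 / r) * (N / (9 * r)) = N / (3 * r\<^sup>2)" for N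
      using r(1) by (simp add: power2_eq_square)
    ultimately show ?thesis by (simp only:)
  qed
  finally have "sqrt (A1q (t\<^sup>2)) \<le> 1" by simp
  moreover have "B1 t \<le> r"
    using r(1) by (simp add: B1_def divide_le_eq flip: r_def)
  moreover have "B1 t \<ge> 0" "A1q (t\<^sup>2) \<ge> 0"
    using B1_pos[OF assms] A1q_pos[OF tsq_range_nonneg[of "t\<^sup>2"]] by auto
  ultimately have "sqrt (A1q (t\<^sup>2)) * B1 t \<le> 1 * r" by (intro mult_mono) auto
  then have "(2 * sqrt (A1q (t\<^sup>2)) * B1 t) ^ 3 \<le> (2 * r) ^ 3"
    using \<open>B1 t \<ge> 0\<close> \<open>A1q (t\<^sup>2) \<ge> 0\<close> by (intro power_mono) auto
  then show ?thesis by (simp add: fibre_density_def r_def power_mult_distrib)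
qed

lemma continuous_on_r_of_t: "continuous_on {0..} r_of_t"
proof -
  have "continuous_on {0..} (\<lambda>t::real. 1 + tsq_inv (t\<^sup>2))"
    by (intro continuous_intros continuous_on_compose2[OF smooth_on_imp_continuous_on[OF smooth_on_tsq_inv]])
      (auto intro: tsq_range_nonneg)
  then show ?thesis by (rule continuous_on_cong[THEN iffD1, rotated -1]) (auto simp: r_of_t_eq)
qed

lemma continuous_on_fibre_density: "continuous_on {0..} fibre_density"
proof -
  have "continuous_on {0..} (\<lambda>t. A1q (t\<^sup>2))"
    by (intro continuous_intros continuous_on_compose2[OF smooth_on_imp_continuous_on[OF smooth_on_A1q]])
      (auto intro: tsq_range_nonneg)
  then show ?thesis
    unfolding fibre_density_def[abs_def] B1_def by (intro continuous_intros continuous_on_r_of_t) auto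
qed

section \<open>Radial integrals\<close>

text \<open>Layer-cake formula in place of polar coordinates: G(a) is the integral of h over [a,
  \<infinity>), and after exchanging the integrals the inner one is the volume of a ball.\<close>

lemma nn_integral_radial:
  fixes h :: "real \<Rightarrow> real" and G :: "real \<Rightarrow> real"
  assumes [measurable]: "h \<in> borel_measurable borel"
    and G: "\<And>s. s \<ge> 0 \<Longrightarrow> (G has_field_derivative - h s) (at s)" "(G \<longlongrightarrow> 0) at_top"
    and h: "\<And>s. s \<ge> 0 \<Longrightarrow> h s \<ge> 0"
  shows "(\<integral>\<^sup>+p. ennreal (G (norm (p::'a::euclidean_space))) \<partial>lborel)
    = (\<integral>\<^sup>+s. ennreal (h s * (unit_ball_vol DIM('a) * s ^ DIM('a))) * indicator {0..} s \<partial>lborel)"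
proof -
  have tail: "ennreal (G a) = (\<integral>\<^sup>+s. ennreal (h s) * indicator {a..} s \<partial>lborel)" if "a \<ge> 0" for a
  proof -
    have "((\<lambda>s. - G s) \<longlongrightarrow> - 0) at_top" by (intro tendsto_minus G)
    then have "(\<integral>\<^sup>+s. ennreal (h s) * indicator {a..} s \<partial>lborel) = ennreal (- 0 - (- G a))"
      by (rule nn_integral_FTC_atLeast[rotated -1])
        (use that h DERIV_minus[OF G(1)] in auto)
    then show ?thesis by simp
  qed
  have "(\<integral>\<^sup>+p. ennreal (G (norm (p::'a))) \<partial>lborel)
      = (\<integral>\<^sup>+p. (\<integral>\<^sup>+s. ennreal (h s) * indicator {norm (p::'a)..} s \<partial>lborel) \<partial>lborel)"
    by (simp add: tail)
  also have "\<dots> = (\<integral>\<^sup>+s. (\<integral>\<^sup>+p. ennreal (h s) * indicator {norm (p::'a)..} s \<partial>lborel) \<partial>lborel)"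
  proof (rule lborel_pair.Fubini'[symmetric])
    have "Measurable.pred (lborel \<Otimes>\<^sub>M lborel) (\<lambda>z :: 'a \<times> real. norm (fst z) \<le> snd z)" by measurable
    then have "(\<lambda>z :: 'a \<times> real. ennreal (h (snd z)) * indicator {z. norm (fst z) \<le> snd z} z) \<in> borel_measurable (lborel \<Otimes>\<^sub>M lborel)"
      by measurable
    then show "(\<lambda>(p::'a, s). ennreal (h s) * indicator {norm p..} s) \<in> borel_measurable (lborel \<Otimes>\<^sub>M lborel)"
      by (rule measurable_cong[THEN iffD1, rotated]) (auto simp: indicator_def)
  qed
  also have "\<dots> = (\<integral>\<^sup>+s. ennreal (h s * (unit_ball_vol DIM('a) * s ^ DIM('a))) * indicator {0..} s \<partial>lborel)"
  proof (rule nn_integral_cong)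
    fix s :: real
    show "(\<integral>\<^sup>+p. ennreal (h s) * indicator {norm (p::'a)..} s \<partial>lborel)
        = ennreal (h s * (unit_ball_vol DIM('a) * s ^ DIM('a))) * indicator {0..} s"
    proof (cases "s \<ge> 0")
      case True
      have "(\<integral>\<^sup>+p. ennreal (h s) * indicator {norm (p::'a)..} s \<partial>lborel)
          = (\<integral>\<^sup>+p. ennreal (h s) * indicator (cball (0::'a) s) p \<partial>lborel)"
        by (intro nn_integral_cong) (auto simp: indicator_def)
      also have "\<dots> = ennreal (h s) * emeasure lborel (cball (0::'a) s)"
        by (rule nn_integral_cmult_indicator) simp
      finally show ?thesis
        using True h[OF True] by (simp add: emeasure_cball ennreal_mult)
    next
      case False
      then have "indicator {norm (p::'a)..} s = (0::ennreal)" for p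
        using norm_ge_zero[of p] by (auto simp: indicator_def simp del: norm_ge_zero)
      then show ?thesis using False by simp
    qed
  qed
  finally show ?thesis .
qed

text \<open>The exponent matches curvature decay r^-8 against density growth r^3, giving order
  |p|^-5, which is integrable in dimension 4. The same function on R^3 dominates the round density
  of the sphere.\<close>

definition majorant :: "'a::euclidean_space \<Rightarrow> real" where
  "majorant p = (1 + (norm p)\<^sup>2) powr (- 5 / 2)"

lemma majorant_pos: "majorant p > 0"
proof -
  have "1 + (norm p)\<^sup>2 > 0" by (simp add: add_pos_nonneg)
  then show ?thesis by (simp add: majorant_def)
qed

lemma continuous_on_majorant: "continuous_on UNIV majorant"
proof -
  have "1 + (norm p)\<^sup>2 > 0" for p :: 'a
    by (simp add: add_pos_nonneg)
  note pos = less_imp_neq[OF this, symmetric]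
  show ?thesis
    unfolding majorant_def[abs_def] by (intro continuous_intros ballI pos)
qed

lemma integrable_majorant:
  assumes "DIM('a::euclidean_space) \<le> 4"
  shows "integrable lborel (majorant :: 'a \<Rightarrow> real)"
proof -
  let ?n = "DIM('a)" and ?c = "unit_ball_vol DIM('a)"
  define h where "h = (\<lambda>s::real. 5 * s * (1 + s\<^sup>2) powr (- 7 / 2))"
  have pos: "1 + s\<^sup>2 > (0::real)" for s :: real by (simp add: add_pos_nonneg)
  have "(\<integral>\<^sup>+p. ennreal (majorant (p::'a)) \<partial>lborel)
    = (\<integral>\<^sup>+s. ennreal (h s * (?c * s ^ ?n)) * indicator {0..} s \<partial>lborel)"
    unfolding majorant_def
  proof (rule nn_integral_radial)
    show "h \<in> borel_measurable borel" unfolding h_def by measurable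
    show "((\<lambda>s::real. (1 + s\<^sup>2) powr (- 5 / 2)) has_field_derivative - h s) (at s)" for s
      unfolding h_def using pos[of s] by (auto intro!: derivative_eq_intros)
    show "((\<lambda>s::real. (1 + s\<^sup>2) powr (- 5 / 2)) \<longlongrightarrow> 0) at_top" by real_asymp
  qed (simp add: h_def)
  also have "\<dots> \<le> (\<integral>\<^sup>+s. ennreal (?c * (5 * s * (1 + s\<^sup>2) powr (- 3 / 2))) * indicator {0..} s \<partial>lborel)"
  proof (rule nn_integral_mono)
    fix s :: real
    show "ennreal (h s * (?c * s ^ ?n)) * indicator {0..} s
      \<le> ennreal (?c * (5 * s * (1 + s\<^sup>2) powr (- 3 / 2))) * indicator {0..} s"
    proof (cases "s \<ge> 0")
      case True
      \<comment> \<open>Replacing the power of s by (1 + s^2)^2 leaves a multiple of the derivative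
        of (1 + s^2) powr (- 1/2), with an explicit integral.\<close>
      have "s ^ ?n \<le> (1 + s\<^sup>2)\<^sup>2"
      proof (cases "s \<le> 1")
        case True
        with \<open>s \<ge> 0\<close> have "s ^ ?n \<le> 1" by (simp add: power_le_one)
        moreover have "1 \<le> (1 + s\<^sup>2)\<^sup>2" by (intro one_le_power) simp
        ultimately show ?thesis by linarith
      next
        case False
        then have "s ^ ?n \<le> s ^ 4" using assms by (intro power_increasing) auto
        also have "\<dots> = (s\<^sup>2)\<^sup>2" by simp
        also have "\<dots> \<le> (1 + s\<^sup>2)\<^sup>2" by (intro power_mono) auto
        finally show ?thesis .
      qed
      also have "\<dots> = (1 + s\<^sup>2) powr 2" using pos[of s] by (simp add: powr_numeral)
      finally have "h s * s ^ ?n \<le> (5 * s * (1 + s\<^sup>2) powr (- 7 / 2)) * (1 + s\<^sup>2) powr 2"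
        unfolding h_def using True by (intro mult_left_mono) auto
      also have "\<dots> = 5 * s * (1 + s\<^sup>2) powr (- 3 / 2)"
      proof -
        have "(1 + s\<^sup>2) powr (- 7 / 2) * (1 + s\<^sup>2) powr 2 = (1 + s\<^sup>2) powr (- 3 / 2)"
          unfolding powr_add[symmetric] by simp
        then show ?thesis by (simp only: mult.assoc)
      qed
      finally have "?c * (h s * s ^ ?n) \<le> ?c * (5 * s * (1 + s\<^sup>2) powr (- 3 / 2))"
        by (intro mult_left_mono) auto
      then show ?thesis using True by (simp add: mult_ac ennreal_leI)
    qed simp
  qed
  also have "\<dots> = ennreal (0 - (- ?c * 5 * (1 + 0\<^sup>2) powr (- 1 / 2)))"
  proof (rule nn_integral_FTC_atLeast)
    show "((\<lambda>s::real. - ?c * 5 * (1 + s\<^sup>2) powr (- 1 / 2)) \<longlongrightarrow> 0) at_top"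
    proof -
      have "((\<lambda>s::real. (1 + s\<^sup>2) powr (- 1 / 2)) \<longlongrightarrow> 0) at_top" by real_asymp
      from tendsto_mult_right_zero[OF this, of "- ?c * 5"] show ?thesis .
    qed
    show "((\<lambda>s::real. - ?c * 5 * (1 + s\<^sup>2) powr (- 1 / 2)) has_field_derivative
        ?c * (5 * s * (1 + s\<^sup>2) powr (- 3 / 2))) (at s)" for s
      using pos[of s] by (auto intro!: derivative_eq_intros)
  qed auto
  also have "\<dots> < \<infinity>" by simp
  finally have "(\<integral>\<^sup>+p. ennreal (norm (majorant (p::'a))) \<partial>lborel) < \<infinity>"
    by (simp add: abs_of_pos[OF majorant_pos])
  then show ?thesis
    by (intro integrableI_bounded) (auto intro!: borel_measurable_continuous_onI continuous_on_majorant)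
qed

text \<open>On flat R^4 the instanton of parameter l has energy density 48 l^2 / (1 + l |p|^2)^4;
  here l = 3/2, the parameter that belongs to the dilation sqrt (3 / x1).\<close>

definition asd_density :: "quat \<Rightarrow> real" where
  "asd_density p = 108 / (1 + 3 / 2 * (norm p)\<^sup>2) ^ 4"

lemma asd_energy:
  "integrable lborel asd_density" "(\<integral>p. asd_density p \<partial>lborel) = 8 * pi\<^sup>2"
proof -
  define G h where "G = (\<lambda>s::real. 108 / (1 + 3 / 2 * s\<^sup>2) ^ 4)" and "h = (\<lambda>s::real. 1296 * s / (1 + 3 / 2 * s\<^sup>2) ^ 5)"
  have pos: "1 + 3 / 2 * s\<^sup>2 > (0::real)" for s :: real by (simp add: add_pos_nonneg)
  have "(\<integral>\<^sup>+p. ennreal (G (norm (p::quat))) \<partial>lborel)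
    = (\<integral>\<^sup>+s. ennreal (h s * (unit_ball_vol DIM(quat) * s ^ DIM(quat))) * indicator {0..} s \<partial>lborel)"
  proof (rule nn_integral_radial)
    show "h \<in> borel_measurable borel" unfolding h_def by measurable
    show "(G has_field_derivative - h s) (at s)" for s
      unfolding G_def h_def using pos[of s]
      by (auto intro!: derivative_eq_intros simp: divide_simps) (simp add: eval_nat_numeral algebra_simps)?
    show "(G \<longlongrightarrow> 0) at_top" unfolding G_def by real_asymp
  qed (simp add: h_def)
  also have "\<dots> = ennreal (8 * pi\<^sup>2 - 0)"
  proof -
    \<comment> \<open>In terms of v = 3/2 s^2 the integrand becomes 8 pi^2 * 12 v^2 / (1 + v)^5,
      with primitive 8 pi^2 v^3 (v + 4) / (1 + v)^4; its limit 8 pi^2 is the total energy.\<close>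
    define F where "F = (\<lambda>s::real. 8 * pi\<^sup>2 * ((3/2 * s\<^sup>2) ^ 3 * (3/2 * s\<^sup>2 + 4) / (1 + 3/2 * s\<^sup>2) ^ 4))"
    have "(\<integral>\<^sup>+s. ennreal (h s * (unit_ball_vol DIM(quat) * s ^ DIM(quat))) * indicator {0..} s \<partial>lborel)
       = ennreal (8 * pi\<^sup>2 - F 0)"
    proof (rule nn_integral_FTC_atLeast)
      show "(\<lambda>s. h s * (unit_ball_vol DIM(quat) * s ^ DIM(quat))) \<in> borel_measurable borel"
        unfolding h_def by measurable
      show "h s * (unit_ball_vol DIM(quat) * s ^ DIM(quat)) \<ge> 0" if "0 \<le> s" for s
        using that by (simp add: h_def)
      have "((\<lambda>u::real. u ^ 3 * (u + 4) / (1 + u) ^ 4) \<longlongrightarrow> 1) at_top"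
        by real_asymp
      moreover have "filterlim (\<lambda>s::real. 3/2 * s\<^sup>2) at_top at_top" by real_asymp
      ultimately have "((\<lambda>s::real. (3/2 * s\<^sup>2) ^ 3 * (3/2 * s\<^sup>2 + 4) / (1 + 3/2 * s\<^sup>2) ^ 4) \<longlongrightarrow> 1) at_top"
        by (rule filterlim_compose)
      from tendsto_mult_left[OF this, of "8 * pi\<^sup>2"] show "(F \<longlongrightarrow> 8 * pi\<^sup>2) at_top"
        by (simp add: F_def)
      fix s :: real
      define u where "u = 3/2 * s\<^sup>2"
      have u: "1 + u > 0" using pos[of s] by (simp add: u_def)
      have du: "((\<lambda>s. 3/2 * s\<^sup>2) has_field_derivative 3 * s) (at s)"
        by (auto intro!: derivative_eq_intros)
      have "((\<lambda>u. u ^ 3 * (u + 4) / (1 + u) ^ 4) has_field_derivative 12 * u\<^sup>2 / (1 + u) ^ 5) (at u)"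
      proof (rule DERIV_cong)
        show "((\<lambda>u. u ^ 3 * (u + 4) / (1 + u) ^ 4) has_field_derivative
          ((3 * u\<^sup>2 * (u + 4) + u ^ 3) * (1 + u) ^ 4 - u ^ 3 * (u + 4) * (4 * (1 + u) ^ 3)) / ((1 + u) ^ 4)\<^sup>2) (at u)"
          using u by (auto intro!: derivative_eq_intros simp: power2_eq_square)
        have "(3 * u\<^sup>2 * (u + 4) + u ^ 3) * (1 + u) ^ 4 - u ^ 3 * (u + 4) * (4 * (1 + u) ^ 3) = 12 * u\<^sup>2 * (1 + u) ^ 3"
          by (simp add: eval_nat_numeral algebra_simps)
        moreover have "(1 + u) ^ 3 / ((1 + u) ^ 4)\<^sup>2 = 1 / (1 + u) ^ 5"
          using u by (simp add: divide_simps flip: power_mult power_add)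
        ultimately show "((3 * u\<^sup>2 * (u + 4) + u ^ 3) * (1 + u) ^ 4 - u ^ 3 * (u + 4) * (4 * (1 + u) ^ 3)) / ((1 + u) ^ 4)\<^sup>2 = 12 * u\<^sup>2 / (1 + u) ^ 5"
          by (metis times_divide_eq_right mult.right_neutral)
      qed
      then have "((\<lambda>s. (3/2 * s\<^sup>2) ^ 3 * (3/2 * s\<^sup>2 + 4) / (1 + 3/2 * s\<^sup>2) ^ 4) has_field_derivative
          12 * u\<^sup>2 / (1 + u) ^ 5 * (3 * s)) (at s)"
        using DERIV_chain2[OF _ du, of "\<lambda>u. u ^ 3 * (u + 4) / (1 + u) ^ 4" "12 * u\<^sup>2 / (1 + u) ^ 5"]
        by (simp add: u_def)
      then have "(F has_field_derivative 8 * pi\<^sup>2 * (12 * u\<^sup>2 / (1 + u) ^ 5 * (3 * s))) (at s)"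
        unfolding F_def by (rule DERIV_cmult)
      moreover have "8 * pi\<^sup>2 * (12 * u\<^sup>2 / (1 + u) ^ 5 * (3 * s)) = h s * (unit_ball_vol DIM(quat) * s ^ DIM(quat))"
        by (simp add: h_def u_def eval_unit_ball_vol power2_eq_square power4_eq_xxxx)
      ultimately show "(F has_field_derivative h s * (unit_ball_vol DIM(quat) * s ^ DIM(quat))) (at s)"
        by simp
    qed
    then show ?thesis by (simp add: F_def)
  qed
  finally have nn: "(\<integral>\<^sup>+p. ennreal (asd_density p) \<partial>lborel) = ennreal (8 * pi\<^sup>2)"
    by (simp add: asd_density_def G_def)
  have nonneg: "asd_density p \<ge> 0" for p
    using pos[of "norm p"] by (simp add: asd_density_def)
  have "continuous_on UNIV asd_density"
    unfolding asd_density_def[abs_def] using less_imp_neq[OF pos] by (intro continuous_intros) force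
  then have meas: "asd_density \<in> borel_measurable lborel"
    by (simp add: borel_measurable_continuous_onI)
  show "integrable lborel asd_density"
    using nn nonneg meas by (intro integrableI_nn_integral_finite[where x = "8 * pi\<^sup>2"]) auto
  show "(\<integral>p. asd_density p \<partial>lborel) = 8 * pi\<^sup>2"
    using nn nonneg meas by (subst integral_eq_nn_integral) auto
qed

section \<open>Integration against the Riemannian volume\<close>

text \<open>The integrand is compared with the Borel function k o \<psi>, from which it differs only
  on a null set; the completion then makes \<open>h\<close> measurable. This suits integrands that
  are meaningful only off the singular orbit.\<close>

lemma param_volume_integral:
  fixes \<phi> :: "real^'n \<Rightarrow> 'a::{real_normed_vector, second_countable_topology}" and h :: "'a \<Rightarrow> real"
    and g :: "'a \<Rightarrow> 'a \<Rightarrow> 'a \<Rightarrow> real"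
  defines "\<rho> \<equiv> volume_density g \<phi>"
  assumes N: "N \<in> sets borel" "range \<phi> \<subseteq> N" and \<phi>: "\<phi> \<in> borel_measurable borel"
    and \<rho>: "\<rho> \<in> borel_measurable borel" "\<And>u. \<rho> u \<ge> 0"
    and \<psi>: "\<psi> \<in> borel_measurable borel" "\<And>u. \<psi> (\<phi> u) = u"
    and k: "k \<in> borel_measurable borel" "AE u in lborel. h (\<phi> u) = k u"
  shows "integrable (param_volume N g \<phi>) h \<longleftrightarrow> integrable lborel (\<lambda>u. \<rho> u * k u)" (is ?A)
    and "(\<integral>x. h x \<partial>param_volume N g \<phi>) = (\<integral>u. \<rho> u * k u \<partial>lborel)" (is ?B)
proof -
  define D where "D = density lborel (\<lambda>u. ennreal (\<rho> u))"
  define P where "P = distr D (restrict_space borel N) \<phi>"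
  have vol: "param_volume N g \<phi> = completion P"
    by (simp add: param_volume_def P_def D_def \<rho>_def)
  note [measurable] = \<phi> \<rho>(1) \<psi>(1) k(1) N(1)
  have \<phi>N: "\<phi> \<in> measurable D (restrict_space borel N)"
    using N by (intro measurable_restrict_space2) (auto simp: D_def)
  have spP: "space P = N" by (simp add: P_def space_restrict_space)
  have setsP: "A \<in> sets P" if "A \<in> sets borel" "A \<subseteq> N" for A
    using that N by (auto simp: P_def sets_restrict_space_iff)
  obtain Y where Y: "Y \<in> null_sets lborel" "\<And>u. u \<notin> Y \<Longrightarrow> h (\<phi> u) = k u"
    using AE_E3[OF k(2)] by auto
  then have [measurable]: "Y \<in> sets borel" by auto
  \<comment> \<open>Points missed by the parametrization, where \<psi> is not a section, together
    with the points over the exceptional set \<open>Y\<close>. The image measure of \<open>Z\<close>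
    vanishes.\<close>
  define Z where "Z = {x\<in>N. \<phi> (\<psi> x) \<noteq> x \<or> \<psi> x \<in> Y}"
  have kP: "(\<lambda>x. k (\<psi> x)) \<in> borel_measurable P"
    unfolding P_def measurable_distr_eq1 by (intro measurable_restrict_space1) measurable
  have Zb: "Z \<in> sets borel"
  proof -
    have "Measurable.pred borel (\<lambda>x. x \<in> N \<and> (\<phi> (\<psi> x) \<noteq> x \<or> \<psi> x \<in> Y))" by measurable
    then show ?thesis by (simp add: Z_def pred_def)
  qed
  then have ZP: "Z \<in> sets P" by (intro setsP) (auto simp: Z_def)
  have "AE u in D. \<phi> u \<notin> Z"
  proof -
    have "AE u in lborel. u \<notin> Y" using Y(1) AE_not_in by blast
    then show ?thesis
      unfolding D_def by (subst AE_density) (auto simp: Z_def \<psi>(2) elim!: eventually_mono)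
  qed
  then have AEZ: "AE x in P. x \<notin> Z"
    unfolding P_def using sets.compl_sets[OF ZP]
    by (subst AE_distr_iff[OF \<phi>N]) (auto simp: P_def set_diff_eq)
  have AEC: "AE x in completion P. h x = k (\<psi> x)"
  proof -
    have "AE x in completion P. x \<notin> Z" using AEZ by (rule AE_completion)
    moreover have "AE x in completion P. x \<in> N"
      using AE_space[of "completion P"] by (simp add: spP)
    ultimately show ?thesis
    proof eventually_elim
      case (elim x)
      then have "\<phi> (\<psi> x) = x" "\<psi> x \<notin> Y" by (auto simp: Z_def)
      then show ?case using Y(2)[of "\<psi> x"] by simp
    qed
  qed
  have kC: "(\<lambda>x. k (\<psi> x)) \<in> borel_measurable (completion P)" using kP by (rule measurable_completion)
  have hC: "h \<in> borel_measurable (completion P)"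
  proof (rule measurableI)
    fix A :: "real set" assume A: "A \<in> sets borel"
    show "h -` A \<inter> space (completion P) \<in> sets (completion P)"
    proof (rule completion.in_sets_AE)
      show "(\<lambda>x. k (\<psi> x)) -` A \<inter> space (completion P) \<in> sets (completion P)"
        using kC A by (rule measurable_sets)
      show "AE x in completion P. x \<in> (\<lambda>x. k (\<psi> x)) -` A \<inter> space (completion P) \<longleftrightarrow> x \<in> h -` A \<inter> space (completion P)"
        using AEC by eventually_elim auto
    qed auto
  qed auto
  have "integrable (completion P) h \<longleftrightarrow> integrable (completion P) (\<lambda>x. k (\<psi> x))"
    by (rule integrable_cong_AE[OF hC kC AEC])
  also have "\<dots> \<longleftrightarrow> integrable P (\<lambda>x. k (\<psi> x))" by (rule integrable_completion[OF kP])
  also have "\<dots> \<longleftrightarrow> integrable D (\<lambda>u. k (\<psi> (\<phi> u)))"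
    unfolding P_def using kP by (intro integrable_distr_eq[OF \<phi>N]) (simp add: P_def)
  also have "\<dots> \<longleftrightarrow> integrable lborel (\<lambda>u. \<rho> u * k u)"
    unfolding D_def \<psi>(2) using \<rho> by (subst integrable_density) auto
  finally show ?A by (simp add: vol)
  have "(\<integral>x. h x \<partial>completion P) = (\<integral>x. k (\<psi> x) \<partial>completion P)"
    by (rule integral_cong_AE[OF hC kC AEC])
  also have "\<dots> = (\<integral>x. k (\<psi> x) \<partial>P)" by (rule integral_completion[OF kP])
  also have "\<dots> = (\<integral>u. k (\<psi> (\<phi> u)) \<partial>D)"
    unfolding P_def using kP by (intro integral_distr[OF \<phi>N]) (simp add: P_def)
  also have "\<dots> = (\<integral>u. \<rho> u * k u \<partial>lborel)"
    unfolding D_def \<psi>(2) using \<rho> by (subst integral_density) auto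
  finally show ?B by (simp add: vol)
qed

section \<open>Separation of fibre and base coordinates\<close>

definition split7 :: "real^7 \<Rightarrow> quat \<times> (real^3)" where
  "split7 u = (fibre_part u, base_part u)"

definition join7 :: "quat \<times> (real^3) \<Rightarrow> real^7" where
  "join7 z = (\<chi> i. if i = 1 then fst (fst z) else if i = 2 then snd (fst z) $ 1
     else if i = 3 then snd (fst z) $ 2 else if i = 4 then snd (fst z) $ 3
     else if i = 5 then snd z $ 1 else if i = 6 then snd z $ 2 else snd z $ 3)"

lemma split7_join7 [simp]: "split7 (join7 z) = z"
  by (simp add: split7_def join7_def fibre_part_def base_part_def prod_eq_iff vec_eq_iff forall_3)

lemma join7_split7 [simp]: "join7 (split7 u) = u"
  by (simp add: split7_def join7_def fibre_part_def base_part_def vec_eq_iff forall_7)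

lemma bounded_linear_split7: "bounded_linear split7"
  unfolding split7_def[abs_def] using bounded_linear_fibre_part bounded_linear_base_part
  by (rule bounded_linear_Pair)

lemma bounded_linear_join7: "bounded_linear join7"
  unfolding linear_conv_bounded_linear[symmetric]
  by (intro linearI) (simp_all add: join7_def vec_eq_iff forall_7)

lemma continuous_on_split7: "continuous_on S split7" and continuous_on_join7: "continuous_on S' join7"
  by (simp_all add: linear_continuous_on bounded_linear_split7 bounded_linear_join7)

lemma prod_Basis_prod:
  fixes f :: "'a::euclidean_space \<times> 'b::euclidean_space \<Rightarrow> 'c::comm_monoid_mult"
  shows "prod f Basis = (\<Prod>i\<in>Basis. f (i, 0)) * (\<Prod>i\<in>Basis. f (0, i))"
proof -
  have "inj_on (\<lambda>u. (u::'a, 0::'b)) Basis" "inj_on (\<lambda>u. (0::'a, u::'b)) Basis"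
    by (auto intro!: inj_onI Pair_inject)
  then show ?thesis
    unfolding Basis_prod_def
    by (subst prod.union_disjoint) (auto simp: Basis_prod_def prod.reindex)
qed

lemma lborel_split7: "distr lborel borel split7 = (lborel :: (quat \<times> (real^3)) measure)"
proof (rule lborel_eqI[symmetric])
  have [measurable]: "split7 \<in> borel_measurable borel"
    by (intro borel_measurable_continuous_onI continuous_on_split7)
  fix l u :: "quat \<times> (real^3)" assume lu: "\<And>b. b \<in> Basis \<Longrightarrow> l \<bullet> b \<le> u \<bullet> b"
  have vim: "split7 -` box l u = box (join7 l) (join7 u)"
    unfolding set_eq_iff mem_box_cart vimage_eq
    by (cases l; cases u)
      (auto simp: split7_def join7_def fibre_part_def base_part_def forall_7 forall_3 box_prod mem_box_cart
        mem_box Basis_prod_def Basis_vec_def)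
  have ord: "join7 l \<bullet> b \<le> join7 u \<bullet> b" if "b \<in> Basis" for b
  proof -
    have 1: "fst (fst l) \<le> fst (fst u)" "snd (fst l) $ i \<le> snd (fst u) $ i" "snd l $ i \<le> snd u $ i" for i
      using lu[of "((1, 0), 0)"] lu[of "((0, axis i 1), 0)"] lu[of "(0, axis i 1)"]
      by (auto simp: Basis_prod_def inner_prod_def inner_axis zero_prod_def)
    have "\<forall>i. join7 l $ i \<le> join7 u $ i"
      unfolding forall_7 by (simp add: join7_def 1)
    then show ?thesis using that by (auto simp: Basis_vec_def inner_axis)
  qed
  have "emeasure (distr lborel borel split7) (box l u) = emeasure lborel (box (join7 l) (join7 u))"
    by (subst emeasure_distr) (simp_all add: vim)
  also have "\<dots> = (\<Prod>b\<in>Basis. (join7 u - join7 l) \<bullet> b)"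
    using ord by (simp add: emeasure_lborel_box)
  also have "(\<Prod>b\<in>Basis. (join7 u - join7 l) \<bullet> b) = (\<Prod>i\<in>UNIV. (join7 u - join7 l) $ i)"
  proof -
    have b7: "(Basis :: (real^7) set) = (\<lambda>i. axis i 1) ` UNIV" by (auto simp: Basis_vec_def)
    have i7: "inj (\<lambda>i::7. axis i (1::real))" by (auto simp: inj_def axis_eq_axis)
    show ?thesis unfolding b7 by (subst prod.reindex[OF i7]) (simp add: inner_axis)
  qed
  also have "\<dots> = (\<Prod>b\<in>Basis. (u - l) \<bullet> b)"
  proof -
    have b3: "(Basis :: (real^3) set) = (\<lambda>i. axis i 1) ` UNIV" by (auto simp: Basis_vec_def)
    have i3: "inj (\<lambda>i::3. axis i (1::real))" by (auto simp: inj_def axis_eq_axis)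
    have p3: "prod f (Basis :: (real^3) set) = f (axis 1 1) * f (axis 2 1) * f (axis 3 1)" for f :: "real^3 \<Rightarrow> real"
      unfolding b3 using i3 by (simp add: prod.reindex prod_3)
    show ?thesis
      by (simp add: prod_Basis_prod p3 prod_7 join7_def inner_prod_def inner_axis)
  qed
  finally show "emeasure (distr lborel borel split7) (box l u) = ennreal (\<Prod>b\<in>Basis. (u - l) \<bullet> b)" .
qed simp

lemma integral_split7:
  fixes G :: "quat \<times> (real^3) \<Rightarrow> real"
  assumes "G \<in> borel_measurable borel"
  shows "integrable lborel (\<lambda>u. G (split7 u)) \<longleftrightarrow> integrable lborel G"
    and "(\<integral>u. G (split7 u) \<partial>lborel) = (\<integral>z. G z \<partial>lborel)"
proof -
  have m: "split7 \<in> measurable lborel borel"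
    using borel_measurable_continuous_onI[OF continuous_on_split7] by simp
  show "integrable lborel (\<lambda>u. G (split7 u)) \<longleftrightarrow> integrable lborel G"
    using integrable_distr_eq[OF m assms] by (simp add: lborel_split7)
  show "(\<integral>u. G (split7 u) \<partial>lborel) = (\<integral>z. G z \<partial>lborel)"
    using integral_distr[OF m assms] by (simp add: lborel_split7)
qed

definition stereo_inv :: "quat \<Rightarrow> real^3" where
  "stereo_inv q = (1 / (1 - fst q)) *\<^sub>R snd q"

lemma stereo_inv_stereo [simp]: "stereo_inv (stereo y) = y"
proof -
  define N where "N = (norm y)\<^sup>2 + 1"
  have N: "N > 0" unfolding N_def by (rule norm_square_plus_1_pos)
  have a: "1 / (1 - (N - 2) / N) * (2 / N) = 1" using N by (simp add: field_simps)
  have b: "(norm y)\<^sup>2 - 1 = N - 2" by (simp add: N_def)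
  show ?thesis
    unfolding stereo_inv_def stereo_def fst_conv snd_conv scaleR_scaleR N_def[symmetric] b a by simp
qed

lemma borel_measurable_stereo_inv [measurable]: "stereo_inv \<in> borel_measurable borel"
proof -
  have "(\<lambda>q::quat. fst q) \<in> borel_measurable borel" "(\<lambda>q::quat. snd q) \<in> borel_measurable borel"
    by (intro borel_measurable_continuous_onI continuous_intros)+
  then show ?thesis unfolding stereo_inv_def[abs_def] by measurable
qed

lemma continuous_on_stereo: "continuous_on S stereo"
  using smooth_on_imp_continuous_on[OF smooth_on_stereo] by (rule continuous_on_subset) simp

lemma continuous_on_sphere_density: "continuous_on S sphere_density"
  unfolding sphere_density_def[abs_def] 
  by (intro continuous_intros) (simp add: less_imp_neq[OF norm_square_plus_1_pos, symmetric])

lemma continuous_on_r_of_t_norm: "continuous_on S (\<lambda>p::'a::real_normed_vector. r_of_t (norm p))"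
  and continuous_on_fibre_density_norm: "continuous_on S (\<lambda>p::'a::real_normed_vector. fibre_density (norm p))"
  by (rule continuous_on_compose2[OF continuous_on_r_of_t] continuous_on_compose2[OF continuous_on_fibre_density];
      auto intro: continuous_intros)+

lemma borel_measurable_excess [measurable]: "excess e \<in> borel_measurable borel"
  unfolding excess_def excess_defs by measurable

section \<open>Integrability of the excess\<close>

definition excess_fibre :: "real \<Rightarrow> quat \<Rightarrow> real" where
  "excess_fibre e p = excess e (r_of_t (norm p)) * fibre_density (norm p)"

lemma borel_measurable_excess_fibre [measurable]: "excess_fibre e \<in> borel_measurable borel"
proof -
  have [measurable]: "(\<lambda>p::quat. r_of_t (norm p)) \<in> borel_measurable borel"
    "(\<lambda>p::quat. fibre_density (norm p)) \<in> borel_measurable borel"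
    by (intro borel_measurable_continuous_onI continuous_on_r_of_t_norm continuous_on_fibre_density_norm)+
  show ?thesis unfolding excess_fibre_def[abs_def] by measurable
qed

text \<open>The product C r^-8 * 8 r^3 is of order r^-5, and sqrt (1 + t^2) <= 2 r contributes 2^5 =
  32, whence 256 = 8 * 32. The constant depends on e; only integrability at fixed \<open>x1\<close>
  uses it.\<close>

lemma excess_fibre_le_majorant:
  assumes "e > 0"
  obtains C where "C > 0" "\<And>p. \<bar>excess_fibre e p\<bar> \<le> C * majorant p"
proof -
  obtain C where C: "C > 0" "\<And>r. r \<ge> 1 \<Longrightarrow> \<bar>excess e r\<bar> \<le> C / r ^ 8"
    using excess_decay[OF assms] by blast
  show ?thesis
  proof (rule that[of "256 * C"])
    fix p :: quat
    define t r m where "t = norm p" and "r = r_of_t t" and "m = sqrt (1 + t\<^sup>2)"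
    have r: "r \<ge> 1" by (simp add: r_def t_def r_of_t_ge_1)
    have m: "m > 0" by (simp add: m_def add_pos_nonneg)
    have "1 + t\<^sup>2 \<le> (2 * r)\<^sup>2" using r_square_ge(1)[of t] by (simp add: r_def t_def power_mult_distrib)
    then have "m \<le> 2 * r" using r unfolding m_def by (intro real_le_lsqrt) auto
    then have "m ^ 5 \<le> (2 * r) ^ 5" using m by (intro power_mono) auto
    then have m5: "1 / r ^ 5 \<le> 32 / m ^ 5" using r m by (simp add: field_simps power_mult_distrib)
    have "\<bar>excess_fibre e p\<bar> = \<bar>excess e r\<bar> * fibre_density t"
      using fibre_density_nonneg[of t] by (simp add: excess_fibre_def abs_mult r_def t_def)
    also have "\<dots> \<le> (C / r ^ 8) * (8 * r ^ 3)"
      using C(2)[OF r] fibre_density_le[of t] fibre_density_nonneg[of t] C(1) r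
      by (intro mult_mono) (auto simp: t_def r_def)
    also have "\<dots> = 8 * C * (1 / r ^ 5)"
      using r by (simp add: field_simps flip: power_add)
    also have "\<dots> \<le> 8 * C * (32 / m ^ 5)" using m5 C(1) by (intro mult_left_mono) auto
    also have "\<dots> = 256 * C * majorant p"
    proof -
      have "majorant p = (m powr 2) powr (- 5 / 2)"
        using m by (simp add: majorant_def m_def t_def powr_numeral add_nonneg_nonneg)
      also have "\<dots> = m powr (- 5)" by (simp add: powr_powr)
      also have "\<dots> = 1 / m ^ 5" using m by (simp add: powr_minus_divide powr_numeral)
      finally show ?thesis by simp
    qed
    finally show "\<bar>excess_fibre e p\<bar> \<le> 256 * C * majorant p" .
  qed (use C in simp)
qed

lemma sphere_density_le: "sphere_density y \<le> 8 * majorant y"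
proof -
  define n where "n = 1 + (norm y)\<^sup>2"
  have n: "n \<ge> 1" by (simp add: n_def)
  have "sphere_density y = 8 * n powr (- 3)"
    using n by (simp add: sphere_density_def n_def power_divide powr_minus_divide powr_numeral add.commute)
  also have "\<dots> \<le> 8 * n powr (- 5 / 2)"
    using n by (intro mult_left_mono powr_mono) auto
  finally show ?thesis by (simp add: majorant_def n_def)
qed

lemma integrable_sphere_density: "integrable lborel sphere_density"
proof (rule Bochner_Integration.integrable_bound)
  show "integrable lborel (\<lambda>y::real^3. 8 * majorant y)"
    by (intro integrable_mult_right integrable_majorant) simp
  show "AE y in lborel. norm (sphere_density y) \<le> norm (8 * majorant y)"
  proof (rule AE_I2)
    fix y :: "real^3"
    show "norm (sphere_density y) \<le> norm (8 * majorant y)"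
      using sphere_density_le[of y] sphere_density_pos[of y] majorant_pos[of y] by simp
  qed
  show "sphere_density \<in> borel_measurable lborel"
    using borel_measurable_continuous_onI[OF continuous_on_sphere_density] by simp
qed

lemma integrable_product:
  fixes f :: "'a::euclidean_space \<Rightarrow> real" and g :: "'b::euclidean_space \<Rightarrow> real"
  assumes f: "integrable lborel f" and g: "integrable lborel g"
  shows "integrable (lborel :: ('a \<times> 'b) measure) (\<lambda>z. f (fst z) * g (snd z))"
proof -
  have [measurable]: "f \<in> borel_measurable borel" "g \<in> borel_measurable borel"
    using borel_measurable_integrable[OF f] borel_measurable_integrable[OF g] by simp_all
  have "integrable (lborel \<Otimes>\<^sub>M lborel) (\<lambda>z::'a \<times> 'b. f (fst z) * g (snd z))"
  proof (rule lborel_pair.Fubini_integrable)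
    show "(\<lambda>z. f (fst z) * g (snd z)) \<in> borel_measurable (lborel \<Otimes>\<^sub>M lborel)" by measurable
    show "integrable lborel (\<lambda>x. \<integral>y. norm (f (fst (x, y)) * g (snd (x, y))) \<partial>lborel)"
      using f by (simp add: abs_mult)
    show "AE x in lborel. integrable lborel (\<lambda>y. f (fst (x, y)) * g (snd (x, y)))"
      using g by simp
  qed
  then show ?thesis by (simp add: lborel_prod)
qed

text \<open>The zero fibre lies in the hyperplane where the first coordinate vanishes, which is
  already a null set.\<close>

lemma AE_fibre_part_nonzero: "AE u in lborel. fibre_part u \<noteq> 0"
proof -
  have "negligible {u::real^7. axis 1 1 \<bullet> u = 0}" by (intro negligible_hyperplane) simp
  then have "negligible {u::real^7. u $ 1 = 0}" by (simp add: inner_axis inner_commute)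
  moreover have "closed {u::real^7. u $ 1 = 0}" by (intro closed_Collect_eq continuous_intros)
  ultimately have "{u::real^7. u $ 1 = 0} \<in> null_sets lborel"
    by (simp add: negligible_iff_null_sets null_sets_completion_iff borel_closed)
  then have "AE u::real^7 in lborel. u \<notin> {u. u $ 1 = 0}" by (rule AE_not_in)
  then show ?thesis by eventually_elim (auto simp: fibre_part_def zero_prod_def)
qed

lemma integrable_excess_product:
  fixes \<Phi> :: "quat \<times> (real^3) \<Rightarrow> real"
  assumes e: "e > 0" and \<Phi>: "\<Phi> \<in> borel_measurable borel" "\<And>z. \<bar>\<Phi> z\<bar> \<le> K"
  shows "integrable lborel (\<lambda>z. \<Phi> z * excess_fibre e (fst z) * sphere_density (snd z))"
proof -
  obtain C where C: "C > 0" "\<And>p. \<bar>excess_fibre e p\<bar> \<le> C * majorant p"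
    using excess_fibre_le_majorant[OF e] by blast
  have [measurable]: "fst \<in> borel_measurable (borel :: (quat \<times> (real^3)) measure)"
    "snd \<in> borel_measurable (borel :: (quat \<times> (real^3)) measure)"
    by (intro borel_measurable_continuous_onI continuous_intros)+
  have [measurable]: "sphere_density \<in> borel_measurable borel"
    by (intro borel_measurable_continuous_onI continuous_on_sphere_density)
  note [measurable] = \<Phi>(1)
  have "integrable (lborel :: (quat \<times> (real^3)) measure) (\<lambda>z. (K * C * majorant (fst z)) * sphere_density (snd z))"
    by (intro integrable_product integrable_mult_right integrable_majorant integrable_sphere_density) simp
  then show ?thesis
  proof (rule Bochner_Integration.integrable_bound)
    show "AE z in lborel. norm (\<Phi> z * excess_fibre e (fst z) * sphere_density (snd z))
        \<le> norm (K * C * majorant (fst z) * sphere_density (snd z))"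
    proof (rule AE_I2)
      fix z :: "quat \<times> (real^3)"
      have K: "K \<ge> 0" using \<Phi>(2)[of z] by linarith
      have "\<bar>\<Phi> z\<bar> * \<bar>excess_fibre e (fst z)\<bar> \<le> K * (C * majorant (fst z))"
        using \<Phi>(2) C(2) K by (intro mult_mono) auto
      then have "\<bar>\<Phi> z\<bar> * \<bar>excess_fibre e (fst z)\<bar> * sphere_density (snd z)
          \<le> K * (C * majorant (fst z)) * sphere_density (snd z)"
        using sphere_density_pos[of "snd z"] by (intro mult_right_mono) auto
      then show "norm (\<Phi> z * excess_fibre e (fst z) * sphere_density (snd z))
        \<le> norm (K * C * majorant (fst z) * sphere_density (snd z))"
        using K C(1) majorant_pos[of "fst z"] sphere_density_pos[of "snd z"]
        by (simp add: abs_mult mult_ac)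
    qed
    show "(\<lambda>z. \<Phi> z * excess_fibre e (fst z) * sphere_density (snd z)) \<in> borel_measurable lborel"
      by measurable
  qed
qed

lemma M_borel: "M \<in> sets borel" "sing_orbit \<in> sets borel"
  unfolding M_def sing_orbit_def by (intro borel_closed closed_Times closed_UNIV closed_sphere closed_singleton)+

text \<open>Stated for functions that are bounded and continuous in the chart, it serves twice: with
  the constant 1 for integrability, and with test functions for the limit.\<close>

lemma vol_M_integral:
  fixes f :: "quat \<times> quat \<Rightarrow> real"
  assumes x1: "x1 > 0"
    and f: "continuous_on UNIV (\<lambda>z::quat \<times> (real^3). f (fst z, stereo (snd z)))"
      "\<And>z::quat \<times> (real^3). \<bar>f (fst z, stereo (snd z))\<bar> \<le> K"
  shows "integrable vol_M (\<lambda>x. f x * (curv_norm2 (A_clarke x1) x - curv_norm2 A_lim x))"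
    and "(\<integral>x. f x * (curv_norm2 (A_clarke x1) x - curv_norm2 A_lim x) \<partial>vol_M) =
      (\<integral>z. f (fst z, stereo (snd z)) * excess_fibre (3 / x1) (fst z) * sphere_density (snd z) \<partial>lborel)"
proof -
  let ?\<Phi> = "\<lambda>z::quat \<times> (real^3). f (fst z, stereo (snd z))"
  define k where "k = (\<lambda>u. ?\<Phi> (split7 u) * excess (3 / x1) (r_of_t (norm (fibre_part u))))"
  define \<psi> where "\<psi> = (\<lambda>x::quat \<times> quat. join7 (fst x, stereo_inv (snd x)))"
  define G where "G = (\<lambda>z::quat \<times> (real^3). ?\<Phi> z * excess_fibre (3 / x1) (fst z) * sphere_density (snd z))"
  have \<rho>: "volume_density bs_metric param_M = (\<lambda>u. fibre_density (norm (fibre_part u)) * sphere_density (base_part u))"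
    by (simp add: volume_density_param_M fun_eq_iff)
  have \<Phi>m [measurable]: "?\<Phi> \<in> borel_measurable borel" by (rule borel_measurable_continuous_onI[OF f(1)])
  have [measurable]: "split7 \<in> borel_measurable borel" "join7 \<in> borel_measurable borel"
    by (intro borel_measurable_continuous_onI continuous_on_split7 continuous_on_join7)+
  have [measurable]: "fst \<in> borel_measurable (borel :: (quat \<times> (real^3)) measure)"
    "snd \<in> borel_measurable (borel :: (quat \<times> (real^3)) measure)"
    "fst \<in> borel_measurable (borel :: (quat \<times> quat) measure)"
    "snd \<in> borel_measurable (borel :: (quat \<times> quat) measure)"
    by (intro borel_measurable_continuous_onI continuous_intros)+
  have [measurable]: "sphere_density \<in> borel_measurable borel"
    by (intro borel_measurable_continuous_onI continuous_on_sphere_density)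
  have cfp: "continuous_on UNIV fibre_part" "continuous_on UNIV base_part"
    by (simp_all add: linear_continuous_on bounded_linear_fibre_part bounded_linear_base_part)
  have [measurable]: "(\<lambda>u. r_of_t (norm (fibre_part u))) \<in> borel_measurable borel"
    by (intro borel_measurable_continuous_onI continuous_on_compose2[OF continuous_on_r_of_t_norm cfp(1)]) auto
  have Gm: "G \<in> borel_measurable borel" unfolding G_def by measurable
  have eq: "volume_density bs_metric param_M u * k u = G (split7 u)" for u
    by (simp add: \<rho> k_def G_def split7_def excess_fibre_def)
  have r1: "range param_M \<subseteq> M" by (auto simp: param_M_eq M_def norm_stereo)
  have r2: "param_M \<in> borel_measurable borel"
    unfolding param_M_eq[abs_def]
    by (intro borel_measurable_continuous_onI continuous_on_Pair cfp continuous_on_compose2[OF continuous_on_stereo cfp(2)]) auto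
  have r3: "volume_density bs_metric param_M \<in> borel_measurable borel"
    unfolding \<rho>
    by (intro borel_measurable_continuous_onI continuous_on_mult
        continuous_on_compose2[OF continuous_on_fibre_density_norm cfp(1)]
        continuous_on_compose2[OF continuous_on_sphere_density cfp(2)]) auto
  have r4: "volume_density bs_metric param_M u \<ge> 0" for u
    by (simp add: \<rho> fibre_density_nonneg less_imp_le[OF sphere_density_pos])
  have r5: "\<psi> \<in> borel_measurable borel" unfolding \<psi>_def by measurable
  have r6: "\<psi> (param_M u) = u" for u
    using join7_split7 by (simp add: \<psi>_def param_M_eq split7_def)
  have r7: "k \<in> borel_measurable borel" unfolding k_def by measurable
  have r8: "AE u in lborel. f (param_M u) * (curv_norm2 (A_clarke x1) (param_M u) - curv_norm2 A_lim (param_M u)) = k u"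
    using AE_fibre_part_nonzero
  proof eventually_elim
    case (elim u)
    then have "r_of_t (norm (fibre_part u)) > 1" by (intro r_of_t_gt_1) simp
    with elim x1 show ?case
      by (simp add: k_def param_M_eq split7_def curv_norm2_clarke curv_norm2_lim norm_stereo excess_eq)
  qed
  note pv = param_volume_integral[OF M_borel(1) r1 r2 r3 r4 r5 r6 r7 r8, folded vol_M_def]
  have "integrable lborel G"
    unfolding G_def using x1 by (intro integrable_excess_product[OF _ \<Phi>m f(2)]) simp
  then show "integrable vol_M (\<lambda>x. f x * (curv_norm2 (A_clarke x1) x - curv_norm2 A_lim x))"
    unfolding pv eq integral_split7[OF Gm] .
  show "(\<integral>x. f x * (curv_norm2 (A_clarke x1) x - curv_norm2 A_lim x) \<partial>vol_M) =
      (\<integral>z. f (fst z, stereo (snd z)) * excess_fibre (3 / x1) (fst z) * sphere_density (snd z) \<partial>lborel)"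
    unfolding pv eq integral_split7[OF Gm] by (simp add: G_def)
qed

lemma vol_sing_integral:
  fixes f :: "quat \<times> quat \<Rightarrow> real"
  assumes "continuous_on UNIV (\<lambda>y::real^3. f (0, stereo y))"
  shows "(\<integral>x. f x \<partial>vol_sing) = (\<integral>y. fibre_density 0 * sphere_density y * f (0, stereo y) \<partial>lborel)"
proof -
  have \<rho>: "volume_density bs_metric param_sing = (\<lambda>y. fibre_density 0 * sphere_density y)"
    by (simp add: volume_density_param_sing fun_eq_iff)
  have "(\<integral>x. f x \<partial>vol_sing) = (\<integral>y. volume_density bs_metric param_sing y * f (0, stereo y) \<partial>lborel)"
    unfolding vol_sing_def
  proof (rule param_volume_integral(2)[where \<psi> = "\<lambda>x. stereo_inv (snd x)"])
    show "range param_sing \<subseteq> sing_orbit" by (auto simp: param_sing_def sing_orbit_def norm_stereo)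
    show "param_sing \<in> borel_measurable borel"
      unfolding param_sing_def[abs_def]
      by (intro borel_measurable_continuous_onI continuous_on_Pair continuous_on_const continuous_on_stereo)
    show "volume_density bs_metric param_sing \<in> borel_measurable borel"
      unfolding \<rho> by (intro borel_measurable_continuous_onI continuous_on_mult continuous_on_const continuous_on_sphere_density)
    show "\<And>u. volume_density bs_metric param_sing u \<ge> 0"
      by (simp add: \<rho> fibre_density_nonneg less_imp_le[OF sphere_density_pos])
    have [measurable]: "snd \<in> borel_measurable (borel :: (quat \<times> quat) measure)"
      by (intro borel_measurable_continuous_onI continuous_intros)
    show "(\<lambda>x::quat \<times> quat. stereo_inv (snd x)) \<in> borel_measurable borel" by measurable
    show "(\<lambda>y. f (0, stereo y)) \<in> borel_measurable borel" by (rule borel_measurable_continuous_onI[OF assms])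
  qed (auto simp: param_sing_def M_borel)
  then show ?thesis by (simp add: \<rho>)
qed

section \<open>Concentration of the curvature\<close>

text \<open>For t^2 = e s^2 the denominator r^2 - 1 + e equals e X with X tending to 1 + 3/2 s^2.
  Then e^2 * excess is X^-2 (X^-2 quad + e lin), and the cross term drops out.\<close>

lemma scaled_excess_tendsto:
  assumes s: "s \<ge> 0"
  shows "((\<lambda>e. e\<^sup>2 * excess e (r_of_t (sqrt e * s))) \<longlongrightarrow> 108 / (1 + 3 / 2 * s\<^sup>2) ^ 4) (at_right 0)"
proof -
  let ?F = "at_right (0::real)"
  define r X where "r = (\<lambda>e. 1 + tsq_inv (e * s\<^sup>2))" and "X = (\<lambda>e. 1 + 3 * (s\<^sup>2 * B1q (e * s\<^sup>2)))"
  define E where "E = (\<lambda>e. 1 / (X e)\<^sup>2 * (1 / (X e)\<^sup>2 * quad e (r e) + e * lin e (r e)))"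
  have e0: "((\<lambda>e. e) \<longlongrightarrow> 0) ?F" by (rule tendsto_ident_at)
  have es: "((\<lambda>e. e * s\<^sup>2) \<longlongrightarrow> 0) ?F" by (rule tendsto_eq_intros e0 refl | simp)+
  have "isCont tsq_inv 0" by (intro isCont_tsq_inv tsq_range_nonneg) simp
  from isCont_tendsto_compose[OF this es] have rl: "(r \<longlongrightarrow> 1) ?F"
    unfolding r_def by (auto intro!: tendsto_eq_intros simp: tsq_inv_0)
  have "isCont B1q 0"
    using smooth_on_imp_continuous_on[OF smooth_on_B1q] open_tsq_range tsq_range_nonneg[of 0]
    by (simp add: continuous_on_eq_continuous_at)
  from isCont_tendsto_compose[OF this es] have Xl: "(X \<longlongrightarrow> 1 + 3 / 2 * s\<^sup>2) ?F"
    unfolding X_def by (auto intro!: tendsto_eq_intros simp: B1q_0)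
  have pos: "1 + 3 / 2 * s\<^sup>2 > 0" by (simp add: add_pos_nonneg)
  have ql: "((\<lambda>e. quad e (r e)) \<longlongrightarrow> quad 0 1) ?F" "((\<lambda>e. lin e (r e)) \<longlongrightarrow> lin 0 1) ?F"
    unfolding excess_defs by (intro tendsto_intros e0 rl; simp)+
  have "(E \<longlongrightarrow> 1 / (1 + 3 / 2 * s\<^sup>2)\<^sup>2 * (1 / (1 + 3 / 2 * s\<^sup>2)\<^sup>2 * quad 0 1 + 0 * lin 0 1)) ?F"
    unfolding E_def using pos by (intro tendsto_intros e0 Xl ql) auto
  \<comment> \<open>At (0, 1) the three numerators are 3, -3 and 0: equal size in the first two
    reflects anti-self-duality on the fibre, and the vanishing third one the absence of curvature
    along the base. Hence 6 * 18.\<close>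
  moreover have "quad 0 1 = 108" by (simp add: excess_defs)
  moreover have "1 / a\<^sup>2 * (1 / a\<^sup>2 * 108 + 0 * b) = 108 / a ^ 4" for a b :: real
    by (simp add: power2_eq_square power4_eq_xxxx)
  ultimately have El: "(E \<longlongrightarrow> 108 / (1 + 3 / 2 * s\<^sup>2) ^ 4) ?F" by (simp only:)
  show ?thesis
  proof (rule Lim_transform_eventually[OF El])
    show "\<forall>\<^sub>F e in ?F. E e = e\<^sup>2 * excess e (r_of_t (sqrt e * s))"
      using eventually_at_right_less[of 0]
    proof eventually_elim
      case (elim e)
      define t where "t = sqrt e * s"
      have t: "t \<ge> 0" "t\<^sup>2 = e * s\<^sup>2" using elim s by (auto simp: t_def power_mult_distrib)
      have rt: "r_of_t t = r e" using t by (simp add: r_of_t_eq r_def)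
      have "(r e)\<^sup>2 - 1 = 3 * (t\<^sup>2 * B1q (t\<^sup>2))"
        using B1_square[OF t(1)] by (simp add: B1_def rt power_divide)
      then have D: "(r e)\<^sup>2 - 1 + e = e * X e" by (simp add: X_def t(2) algebra_simps)
      have "B1q (e * s\<^sup>2) > 0" using elim by (intro B1q_pos tsq_range_nonneg) simp
      then have X: "X e > 0" by (simp add: X_def add_pos_nonneg)
      have "e\<^sup>2 * (e / (e * X e)\<^sup>2 * (e / (e * X e)\<^sup>2 * Q + L)) = 1 / (X e)\<^sup>2 * (1 / (X e)\<^sup>2 * Q + e * L)" for Q L
        using elim X by (simp add: field_simps power2_eq_square)
      then show ?case
        unfolding t_def[symmetric] rt E_def excess_def D by (rule sym)
    qed
  qed
qed

text \<open>In e^2 x (x + 1) = (e x)^2 + e (e x) the first term is bounded by n^-4 up to a constant,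
  with n = 1 + |p|^2. The second gets its third power of 1 / n from the restriction to |sqrt e p| <=
  T0, which holds on the support of a test function.\<close>

lemma scaled_excess_bound:
  fixes T0 :: real
  obtains C where "C > 0" "\<And>e p. \<lbrakk>0 < e; e \<le> 1; norm (sqrt e *\<^sub>R (p::quat)) \<le> T0\<rbrakk> \<Longrightarrow>
    \<bar>e\<^sup>2 * excess_fibre e (sqrt e *\<^sub>R p)\<bar> \<le> C * majorant p"
proof -
  have "bounded (r_of_t ` {0..T0})" "bounded (fibre_density ` {0..T0})"
    by (intro compact_imp_bounded compact_continuous_image continuous_on_subset[OF continuous_on_r_of_t]
        continuous_on_subset[OF continuous_on_fibre_density]; auto)+
  then obtain R0 B where R0: "\<And>t. t \<in> {0..T0} \<Longrightarrow> \<bar>r_of_t t\<bar> \<le> R0" and B: "B > 0" "\<And>t. t \<in> {0..T0} \<Longrightarrow> \<bar>fibre_density t\<bar> \<le> B"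
    unfolding bounded_pos by (metis imageI real_norm_def)
  obtain C where C: "C > 0" "\<And>e r. \<lbrakk>0 < e; e \<le> 1; 1 \<le> r; r \<le> max 1 R0\<rbrakk> \<Longrightarrow>
     \<bar>excess e r\<bar> \<le> C * ((e / (r\<^sup>2 - 1 + e)\<^sup>2) * (e / (r\<^sup>2 - 1 + e)\<^sup>2 + 1))"
    using excess_local[of "max 1 R0"] by auto
  define C' where "C' = C * (256 + 16 * (1 + T0\<^sup>2)) * B"
  show ?thesis
  proof (rule that[of C'])
    show "C' > 0" using C(1) B(1) by (simp add: C'_def add_pos_nonneg)
    fix e :: real and p :: quat
    assume e: "0 < e" "e \<le> 1" and T0: "norm (sqrt e *\<^sub>R p) \<le> T0"
    define t n r where "t = norm (sqrt e *\<^sub>R p)" and "n = 1 + (norm p)\<^sup>2" and "r = r_of_t t"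
    have t: "t \<in> {0..T0}" using T0 by (simp add: t_def)
    have n: "n \<ge> 1" by (simp add: n_def)
    have t2: "t\<^sup>2 = e * (norm p)\<^sup>2" using e by (simp add: t_def power_mult_distrib)
    have r: "1 \<le> r" "r \<le> max 1 R0"
      using r_of_t_ge_1[of t] R0[OF t] t by (auto simp: r_def)
    define x where "x = e / (r\<^sup>2 - 1 + e)\<^sup>2"
    \<comment> \<open>This yields e x <= 16 / n^2, the source of 16 and of 256 = 16^2 in the
      constant.\<close>
    have "e * n / 4 \<le> r\<^sup>2 - 1 + e"
    proof -
      have "e * n / 4 = e / 4 + t\<^sup>2 / 4" by (simp add: n_def t2 algebra_simps add_divide_distrib)
      then show ?thesis using r_square_ge(2)[of t] e t unfolding r_def[symmetric] by simp
    qed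
    then have "(e * n / 4)\<^sup>2 \<le> (r\<^sup>2 - 1 + e)\<^sup>2" using e n by (intro power_mono) auto
    then have "e / (r\<^sup>2 - 1 + e)\<^sup>2 \<le> e / (e * n / 4)\<^sup>2"
      using e n by (intro divide_left_mono mult_pos_pos zero_less_power excess_denominator r) auto
    then have "x \<le> e / (e * n / 4)\<^sup>2" by (simp add: x_def)
    also have "\<dots> = 16 / (e * n\<^sup>2)" using e n by (simp add: field_simps power2_eq_square)
    finally have ex: "e * x \<le> 16 / n\<^sup>2"
      using e n mult_left_mono[of x "16 / (e * n\<^sup>2)" e] by simp
    have x0: "e * x \<ge> 0" using e by (simp add: x_def)
    \<comment> \<open>On the bounded region the loose factor e is worth (1 + T0^2) / n.\<close>
    have "e * n \<le> 1 + T0\<^sup>2"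
    proof -
      have "t\<^sup>2 \<le> T0\<^sup>2" using t by (intro power_mono) auto
      then show ?thesis using e(2) t2 by (simp add: n_def algebra_simps)
    qed
    then have en: "e \<le> (1 + T0\<^sup>2) / n" using n by (simp add: le_divide_eq)
    have "e\<^sup>2 * (x * (x + 1)) = (e * x) * (e * x) + e * (e * x)"
      by (simp add: power2_eq_square algebra_simps)
    also have "\<dots> \<le> (16 / n\<^sup>2) * (16 / n\<^sup>2) + ((1 + T0\<^sup>2) / n) * (16 / n\<^sup>2)"
      using ex x0 en e n by (intro add_mono mult_mono) auto
    also have "\<dots> = 256 / n ^ 4 + 16 * (1 + T0\<^sup>2) / n ^ 3"
      by (simp add: power2_eq_square power3_eq_cube power4_eq_xxxx mult_ac)
    also have "\<dots> \<le> 256 / n ^ 3 + 16 * (1 + T0\<^sup>2) / n ^ 3"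
      using n by (intro add_right_mono divide_left_mono power_increasing) auto
    also have "\<dots> = (256 + 16 * (1 + T0\<^sup>2)) * (1 / n ^ 3)" by (simp add: add_divide_distrib)
    also have "\<dots> \<le> (256 + 16 * (1 + T0\<^sup>2)) * majorant p"
    proof (rule mult_left_mono)
      have "1 / n ^ 3 = n powr (- 3)" using n by (simp add: powr_minus_divide powr_numeral)
      also have "\<dots> \<le> n powr (- 5 / 2)" using n by (intro powr_mono) auto
      finally show "1 / n ^ 3 \<le> majorant p" by (simp add: majorant_def n_def)
    qed (simp add: add_nonneg_nonneg)
    finally have m: "e\<^sup>2 * (x * (x + 1)) \<le> (256 + 16 * (1 + T0\<^sup>2)) * majorant p" .
    have "\<bar>e\<^sup>2 * excess_fibre e (sqrt e *\<^sub>R p)\<bar> = (e\<^sup>2 * \<bar>excess e r\<bar>) * \<bar>fibre_density t\<bar>"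
      using e by (simp add: excess_fibre_def abs_mult r_def t_def)
    also have "\<dots> \<le> (e\<^sup>2 * (C * (x * (x + 1)))) * B"
    proof (rule mult_mono)
      show "e\<^sup>2 * \<bar>excess e r\<bar> \<le> e\<^sup>2 * (C * (x * (x + 1)))"
        using C(2)[OF e r] unfolding x_def by (intro mult_left_mono) auto
      have "0 \<le> x" using e by (simp add: x_def)
      then show "0 \<le> e\<^sup>2 * (C * (x * (x + 1)))" using C(1) by simp
    qed (use B t in auto)
    also have "\<dots> = C * B * (e\<^sup>2 * (x * (x + 1)))" by simp
    also have "\<dots> \<le> C * B * ((256 + 16 * (1 + T0\<^sup>2)) * majorant p)"
      using m C(1) B(1) by (intro mult_left_mono) auto
    finally show "\<bar>e\<^sup>2 * excess_fibre e (sqrt e *\<^sub>R p)\<bar> \<le> C' * majorant p"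
      by (simp add: C'_def mult_ac)
  qed
qed

lemma integral_scale:
  fixes G :: "'a::euclidean_space \<Rightarrow> real"
  assumes G: "G \<in> borel_measurable borel" and c: "c > 0"
  shows "(\<integral>p. G p \<partial>lborel) = (\<integral>p. c ^ DIM('a) * G (c *\<^sub>R p) \<partial>lborel)"
proof -
  have "(lborel :: 'a measure) = density (distr lborel borel (\<lambda>x. 0 + c *\<^sub>R x)) (\<lambda>_. ennreal (\<bar>c\<bar> ^ DIM('a)))"
    using c by (intro lborel_affine) simp
  then have "(\<integral>p. G p \<partial>lborel) = (\<integral>p. G p \<partial>density (distr lborel borel (\<lambda>x. c *\<^sub>R x)) (\<lambda>_. ennreal (c ^ DIM('a))))"
    using c by simp
  also have "\<dots> = (\<integral>p. c ^ DIM('a) * G p \<partial>distr lborel borel (\<lambda>x. c *\<^sub>R x))"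
    using G c by (subst integral_density) auto
  also have "\<dots> = (\<integral>p. c ^ DIM('a) * G (c *\<^sub>R p) \<partial>lborel)"
    using G by (subst integral_distr) auto
  finally show ?thesis .
qed

text \<open>Test functions are known only through charts. Stereographic projection misses the pole
  1; composing with s = - 1 gives a second chart that covers it. Its derivative is injective because
  stereographic projection is conformal.\<close>

lemma test_function_continuous:
  assumes "test_function f" "\<bar>s\<bar> = 1"
  shows "continuous_on UNIV (\<lambda>z::quat \<times> (real^3). f (fst z, s *\<^sub>R stereo (snd z)))"
proof -
  define \<phi> where "\<phi> = (\<lambda>u. (fibre_part u, s *\<^sub>R stereo (base_part u)))"
  have sm: "smooth_on UNIV \<phi>"
    unfolding \<phi>_def
    by (intro smooth_on_Pair smooth_on_scaleR smooth_on_const open_UNIV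
        smooth_on_linear[OF open_UNIV bounded_linear_fibre_part]
        smooth_on_compose[OF open_UNIV open_UNIV smooth_on_stereo smooth_on_linear[OF open_UNIV bounded_linear_base_part]]) auto
  have d: "(\<phi> has_derivative (\<lambda>w. (fibre_part w, s *\<^sub>R stereo_deriv (base_part u) (base_part w)))) (at u)" for u
    unfolding \<phi>_def
    by (intro has_derivative_Pair has_derivative_scaleR_right bounded_linear_imp_has_derivative bounded_linear_fibre_part
      has_derivative_compose[OF bounded_linear_imp_has_derivative[OF bounded_linear_base_part] has_derivative_stereo])
  have inj: "inj (\<lambda>w. (fibre_part w, s *\<^sub>R stereo_deriv (base_part u) (base_part w)))" for u
  proof (rule injI)
    fix w w' :: "real^7"
    let ?y = "base_part u"
    assume "(fibre_part w, s *\<^sub>R stereo_deriv ?y (base_part w)) = (fibre_part w', s *\<^sub>R stereo_deriv ?y (base_part w'))"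
    then have f: "fibre_part w = fibre_part w'" and eq: "stereo_deriv ?y (base_part w) = stereo_deriv ?y (base_part w')"
      using assms(2) by auto
    have "linear (stereo_deriv ?y)" using has_derivative_stereo has_derivative_linear by blast
    then have "stereo_deriv ?y (base_part w - base_part w') = 0" using eq by (simp add: linear_diff)
    then have "(2 / ((norm ?y)\<^sup>2 + 1))\<^sup>2 * ((base_part w - base_part w') \<bullet> (base_part w - base_part w')) = 0"
      using stereo_deriv_inner[of ?y "base_part w - base_part w'" "base_part w - base_part w'"] by simp
    then have "base_part w = base_part w'" using norm_square_plus_1_pos[of ?y] by simp
    with f have "split7 w = split7 w'" by (simp add: split7_def)
    then show "w = w'" using join7_split7 by metis
  qed
  have "local_param M UNIV \<phi>"
    unfolding local_param_def
  proof (intro conjI ballI)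
    show "\<phi> ` UNIV \<subseteq> M" using assms(2) by (auto simp: \<phi>_def M_def norm_stereo)
    show "inj (frechet_derivative \<phi> (at u))" for u
      using inj[of u] by (simp add: frechet_derivative_at[OF d, symmetric])
  qed (use sm in auto)
  then have "smooth_on UNIV (f \<circ> \<phi>)" using assms(1) unfolding test_function_def by blast
  then have "continuous_on UNIV (f \<circ> \<phi>)" by (rule smooth_on_imp_continuous_on)
  then have "continuous_on UNIV (\<lambda>z. (f \<circ> \<phi>) (join7 z))"
    by (rule continuous_on_compose2) (auto intro: continuous_on_join7)
  moreover have "(f \<circ> \<phi>) (join7 z) = f (fst z, s *\<^sub>R stereo (snd z))" for z
    using arg_cong[OF split7_join7[of z], of fst] arg_cong[OF split7_join7[of z], of snd]
    by (simp add: \<phi>_def split7_def)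
  ultimately show ?thesis by simp
qed

text \<open>The closed unit ball is mapped onto the hemisphere with nonpositive real part, so two
  compact pieces of charts cover the sphere.\<close>

lemma stereo_hemisphere:
  assumes "norm q = 1"
  obtains s y where "\<bar>s\<bar> = 1" "norm (y::real^3) \<le> 1" "q = s *\<^sub>R stereo y"
proof -
  have main: "\<exists>y. norm y \<le> 1 \<and> stereo y = q" if q: "norm q = 1" "fst q \<le> 0" for q
  proof (intro exI conjI)
    define a where "a = fst q"
    have a: "1 - a > 0" "a \<le> 0" using q by (auto simp: a_def)
    have sq: "(norm (snd q))\<^sup>2 = (1 - a) * (1 + a)"
    proof -
      have "(norm q)\<^sup>2 = a\<^sup>2 + (norm (snd q))\<^sup>2" by (simp add: norm_prod_def a_def)
      then show ?thesis using q by (simp add: power2_eq_square algebra_simps)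
    qed
    have n: "(norm (stereo_inv q))\<^sup>2 = (1 + a) / (1 - a)"
      using a sq by (simp add: stereo_inv_def power_mult_distrib power_divide power2_eq_square flip: a_def)
    also have "\<dots> \<le> 1" using a by (simp add: divide_le_eq)
    finally show "norm (stereo_inv q) \<le> 1" by (simp add: power_le_one_iff abs_square_le_1)
    have n1: "(norm (stereo_inv q))\<^sup>2 + 1 = 2 / (1 - a)" and n2: "(norm (stereo_inv q))\<^sup>2 - 1 = 2 * a / (1 - a)"
      unfolding n using a by (simp_all add: field_simps)
    show "stereo (stereo_inv q) = q"
      unfolding stereo_def n1 n2 using a by (simp add: stereo_inv_def prod_eq_iff flip: a_def)
  qed
  show ?thesis
  proof (cases "fst q \<le> 0")
    case True
    then show ?thesis using main[OF assms] that[of 1] by auto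
  next
    case False
    then have "\<exists>y. norm y \<le> 1 \<and> stereo y = - q" using main[of "- q"] assms by simp
    then show ?thesis using that[of "- 1"] by (metis abs_neg_one minus_minus scaleR_minus1_left)
  qed
qed

text \<open>Boundedness follows from compactness inside the two charts; the bound for the support
  uses only the fibre coordinate, since the sphere is compact.\<close>

lemma test_function_bounded:
  assumes f: "test_function f"
  obtains K T0 where "\<And>x. x \<in> M \<Longrightarrow> \<bar>f x\<bar> \<le> K" "\<And>x. x \<in> M \<Longrightarrow> norm (fst x) > T0 \<Longrightarrow> f x = 0"
proof -
  obtain S where S: "compact S" "\<And>x. x \<in> M - S \<Longrightarrow> f x = 0"
    using f unfolding test_function_def by blast
  obtain T0 where T0: "\<And>x. x \<in> S \<Longrightarrow> norm x \<le> T0"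
    using compact_imp_bounded[OF S(1)] bounded_iff by metis
  have out: "f x = 0" if "x \<in> M" "norm (fst x) > T0" for x
    using that S(2)[of x] T0[of x] norm_fst_le[of "fst x" "snd x"] by fastforce
  have "\<exists>b. \<forall>z\<in>cball 0 T0 \<times> cball 0 1. \<bar>f (fst z, s *\<^sub>R stereo (snd z))\<bar> \<le> b" if "\<bar>s\<bar> = 1" for s
  proof -
    have "bounded ((\<lambda>z. f (fst z, s *\<^sub>R stereo (snd z))) ` (cball 0 T0 \<times> cball 0 1))"
      using test_function_continuous[OF f that]
      by (intro compact_imp_bounded compact_continuous_image compact_Times compact_cball) (auto intro: continuous_on_subset)
    then show ?thesis by (simp add: bounded_iff)
  qed
  then obtain B where B: "\<And>s z. \<bar>s\<bar> = 1 \<Longrightarrow> z \<in> cball 0 T0 \<times> cball 0 1 \<Longrightarrow> \<bar>f (fst z, s *\<^sub>R stereo (snd z))\<bar> \<le> B s"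
    by metis
  show ?thesis
  proof (rule that[of "max (\<bar>B 1\<bar>) (\<bar>B (- 1)\<bar>)"])
    fix x assume x: "x \<in> M"
    then have "norm (snd x) = 1" by (auto simp: M_def)
    then obtain s y where sy: "\<bar>s\<bar> = 1" "norm (y::real^3) \<le> 1" "snd x = s *\<^sub>R stereo y"
      using stereo_hemisphere by metis
    show "\<bar>f x\<bar> \<le> max (\<bar>B 1\<bar>) (\<bar>B (- 1)\<bar>)"
    proof (cases "norm (fst x) > T0")
      case True
      then show ?thesis using out[OF x] by simp
    next
      case False
      then have "\<bar>f (fst x, s *\<^sub>R stereo y)\<bar> \<le> B s"
        using B[OF sy(1), of "(fst x, y)"] sy by simp
      then have "\<bar>f x\<bar> \<le> B s" by (simp flip: sy(3))
      moreover have "s = 1 \<or> s = - 1" using sy(1) by (auto simp: abs_if split: if_splits)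
      ultimately show ?thesis by auto
    qed
  qed (rule out)
qed

text \<open>Dominated convergence is applied twice: on each fibre, where the rescaled integrals
  converge to the instanton energy weighted by f at the zero section, and then over the base with a
  bound independent of the base point.\<close>

theorem curvature_concentration:
  assumes f: "test_function f"
  shows "((\<lambda>x1. \<integral>x. f x * (curv_norm2 (A_clarke x1) x - curv_norm2 A_lim x) \<partial>vol_M)
           \<longlongrightarrow> 8 * pi\<^sup>2 * (\<integral>x. f x \<partial>vol_sing)) at_top"
proof -
  define \<Phi> where "\<Phi> = (\<lambda>z::quat \<times> (real^3). f (fst z, stereo (snd z)))"
  have inM: "(p, stereo y) \<in> M" for p y by (simp add: M_def norm_stereo)
  have cont: "continuous_on UNIV \<Phi>" using test_function_continuous[OF f, of 1] by (simp add: \<Phi>_def)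
  obtain K T0 where K: "\<And>z. \<bar>\<Phi> z\<bar> \<le> K" and T0: "\<And>z. norm (fst z) > T0 \<Longrightarrow> \<Phi> z = 0"
    using test_function_bounded[OF f] inM unfolding \<Phi>_def by (metis fst_conv)
  have K0: "K \<ge> 0" using K[of undefined] by linarith
  have \<Phi>m: "\<Phi> \<in> borel_measurable borel" by (rule borel_measurable_continuous_onI[OF cont])
  have contp: "continuous_on UNIV (\<lambda>p. \<Phi> (p, y))" and conty: "continuous_on UNIV (\<lambda>y. \<Phi> (p, y))" for p y
    by (rule continuous_on_compose2[OF cont]; auto intro!: continuous_intros)+
  have \<Phi>my [measurable]: "(\<lambda>p. \<Phi> (p, y)) \<in> borel_measurable borel" for y
    by (rule borel_measurable_continuous_onI[OF contp])
  have [measurable]: "sphere_density \<in> borel_measurable borel"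
    by (intro borel_measurable_continuous_onI continuous_on_sphere_density)
  obtain C where C: "C > 0" "\<And>e p. \<lbrakk>0 < e; e \<le> 1; norm (sqrt e *\<^sub>R (p::quat)) \<le> T0\<rbrakk> \<Longrightarrow>
    \<bar>e\<^sup>2 * excess_fibre e (sqrt e *\<^sub>R p)\<bar> \<le> C * majorant p"
    using scaled_excess_bound[of T0] by blast
  have DIMq: "DIM(quat) = 4" by simp
  \<comment> \<open>The factor e^2 is the Jacobian of the dilation by sqrt e in four
    dimensions.\<close>
  define g where "g = (\<lambda>e y p. e\<^sup>2 * (\<Phi> (sqrt e *\<^sub>R p, y) * excess_fibre e (sqrt e *\<^sub>R p)))"
  define J where "J = (\<lambda>e y. \<integral>p. g e y p \<partial>lborel)"
  have gm: "g e y \<in> borel_measurable lborel" for e y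
  proof -
    have [measurable]: "(\<lambda>p::quat. sqrt e *\<^sub>R p) \<in> borel_measurable borel" by measurable
    show ?thesis unfolding g_def by measurable
  qed
  have gbound: "\<bar>g e y p\<bar> \<le> K * C * majorant p" if e: "0 < e" "e \<le> 1" for e y p
  proof (cases "norm (sqrt e *\<^sub>R p) > T0")
    case True
    then have "\<Phi> (sqrt e *\<^sub>R p, y) = 0" by (intro T0) simp
    then show ?thesis using K0 C(1) majorant_pos[of p] by (simp add: g_def)
  next
    case False
    then have b: "\<bar>e\<^sup>2 * excess_fibre e (sqrt e *\<^sub>R p)\<bar> \<le> C * majorant p" by (intro C(2) e) simp
    have "\<bar>g e y p\<bar> = \<bar>\<Phi> (sqrt e *\<^sub>R p, y)\<bar> * \<bar>e\<^sup>2 * excess_fibre e (sqrt e *\<^sub>R p)\<bar>"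
      by (simp add: g_def abs_mult)
    also have "\<dots> \<le> K * (C * majorant p)" using b K K0 by (intro mult_mono) auto
    finally show ?thesis by simp
  qed
  have maj: "integrable lborel (\<lambda>p::quat. K * C * majorant p)"
    by (intro integrable_mult_right integrable_majorant) simp
  have e_lim: "filterlim (\<lambda>x1::real. 3 / x1) (at_right 0) at_top" by real_asymp
  have e_ev: "\<forall>\<^sub>F x1 in at_top. 0 < 3 / x1 \<and> 3 / x1 \<le> (1::real)"
    using eventually_ge_at_top[of 3] by eventually_elim (auto simp: divide_le_eq)
  have glim: "((\<lambda>x1. g (3 / x1) y p) \<longlongrightarrow> \<Phi> (0, y) * fibre_density 0 * asd_density p) at_top" for y p
  proof -
    have s0: "((\<lambda>e. sqrt e *\<^sub>R p) \<longlongrightarrow> 0) (at_right 0)"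
      by (auto intro!: tendsto_eq_intros)
    have "isCont (\<lambda>p. \<Phi> (p, y)) 0" "isCont (\<lambda>p::quat. fibre_density (norm p)) 0"
      using contp[of y] continuous_on_fibre_density_norm[of "UNIV :: quat set"] by (simp_all add: continuous_on_eq_continuous_at del: split_paired_All)
    from isCont_tendsto_compose[OF this(1) s0] isCont_tendsto_compose[OF this(2) s0]
    have a: "((\<lambda>e. \<Phi> (sqrt e *\<^sub>R p, y)) \<longlongrightarrow> \<Phi> (0, y)) (at_right 0)"
      "((\<lambda>e. fibre_density (norm (sqrt e *\<^sub>R p))) \<longlongrightarrow> fibre_density 0) (at_right 0)" by simp_all
    have b: "((\<lambda>e. \<Phi> (sqrt e *\<^sub>R p, y) * fibre_density (norm (sqrt e *\<^sub>R p)) * (e\<^sup>2 * excess e (r_of_t (sqrt e * norm p))))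
        \<longlongrightarrow> \<Phi> (0, y) * fibre_density 0 * asd_density p) (at_right 0)"
      unfolding asd_density_def by (intro tendsto_mult a scaled_excess_tendsto) simp
    have "((\<lambda>e. g e y p) \<longlongrightarrow> \<Phi> (0, y) * fibre_density 0 * asd_density p) (at_right 0)"
    proof (rule Lim_transform_eventually[OF b])
      show "\<forall>\<^sub>F e in at_right 0. \<Phi> (sqrt e *\<^sub>R p, y) * fibre_density (norm (sqrt e *\<^sub>R p)) * (e\<^sup>2 * excess e (r_of_t (sqrt e * norm p)))
         = g e y p"
        using eventually_at_right_less[of 0] by eventually_elim (simp add: g_def excess_fibre_def)
    qed
    from filterlim_compose[OF this e_lim] show ?thesis .
  qed
  have Jlim: "((\<lambda>x1. J (3 / x1) y) \<longlongrightarrow> \<Phi> (0, y) * fibre_density 0 * (8 * pi\<^sup>2)) at_top" for y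
  proof -
    have "((\<lambda>x1. \<integral>p. g (3 / x1) y p \<partial>lborel) \<longlongrightarrow> (\<integral>p. \<Phi> (0, y) * fibre_density 0 * asd_density p \<partial>lborel)) at_top"
    proof (rule integral_dominated_convergence_at_top[OF _ gm maj])
      show "(\<lambda>p. \<Phi> (0, y) * fibre_density 0 * asd_density p) \<in> borel_measurable lborel"
        using borel_measurable_integrable[OF asd_energy(1)] by measurable
      show "AE p in lborel. ((\<lambda>x1. g (3 / x1) y p) \<longlongrightarrow> \<Phi> (0, y) * fibre_density 0 * asd_density p) at_top"
        using glim by simp
      show "\<forall>\<^sub>F x1 in at_top. AE p in lborel. norm (g (3 / x1) y p) \<le> K * C * majorant p"
        using e_ev by eventually_elim (use gbound in auto)
    qed
    then show ?thesis by (simp add: J_def asd_energy(2))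
  qed
  \<comment> \<open>Independent of e and of the base point, so a multiple of the sphere density
    dominates the outer integral.\<close>
  define L where "L = (\<integral>p. K * C * majorant (p::quat) \<partial>lborel)"
  have Jbound: "\<bar>J e y\<bar> \<le> L" if e: "0 < e" "e \<le> 1" for e y
  proof -
    have gi: "integrable lborel (g e y)"
      by (rule Bochner_Integration.integrable_bound[OF maj gm])
        (use gbound[OF e] in \<open>auto intro!: AE_I2 intro: order_trans[OF _ abs_ge_self]\<close>)
    have "\<bar>J e y\<bar> \<le> (\<integral>p. \<bar>g e y p\<bar> \<partial>lborel)"
      unfolding J_def using integral_norm_bound[of lborel "g e y"] by simp
    also have "\<dots> \<le> L"
      unfolding L_def using gi maj gbound[OF e]
      by (intro integral_mono integrable_abs) auto
    finally show ?thesis .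
  qed
  \<comment> \<open>The fibre integral is made the inner one, and the dilation is carried out only
    there.\<close>
  have fold: "(\<integral>x. f x * (curv_norm2 (A_clarke x1) x - curv_norm2 A_lim x) \<partial>vol_M)
      = (\<integral>y. J (3 / x1) y * sphere_density y \<partial>lborel)" if x1: "x1 > 0" for x1
  proof -
    define e where "e = 3 / x1"
    have e: "e > 0" using x1 by (simp add: e_def)
    have "(\<integral>x. f x * (curv_norm2 (A_clarke x1) x - curv_norm2 A_lim x) \<partial>vol_M)
        = (\<integral>z. \<Phi> z * excess_fibre e (fst z) * sphere_density (snd z) \<partial>lborel)"
      unfolding \<Phi>_def e_def using cont K unfolding \<Phi>_def by (rule vol_M_integral(2)[OF x1])
    also have "\<dots> = (\<integral>y. (\<integral>p. \<Phi> (p, y) * excess_fibre e p * sphere_density y \<partial>lborel) \<partial>lborel)"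
    proof -
      have "integrable (lborel \<Otimes>\<^sub>M lborel) (case_prod (\<lambda>p y. \<Phi> (p, y) * excess_fibre e p * sphere_density y))"
        using integrable_excess_product[OF e \<Phi>m K] by (simp add: lborel_prod split_def)
      from lborel_pair.integral_snd[OF this] show ?thesis
        by (simp add: lborel_prod split_def)
    qed
    also have "\<dots> = (\<integral>y. J e y * sphere_density y \<partial>lborel)"
    proof (rule Bochner_Integration.integral_cong[OF refl])
      fix y :: "real^3"
      have "(\<integral>p. \<Phi> (p, y) * excess_fibre e p * sphere_density y \<partial>lborel)
          = (\<integral>p. \<Phi> (p, y) * excess_fibre e p \<partial>lborel) * sphere_density y" by simp
      also have "(\<integral>p. \<Phi> (p, y) * excess_fibre e p \<partial>lborel)
          = (\<integral>p. sqrt e ^ DIM(quat) * (\<Phi> (sqrt e *\<^sub>R p, y) * excess_fibre e (sqrt e *\<^sub>R p)) \<partial>lborel)"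
        using e by (intro integral_scale) auto
      also have "sqrt e ^ DIM(quat) = e\<^sup>2"
      proof -
        have "sqrt e ^ 4 = ((sqrt e)\<^sup>2)\<^sup>2" by (simp only: power_mult[symmetric]) simp
        then show ?thesis using e unfolding DIMq by simp
      qed
      finally show "(\<integral>p. \<Phi> (p, y) * excess_fibre e p * sphere_density y \<partial>lborel) = J e y * sphere_density y"
        by (simp add: J_def g_def)
    qed
    finally show ?thesis by (simp add: e_def)
  qed
  have Jm: "J e \<in> borel_measurable lborel" for e
  proof -
    have [measurable]: "\<Phi> \<in> borel_measurable (lborel \<Otimes>\<^sub>M lborel)"
      using \<Phi>m by (simp add: lborel_prod)
    have [measurable]: "(\<lambda>z::(real^3) \<times> quat. \<Phi> (sqrt e *\<^sub>R snd z, fst z)) \<in> borel_measurable (lborel \<Otimes>\<^sub>M lborel)"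
    proof -
      have "continuous_on UNIV (\<lambda>z::(real^3) \<times> quat. \<Phi> (sqrt e *\<^sub>R snd z, fst z))"
        by (rule continuous_on_compose2[OF cont]) (auto intro!: continuous_intros)
      then show ?thesis using borel_measurable_continuous_onI by (simp add: lborel_prod)
    qed
    have "(\<lambda>z::(real^3) \<times> quat. g e (fst z) (snd z)) \<in> borel_measurable (lborel \<Otimes>\<^sub>M lborel)"
      unfolding g_def by measurable
    then have "case_prod (g e) \<in> borel_measurable (lborel \<Otimes>\<^sub>M lborel)"
      by (simp add: split_def)
    then show ?thesis unfolding J_def by (rule lborel.borel_measurable_lebesgue_integral)
  qed
  have "((\<lambda>x1. \<integral>y. J (3 / x1) y * sphere_density y \<partial>lborel)
      \<longlongrightarrow> (\<integral>y. \<Phi> (0, y) * fibre_density 0 * (8 * pi\<^sup>2) * sphere_density y \<partial>lborel)) at_top"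
  proof (rule integral_dominated_convergence_at_top[where w = "\<lambda>y. L * sphere_density y"])
    show "(\<lambda>y. \<Phi> (0, y) * fibre_density 0 * (8 * pi\<^sup>2) * sphere_density y) \<in> borel_measurable lborel"
      using borel_measurable_continuous_onI[OF conty[of 0]] by measurable
    show "(\<lambda>y. J (3 / x1) y * sphere_density y) \<in> borel_measurable lborel" for x1
      using Jm[of "3 / x1"] by measurable
    show "integrable lborel (\<lambda>y. L * sphere_density y)"
      by (intro integrable_mult_right integrable_sphere_density)
    show "AE y in lborel. ((\<lambda>x1. J (3 / x1) y * sphere_density y) \<longlongrightarrow> \<Phi> (0, y) * fibre_density 0 * (8 * pi\<^sup>2) * sphere_density y) at_top"
      by (intro AE_I2 tendsto_mult Jlim tendsto_const)
    show "\<forall>\<^sub>F x1 in at_top. AE y in lborel. norm (J (3 / x1) y * sphere_density y) \<le> L * sphere_density y"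
      using e_ev
    proof eventually_elim
      case (elim x1)
      then show ?case
        using Jbound[of "3 / x1"] sphere_density_pos
        by (auto simp: abs_mult less_imp_le intro!: AE_I2 mult_mono)
    qed
  qed
  moreover have "(\<integral>y. \<Phi> (0, y) * fibre_density 0 * (8 * pi\<^sup>2) * sphere_density y \<partial>lborel) = 8 * pi\<^sup>2 * (\<integral>x. f x \<partial>vol_sing)"
  proof -
    have "(\<integral>x. f x \<partial>vol_sing) = (\<integral>y. fibre_density 0 * sphere_density y * \<Phi> (0, y) \<partial>lborel)"
      using vol_sing_integral[of f] conty[of 0] by (simp add: \<Phi>_def)
    moreover have "(\<lambda>y. \<Phi> (0, y) * fibre_density 0 * (8 * pi\<^sup>2) * sphere_density y)
        = (\<lambda>y. 8 * pi\<^sup>2 * (fibre_density 0 * sphere_density y * \<Phi> (0, y)))"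
      by (simp add: fun_eq_iff)
    ultimately show ?thesis by (simp only: integral_mult_right_zero)
  qed
  ultimately have "((\<lambda>x1. \<integral>y. J (3 / x1) y * sphere_density y \<partial>lborel) \<longlongrightarrow> 8 * pi\<^sup>2 * (\<integral>x. f x \<partial>vol_sing)) at_top"
    by simp
  then show ?thesis
  proof (rule Lim_transform_eventually)
    show "\<forall>\<^sub>F x1 in at_top. (\<integral>y. J (3 / x1) y * sphere_density y \<partial>lborel)
        = (\<integral>x. f x * (curv_norm2 (A_clarke x1) x - curv_norm2 A_lim x) \<partial>vol_M)"
      using eventually_gt_at_top[of 0] by eventually_elim (rule fold[symmetric])
  qed
qed

theorem theorem2:
  shows
    "(\<forall>l>0. \<exists>\<delta> :: real \<Rightarrow> real.
        (\<forall>x1>0. \<delta> x1 > 0) \<and> (\<delta> \<longlongrightarrow> 0) at_top \<and>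
        (\<forall>p\<in>sphere 0 1.
           converges_with_derivs (ball 0 1) (ball 0 1)
             (\<lambda>x1. pullback (slice (\<delta> x1) p) (A_clarke x1)) (A_ASD l) at_top))
     \<and>
     (\<forall>K. compact K \<and> K \<subseteq> M_reg \<longrightarrow>
        converges_with_derivs_on_compact M_reg K A_clarke A_lim at_top)
     \<and>
     (\<forall>x1>0. integrable vol_M (\<lambda>x. curv_norm2 (A_clarke x1) x - curv_norm2 A_lim x))
     \<and>
     (\<forall>f. test_function f \<longrightarrow>
        ((\<lambda>x1. \<integral>x. f x * (curv_norm2 (A_clarke x1) x - curv_norm2 A_lim x) \<partial>vol_M)
           \<longlongrightarrow> 8 * pi\<^sup>2 * (\<integral>x. f x \<partial>vol_sing)) at_top)"
proof (intro conjI allI impI)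
  fix l :: real assume l: "l > 0"
  have "((\<lambda>x1. sqrt (2 * l / x1)) \<longlongrightarrow> 0) at_top" using l by real_asymp
  with l show "\<exists>\<delta> :: real \<Rightarrow> real.
        (\<forall>x1>0. \<delta> x1 > 0) \<and> (\<delta> \<longlongrightarrow> 0) at_top \<and>
        (\<forall>p\<in>sphere 0 1.
           converges_with_derivs (ball 0 1) (ball 0 1)
             (\<lambda>x1. pullback (slice (\<delta> x1) p) (A_clarke x1)) (A_ASD l) at_top)"
    by (intro exI[of _ "\<lambda>x1. sqrt (2 * l / x1)"]) (simp add: bubbling)
next
  show "integrable vol_M (\<lambda>x. curv_norm2 (A_clarke x1) x - curv_norm2 A_lim x)" if "x1 > 0" for x1
    \<comment> \<open>The constant 1 is bounded and continuous in the chart, although it has no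
      compact support.\<close>
    using vol_M_integral(1)[OF that, of "\<lambda>_. 1" 1] by simp
qed (simp_all add: convergence_away_from_orbit curvature_concentration)

end
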